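(* Fix $0\le\alpha<1$. Suppose that $X_1,\ldots,X_n$ is a random sample from $P_\bullet$, where $P_\bullet$ is the size-biased presentation of limit frequencies of a Gibbs$(\alpha)$ partition of positive integers, and let $p$ be the EPPF of that Gibbs$(\alpha)$ partition. Then the probability function of $N^{X\uparrow}_{\bullet:n}$, the sequence of sizes of clusters of $X$-values in increasing order of those values, is given by $$\mathbb{P}\bigl[N^{X\uparrow}_{\bullet:n}=(n_1,\ldots,n_k)\bigr]=\binom{n}{n_1,\ldots,n_k}\left(\prod_{i=1}^k\frac{n_i-\alpha}{(n_i-\alpha)+\cdots+(n_k-\alpha)}\right)p(n_1,\ldots,n_k)$$ for each composition $(n_1,\ldots,n_k)$ of $n$. Moreover, $N^{X\uparrow}_{\bullet:n}$ is a $(\text{size}-\alpha)$-biased permutation of the appearance-ordered cluster sizes $N^{*}_{\bullet:n}$: given $N^{*}_{\bullet:n}=(n_1,\ldots,n_k)$, the conditional distribution of $N^{X\uparrow}_{\bullet:n}$ is that of a $(\text{size}-\alpha)$-biased random permutation of $(n_1,\ldots,n_k)$, where the probability function of $N^{*}_{\bullet:n}$ is $$\mathbb{P}\bigl[N^{*}_{\bullet:n}=(n_1,\ldots,n_k)\bigr]=\binom{n}{n_1,\ldots,n_k}\left(\prod_{i=1}^k\frac{n_i}{n_i+\cdots+n_k}\right)p(n_1,\ldots,n_k).$$ In particular this applies to $P_\bullet$ with $\mathsf{GEM}(\alpha,\theta)$ distribution, $\theta>-\alpha$, with $p$ the EPPF corresponding to the weights $V_{k:n}=\frac{1}{(1+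\theta)_{n-1}}\prod_{i=1}^{k-1}(\theta+i\alpha)$.
   Context: Gibbs$(\alpha)$ partition: an exchangeable random partition of $\mathbb{N}=\{1,2,\ldots\}$ is a sequence $(\Pi_n)$ of random partitions of $[n]=\{1,\ldots,n\}$, with $\Pi_m$ the restriction of $\Pi_n$ to $[m]$ for $m<n$, such that for each $n$ and each partition $\{C_1,\ldots,C_k\}$ of $[n]$, $\mathbb{P}(\Pi_n=\{C_1,\ldots,C_k\})=p(\#C_1,\ldots,\#C_k)$ for some symmetric function $p$ (the exchangeable partition probability function, EPPF). It is a Gibbs$(\alpha)$ partition if $p(n_1,\ldots,n_k)=V_{k:n}\prod_{i=1}^k(1-\alpha)_{n_i-1}$ with $n=\sum_i n_i$ and $(x)_m=\Gamma(x+m)/\Gamma(x)$, for some positive weights $V_{k:n}$, $1\le k\le n$, satisfying $V_{k:n}=(n-k\alpha)V_{k:n+1}+V_{k+1:n+1}$ for all $1\le k\le n$. The size-biased presentation of its limit frequencies is $P_\bullet=(P_1,P_2,\ldots)$ where $P_j$ is the almost sure limit as $n\to\infty$ of $1/n$ times the size of the $j$th cluster of $\Pi_n$ in order of appearance (order of least elements). It is assumed that $P_j>0$ for all $j$ and $\sum_jP_j=1$ almost surely. $\mathsf{GEM}(\alpha,\theta)$ distribution: the law of $P_\bullet$ with $P_j = H_j\prod_{i=1}^{j-1}(1-H_i)$, where the $H_i$ are independent and $H_i$ has the beta$(1-\alpha,\theta+i\alpha)$ distribution. It is known that this is the law of the size-biased presentation of limit frequencies of the Gibbs$(\alpha)$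 partition with weights $V_{k:n}=\frac{1}{(1+\theta)_{n-1}}\prod_{i=1}^{k-1}(\theta+i\alpha)$. A random sample from $P_\bullet$ is a sequence which, conditionally given $P_\bullet$, is i.i.d. with $\mathbb{P}(X_i=j\mid P_\bullet)=P_j$, $j\ge1$. The clusters of the sample are the equivalence classes of $[n]$ under $i\sim j\iff X_i=X_j$. $N^{X\uparrow}_{\bullet:n}$ lists the cluster sizes in increasing order of the common $X$-values of the clusters, and $N^{*}_{\bullet:n}$ lists the cluster sizes in order of appearance (order of least elements). A composition of $n$ is a finite sequence of strictly positive integers with sum $n$. A $(\text{size}-\alpha)$-biased random permutation of $(n_1,\ldots,n_k)$ is $(n_{\pi(1)},\ldots,n_{\pi(k)})$ where $\pi$ is a random permutation of $[k]$ with $\mathbb{P}(\pi=\sigma)=\prod_{i=1}^k \frac{n_{\sigma(i)}-\alpha}{\sum_{j=i}^k (n_{\sigma(j)}-\alpha)}$ for each permutation $\sigma$ of $[k]$. *)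

theory Defs
  imports "HOL-Probability.Probability" "HOL-Combinatorics.Permutations"
begin

section \<open>Compositions and size-biased products\<close>

definition composition :: "nat \<Rightarrow> nat list \<Rightarrow> bool" where
  "composition n ns \<longleftrightarrow> (\<forall>m\<in>set ns. 0 < m) \<and> sum_list ns = n"

definition multinomial :: "nat list \<Rightarrow> real" where
  "multinomial ns = fact (sum_list ns) / (\<Prod>i<length ns. fact (ns ! i))"

definition size_biased_weight :: "real \<Rightarrow> nat list \<Rightarrow> real" where
  "size_biased_weight \<alpha> ns =
     (\<Prod>i<length ns. (real (ns ! i) - \<alpha>) / (\<Sum>j=i..<length ns. real (ns ! j) - \<alpha>))"

text \<open>
  The probability that a \<open>(size - \<alpha>)\<close>-biased random permutation of \<open>ns\<close> equals \<open>ms\<close>. A permutation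
  \<open>\<sigma>\<close> of the indices has probability \<open>size_biased_weight \<alpha> (permute_list \<sigma> ns)\<close>; several \<open>\<sigma>\<close> give
  the same list when \<open>ns\<close> has repeated entries, hence the sum.
\<close>
definition size_biased_perm_prob :: "real \<Rightarrow> nat list \<Rightarrow> nat list \<Rightarrow> real" where
  "size_biased_perm_prob \<alpha> ns ms =
     (\<Sum>\<sigma> | \<sigma> permutes {..<length ns} \<and> permute_list \<sigma> ns = ms.
        size_biased_weight \<alpha> (permute_list \<sigma> ns))"

section \<open>Exchangeable and Gibbs partitions\<close>

text \<open>Cluster sizes of a partition of a finite set of naturals, in order of least elements.\<close>
definition appearance_sizes :: "nat set set \<Rightarrow> nat list" where
  "appearance_sizes A = map card (sorted_key_list_of_set Min A)"

text \<open>
  \<open>Q n\<close> is the random partition of \<open>{1..n}\<close>; the value \<open>Q 0\<close> is irrelevant. The cluster sizes are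
  passed to the EPPF \<open>p\<close> as a list, and \<open>p\<close> matters only on compositions of positive integers.
\<close>
definition exchangeable_partition ::
  "'w measure \<Rightarrow> (nat \<Rightarrow> 'w \<Rightarrow> nat set set) \<Rightarrow> (nat list \<Rightarrow> real) \<Rightarrow> bool" where
  "exchangeable_partition M Q p \<longleftrightarrow>
     (\<forall>n\<ge>1. Q n \<in> M \<rightarrow>\<^sub>M count_space {A. partition_on {1..n} A}) \<and>
     (\<forall>m n. 1 \<le> m \<and> m < n \<longrightarrow>
        (\<forall>w\<in>space M. Q m w = (\<lambda>C. C \<inter> {1..m}) ` Q n w - {{}})) \<and>
     (\<forall>n\<ge>1. \<forall>ns ms. composition n ns \<and> mset ms = mset ns \<longrightarrow> p ms = p ns) \<and>
     (\<forall>n\<ge>1. \<forall>Cs. distinct Cs \<and> partition_on {1..n} (set Cs) \<longrightarrow>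
        \<P>(w in M. Q n w = set Cs) = p (map card Cs))"

text \<open>\<open>V k n\<close> is the weight for partitions of \<open>{1..n}\<close> into \<open>k\<close> clusters.\<close>
definition gibbs_weights :: "real \<Rightarrow> (nat \<Rightarrow> nat \<Rightarrow> real) \<Rightarrow> bool" where
  "gibbs_weights \<alpha> V \<longleftrightarrow>
     (\<forall>n k. 1 \<le> k \<and> k \<le> n \<longrightarrow>
        0 < V k n \<and> V k n = (real n - real k * \<alpha>) * V k (n + 1) + V (k + 1) (n + 1))"

definition gibbs_eppf :: "real \<Rightarrow> (nat \<Rightarrow> nat \<Rightarrow> real) \<Rightarrow> nat list \<Rightarrow> real" where
  "gibbs_eppf \<alpha> V ns =
     V (length ns) (sum_list ns) * (\<Prod>i<length ns. pochhammer (1 - \<alpha>) (ns ! i - 1))"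

definition gibbs_partition ::
  "'w measure \<Rightarrow> real \<Rightarrow> (nat \<Rightarrow> 'w \<Rightarrow> nat set set) \<Rightarrow> (nat list \<Rightarrow> real) \<Rightarrow> bool" where
  "gibbs_partition M \<alpha> Q p \<longleftrightarrow>
     exchangeable_partition M Q p \<and>
     (\<exists>V. gibbs_weights \<alpha> V \<and> (\<forall>n\<ge>1. \<forall>ns. composition n ns \<longrightarrow> p ns = gibbs_eppf \<alpha> V ns))"

text \<open>
  Frequencies are indexed from 1, so \<open>P 0\<close> is never used. The \<open>j\<close>th cluster of \<open>Q n w\<close> has size 0
  if there are fewer than \<open>j\<close> clusters.
\<close>
definition size_biased_limit_freqs ::
  "'w measure \<Rightarrow> (nat \<Rightarrow> 'w \<Rightarrow> nat set set) \<Rightarrow> (nat \<Rightarrow> 'w \<Rightarrow> real) \<Rightarrow> bool" where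
  "size_biased_limit_freqs M Q P \<longleftrightarrow>
     (\<forall>j\<ge>1. AE w in M.
        (\<lambda>n. (if j \<le> length (appearance_sizes (Q n w))
              then real (appearance_sizes (Q n w) ! (j - 1)) else 0) / real n) \<longlonglongrightarrow> P j w)"

definition proper_freqs :: "'w measure \<Rightarrow> (nat \<Rightarrow> 'w \<Rightarrow> real) \<Rightarrow> bool" where
  "proper_freqs M P \<longleftrightarrow>
     (AE w in M. (\<forall>j\<ge>1. 0 < P j w) \<and> ((\<lambda>j. P j w) has_sum 1) {1..})"

section \<open>The GEM distribution\<close>

definition beta_distribution :: "real \<Rightarrow> real \<Rightarrow> real measure" where
  "beta_distribution a b = density lborel
     (\<lambda>x. ennreal (indicator {0<..<1} x * (x powr (a - 1) * (1 - x) powr (b - 1)) / Beta a b))"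

abbreviation seq_space :: "(nat \<Rightarrow> real) measure" where
  "seq_space \<equiv> (\<Pi>\<^sub>M j\<in>{1..}. borel)"

abbreviation freq_seq :: "(nat \<Rightarrow> 'w \<Rightarrow> real) \<Rightarrow> 'w \<Rightarrow> nat \<Rightarrow> real" where
  "freq_seq P w \<equiv> (\<lambda>j\<in>{1..}. P j w)"

definition stick_breaking :: "(nat \<Rightarrow> real) \<Rightarrow> nat \<Rightarrow> real" where
  "stick_breaking h = (\<lambda>j\<in>{1..}. h j * (\<Prod>i\<in>{1..<j}. 1 - h i))"

definition GEM :: "real \<Rightarrow> real \<Rightarrow> (nat \<Rightarrow> real) measure" where
  "GEM \<alpha> \<theta> =
     distr (\<Pi>\<^sub>M i\<in>{1..}. beta_distribution (1 - \<alpha>) (\<theta> + real i * \<alpha>)) seq_space stick_breaking"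

definition GEM_weights :: "real \<Rightarrow> real \<Rightarrow> nat \<Rightarrow> nat \<Rightarrow> real" where
  "GEM_weights \<alpha> \<theta> k n =
     1 / pochhammer (1 + \<theta>) (n - 1) * (\<Prod>i\<in>{1..<k}. \<theta> + real i * \<alpha>)"

lemma gibbs_weights_GEM_weights:
  assumes "0 \<le> \<alpha>" "\<alpha> < 1" "- \<alpha> < \<theta>"
  shows "gibbs_weights \<alpha> (GEM_weights \<alpha> \<theta>)"
  unfolding gibbs_weights_def
proof (intro allI impI)
  fix n k :: nat
  assume kn: "1 \<le> k \<and> k \<le> n"
  have pos: "0 < \<theta> + real i * \<alpha>" if "1 \<le> i" for i
    using assms that mult_right_mono[of 1 "real i" \<alpha>] by simp
  have poch: "0 < pochhammer (1 + \<theta>) m" for m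
    using assms by (intro pochhammer_pos) simp
  obtain m where n: "n = Suc m" using kn by (cases n) auto
  have nz: "1 + \<theta> + real m \<noteq> 0" using assms by linarith
  have *: "pochhammer (1 + \<theta>) n = (1 + \<theta> + real m) * pochhammer (1 + \<theta>) m"
    by (simp add: n pochhammer_Suc)
  define W where "W = (\<Prod>i\<in>{1..<k}. \<theta> + real i * \<alpha>)"
  have W: "(\<Prod>i\<in>{1..<k + 1}. \<theta> + real i * \<alpha>) = W * (\<theta> + real k * \<alpha>)"
    unfolding W_def using kn by (simp add: prod.atLeastLessThan_Suc)
  have "0 < GEM_weights \<alpha> \<theta> k n"
    unfolding GEM_weights_def using pos poch by (intro mult_pos_pos prod_pos divide_pos_pos) auto
  moreover have "GEM_weights \<alpha> \<theta> k n =
      (real n - real k * \<alpha>) * GEM_weights \<alpha> \<theta> k (n + 1) + GEM_weights \<alpha> \<theta> (k + 1) (n + 1)"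
  proof -
    have "(real n - real k * \<alpha>) * GEM_weights \<alpha> \<theta> k (n + 1) + GEM_weights \<alpha> \<theta> (k + 1) (n + 1)
        = (1 + \<theta> + real m) * W / pochhammer (1 + \<theta>) n"
      unfolding GEM_weights_def W W_def[symmetric]
      by (simp add: n add_divide_distrib[symmetric] algebra_simps)
    also have "\<dots> = W / pochhammer (1 + \<theta>) m"
      using nz by (simp add: *)
    finally show ?thesis
      by (simp add: GEM_weights_def n W_def)
  qed
  ultimately show "0 < GEM_weights \<alpha> \<theta> k n \<and> GEM_weights \<alpha> \<theta> k n =
      (real n - real k * \<alpha>) * GEM_weights \<alpha> \<theta> k (n + 1) + GEM_weights \<alpha> \<theta> (k + 1) (n + 1)"
    by blast
qed

section \<open>Random samples and their clusters\<close>

text \<open>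
  The sample is \<open>X 1, \<dots>, X n\<close>. Conditioning is on the sigma-algebra generated by \<open>P 1, P 2, \<dots>\<close>;
  for discrete variables, conditional independence with marginals \<open>P\<close> means that the conditional
  probability of each outcome \<open>(x 1, \<dots>, x n)\<close> is the product of the \<open>P (x i)\<close>.
\<close>
definition random_sample ::
  "'w measure \<Rightarrow> (nat \<Rightarrow> 'w \<Rightarrow> real) \<Rightarrow> nat \<Rightarrow> (nat \<Rightarrow> 'w \<Rightarrow> nat) \<Rightarrow> bool" where
  "random_sample M P n X \<longleftrightarrow>
     (\<forall>j\<ge>1. P j \<in> borel_measurable M) \<and>
     (\<forall>i\<in>{1..n}. X i \<in> M \<rightarrow>\<^sub>M count_space {1..}) \<and>
     (\<forall>x\<in>{1..n} \<rightarrow> {1..}. AE w in M.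
        real_cond_exp M (vimage_algebra (space M) (freq_seq P) seq_space)
          (indicator {w\<in>space M. \<forall>i\<in>{1..n}. X i w = x i}) w = (\<Prod>i\<in>{1..n}. P (x i) w))"

definition sample_clusters :: "nat \<Rightarrow> (nat \<Rightarrow> 'w \<Rightarrow> nat) \<Rightarrow> 'w \<Rightarrow> nat set set" where
  "sample_clusters n X w = {1..n} // {(i, j). i \<in> {1..n} \<and> j \<in> {1..n} \<and> X i w = X j w}"

definition N_app :: "nat \<Rightarrow> (nat \<Rightarrow> 'w \<Rightarrow> nat) \<Rightarrow> 'w \<Rightarrow> nat list" where
  "N_app n X w = appearance_sizes (sample_clusters n X w)"

text \<open>All members of a cluster share their \<open>X\<close>-value, so it can be read off at the least one.\<close>
definition N_inc :: "nat \<Rightarrow> (nat \<Rightarrow> 'w \<Rightarrow> nat) \<Rightarrow> 'w \<Rightarrow> nat list" where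
  "N_inc n X w = map card (sorted_key_list_of_set (\<lambda>C. X (Min C) w) (sample_clusters n X w))"

definition cluster_size_laws ::
  "'w measure \<Rightarrow> real \<Rightarrow> (nat list \<Rightarrow> real) \<Rightarrow> nat \<Rightarrow> (nat \<Rightarrow> 'w \<Rightarrow> nat) \<Rightarrow> bool" where
  "cluster_size_laws M \<alpha> p n X \<longleftrightarrow>
     (\<forall>ns. composition n ns \<longrightarrow>
        \<P>(w in M. N_inc n X w = ns) = multinomial ns * size_biased_weight \<alpha> ns * p ns) \<and>
     (\<forall>ns ms. composition n ns \<longrightarrow>
        \<P>(w in M. N_inc n X w = ms \<bar> N_app n X w = ns) = size_biased_perm_prob \<alpha> ns ms) \<and>
     (\<forall>ns. composition n ns \<longrightarrow>
        \<P>(w in M. N_app n X w = ns) = multinomial ns * size_biased_weight 0 ns * p ns)"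

end

theory Submission
  imports Defs "HOL-Combinatorics.Multiset_Permutations"
begin

text \<open>
  Write \<open>w ns\<close> for the product of the factors \<open>(n\<^sub>i - \<alpha>) / ((n\<^sub>i - \<alpha>) + \<dots> + (n\<^sub>k - \<alpha>))\<close> and \<open>p\<close> for
  the EPPF. All three laws follow from one statement about ordered set partitions: for every list
  \<open>Cs\<close> of blocks partitioning \<open>{1..n}\<close>, the clusters of the sample, read in increasing order of
  their \<open>X\<close>-values, are exactly \<open>Cs\<close> with probability \<open>w ns * p ns\<close>, where \<open>ns\<close> lists the sizes of
  \<open>Cs\<close> (\<open>value_order_prob\<close>). Summing over the ordered partitions with given sizes, of which there
  are a multinomial number, gives the law of \<open>N_inc\<close>. Since \<open>p\<close> is symmetric and \<open>w\<close> sums to 1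
  over all orderings of a fixed set of blocks, the unordered partition has probability \<open>p\<close> and,
  given the partition, the ordering is \<open>(size - \<alpha>)\<close>-biased; this gives the other two laws (\<open>cluster_size_laws_of_bound\<close>).

  The probability in question is the supremum over \<open>K\<close> of the sums of
  \<open>E (P j\<^sub>1 ^ n\<^sub>1 * \<dots> * P j\<^sub>k ^ n\<^sub>k)\<close> over \<open>1 \<le> j\<^sub>1 < \<dots> < j\<^sub>k \<le> K\<close>. It is enough to bound these
  sums by \<open>w ns * p ns\<close>: the probabilities of all ordered partitions add up to 1, and so do the
  bounds, because \<open>w\<close> sums to 1 over orderings and \<open>p\<close> sums to 1 over set partitions. Hence no
  bound can be strict.

  For a Gibbs partition the bound expresses the following mechanism. Start with \<open>k\<close> clusters of
  sizes \<open>n\<^sub>1, \<dots>, n\<^sub>k\<close>, whose probability is \<open>p ns\<close>, and let further elements arrive. Each new element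
  joins a cluster of current size \<open>m\<close> with weight proportional to \<open>m - \<alpha>\<close>. So, whenever an element
  joins one of those initial clusters that no new element has joined before, the choice among them
  is proportional to \<open>n\<^sub>i - \<alpha>\<close>, whatever has happened so far. The order in which the initial
  clusters are discovered by new elements is therefore \<open>(size - \<alpha>)\<close>-biased, and
  \<open>w ns * p ns\<close> dominates the probability that they arise and are all discovered, in the listed
  order, by the first \<open>N\<close> new elements (\<open>funpow_grow_placements_le\<close>). If the new elements are read
  first, the same event says that the additional \<open>n\<close> elements fall into the clusters of ranks
  \<open>j\<^sub>1 < \<dots> < j\<^sub>k\<close> by order of appearance, with multiplicities \<open>n\<^sub>1, \<dots>, n\<^sub>k\<close>; its probability is
  a moment of the limit frequencies (\<open>moment_given_label_word\<close>).

  For the GEM distribution the moments are products of beta moments. Splitting off the first stick,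
  which either is \<open>P j\<^sub>1\<close> or is not, leaves a GEM sequence with parameter \<open>\<theta> + \<alpha>\<close>, and the right-hand
  side \<open>w ns * p ns\<close> satisfies the resulting recursion with equality (\<open>gibbs_eppf_GEM_rec\<close>); the
  bound follows by induction on the number of sticks (\<open>GEM_inc_sum_le\<close>).
\<close>

section \<open>Growing lists of cluster sizes\<close>

definition bump :: "nat \<Rightarrow> nat \<Rightarrow> nat list \<Rightarrow> nat list" where
  "bump j m c = c[j := c ! j + m]"

text \<open>
  The sum of \<open>h\<close> over all ways of adding one element to clusters of sizes \<open>c\<close>: to an existing
  cluster, or as a new singleton listed last. Iterates of \<open>grow\<close> thus sum a function over all
  histories of a growing partition.
\<close>
definition grow :: "(nat list \<Rightarrow> real) \<Rightarrow> nat list \<Rightarrow> real" where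
  "grow h c = (\<Sum>i<length c. h (bump i 1 c)) + h (c @ [1])"

lemma length_bump [simp]: "length (bump j m c) = length c"
  by (simp add: bump_def)

lemma bump_commute: "bump i a (bump j b c) = bump j b (bump i a c)"
  by (cases "i = j"; cases "i < length c"; cases "j < length c")
     (auto simp: bump_def list_update_swap list_update_beyond ac_simps)

lemma bump_append1: "j < length c \<Longrightarrow> bump j m (c @ d) = bump j m c @ d"
  by (simp add: bump_def list_update_append nth_append)

lemma bump_append2: "bump (length c) m (c @ n # d) = c @ (n + m) # d"
  by (simp add: bump_def list_update_append)

lemma grow_cong:
  assumes "\<And>c'. length c \<le> length c' \<Longrightarrow> f c' = g c'"
  shows "grow f c = grow g c"
  unfolding grow_def using assms by simp

lemma funpow_grow_cong:
  assumes "\<And>c'. length c \<le> length c' \<Longrightarrow> f c' = g c'"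
  shows "(grow ^^ N) f c = (grow ^^ N) g c"
  using assms
proof (induction N arbitrary: c)
  case (Suc N)
  show ?case by (auto intro!: grow_cong Suc)
qed simp

lemma funpow_grow_add: "(grow ^^ N) (\<lambda>c. f c + g c) c = (grow ^^ N) f c + (grow ^^ N) g c"
proof (induction N arbitrary: c)
  case (Suc N)
  have "grow h c = (\<Sum>i<length c. h (bump i 1 c)) + h (c @ [1])" for h
    by (simp add: grow_def)
  then show ?case by (simp add: Suc sum.distrib)
qed simp

text \<open>
  Adding \<open>m\<close> elements to a cluster that already exists can be done before or after the other
  additions. This is where exchangeability enters on the level of cluster sizes.
\<close>
lemma funpow_grow_bump:
  "j < length c \<Longrightarrow> (grow ^^ N) (\<lambda>c. h (bump j m c)) c = (grow ^^ N) h (bump j m c)"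
proof (induction N arbitrary: c)
  case (Suc N)
  have "(grow ^^ Suc N) (\<lambda>c. h (bump j m c)) c = grow (\<lambda>c. (grow ^^ N) h (bump j m c)) c"
    using Suc by (auto intro!: grow_cong)
  also have "\<dots> = (grow ^^ Suc N) h (bump j m c)"
    using Suc.prems by (simp add: grow_def bump_commute[of j m] bump_append1)
  finally show ?case .
qed simp

section \<open>Placing sizes at increasing positions\<close>

definition inc_lists :: "nat \<Rightarrow> nat \<Rightarrow> nat \<Rightarrow> nat list set" where
  "inc_lists m K k = {js. sorted_wrt (<) js \<and> set js \<subseteq> {m..<K} \<and> length js = k}"

lemma finite_inc_lists [simp]: "finite (inc_lists m K k)"
  by (rule finite_subset[of _ "{js. set js \<subseteq> {m..<K} \<and> length js = k}"])
     (auto simp: inc_lists_def finite_lists_length_eq)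

lemma inc_lists_0 [simp]: "inc_lists m K 0 = {[]}"
  by (auto simp: inc_lists_def)

lemma inc_lists_empty: "K \<le> m \<Longrightarrow> inc_lists m K (Suc k) = {}"
  by (auto simp: inc_lists_def length_Suc_conv)

text \<open>
  Either the smallest admissible position \<open>m\<close> is used, and then it comes first, or it is not.
\<close>
lemma inc_lists_Suc:
  assumes "m < K"
  shows "inc_lists m K (Suc k) = inc_lists (Suc m) K (Suc k) \<union> (#) m ` inc_lists (Suc m) K k"
proof (intro set_eqI iffI)
  fix js assume js: "js \<in> inc_lists m K (Suc k)"
  then obtain a ks where ks: "js = a # ks" by (cases js) (auto simp: inc_lists_def)
  have "js \<in> inc_lists (Suc m) K (Suc k)" if "a \<noteq> m"
    using js that by (fastforce simp: inc_lists_def ks)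
  moreover have "ks \<in> inc_lists (Suc m) K k" if "a = m"
    using js that by (fastforce simp: inc_lists_def ks)
  ultimately show "js \<in> inc_lists (Suc m) K (Suc k) \<union> (#) m ` inc_lists (Suc m) K k"
    unfolding ks by blast
next
  fix js assume "js \<in> inc_lists (Suc m) K (Suc k) \<union> (#) m ` inc_lists (Suc m) K k"
  then show "js \<in> inc_lists m K (Suc k)"
    using assms by (fastforce simp: inc_lists_def)
qed

lemma sum_inc_lists_Suc:
  assumes "m < K"
  shows "(\<Sum>js\<in>inc_lists m K (Suc k). f js) =
    (\<Sum>js\<in>inc_lists (Suc m) K (Suc k). f js) + (\<Sum>js\<in>inc_lists (Suc m) K k. f (m # js))"
proof -
  have "(#) m ` inc_lists (Suc m) K k \<inter> inc_lists (Suc m) K (Suc k) = {}"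
    by (auto simp: inc_lists_def)
  then show ?thesis
    unfolding inc_lists_Suc[OF assms]
    by (subst sum.union_disjoint) (auto simp: sum.reindex)
qed

fun bumps :: "nat list \<Rightarrow> nat list \<Rightarrow> nat list \<Rightarrow> nat list" where
  "bumps (j # js) (n # r) c = bumps js r (bump j n c)"
| "bumps _ _ c = c"

text \<open>
  The entries of \<open>r\<close> are the sizes of initial clusters still to be discovered, and each of them is
  identified with one of the clusters from position \<open>m\<close> on, in increasing order. The value is the
  sum of \<open>h\<close> over all such identifications.
\<close>
definition placements :: "(nat list \<Rightarrow> real) \<Rightarrow> nat \<Rightarrow> nat list \<Rightarrow> nat list \<Rightarrow> real" where
  "placements h m r c = (\<Sum>js\<in>inc_lists m (length c) (length r). h (bumps js r c))"

lemma placements_Nil [simp]: "placements h m [] = h"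
  by (simp add: placements_def fun_eq_iff)

lemma placements_Cons:
  assumes "m < length c"
  shows "placements h m (n # r) c =
    placements h (Suc m) (n # r) c + placements h (Suc m) r (bump m n c)"
  by (simp add: placements_def sum_inc_lists_Suc[OF assms])

section \<open>Size-biased discovery in the Gibbs model\<close>

lemma gibbs_eppf_prod_list:
  "gibbs_eppf \<alpha> V ns =
     V (length ns) (sum_list ns) * (\<Prod>m\<leftarrow>ns. pochhammer (1 - \<alpha>) (m - 1))"
proof -
  have "(\<Prod>i<length ns. pochhammer (1 - \<alpha>) (ns ! i - 1)) = (\<Prod>m\<leftarrow>ns. pochhammer (1 - \<alpha>) (m - 1))"
    by (induction ns) (auto simp: prod.lessThan_Suc_shift simp del: prod.lessThan_Suc)
  then show ?thesis by (simp add: gibbs_eppf_def)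
qed

lemma gibbs_eppf_perm:
  assumes "mset ms = mset ns"
  shows "gibbs_eppf \<alpha> V ms = gibbs_eppf \<alpha> V ns"
proof -
  have "(\<Prod>m\<leftarrow>ms. pochhammer (1 - \<alpha>) (m - 1)) = (\<Prod>m\<leftarrow>ns. pochhammer (1 - \<alpha>) (m - 1))"
    using assms by (simp flip: prod_mset_prod_list)
  moreover have "length ms = length ns" "sum_list ms = sum_list ns"
    using mset_eq_length[OF assms] assms by (simp_all flip: sum_mset_sum_list)
  ultimately show ?thesis by (simp add: gibbs_eppf_prod_list)
qed

lemma size_biased_weight_Nil [simp]: "size_biased_weight \<alpha> [] = 1"
  by (simp add: size_biased_weight_def)

lemma sum_atLeastLessThan_nth_eq_sum_list:
  "(\<Sum>j=0..<length ns. f (ns ! j)) = (\<Sum>m\<leftarrow>ns. f m)"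
  by (simp add: sum_list_sum_nth)

lemma size_biased_weight_Cons:
  "size_biased_weight \<alpha> (n # ns) =
     (real n - \<alpha>) / (\<Sum>m\<leftarrow>n # ns. real m - \<alpha>) * size_biased_weight \<alpha> ns"
proof -
  have "(\<Sum>j=Suc i..<Suc (length ns). real ((n # ns) ! j) - \<alpha>) = (\<Sum>j=i..<length ns. real (ns ! j) - \<alpha>)" for i
    by (simp only: sum.shift_bounds_Suc_ivl nth_Cons_Suc)
  moreover have "(\<Sum>j=0..<Suc (length ns). real ((n # ns) ! j) - \<alpha>) = (\<Sum>m\<leftarrow>n # ns. real m - \<alpha>)"
    using sum_atLeastLessThan_nth_eq_sum_list[of "\<lambda>m. real m - \<alpha>" "n # ns"] by simp
  ultimately show ?thesis
    unfolding size_biased_weight_def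
    by (simp add: prod.lessThan_Suc_shift del: prod.lessThan_Suc sum.op_ivl_Suc)
qed

lemma sum_list_size_minus_pos:
  assumes "\<alpha> < 1" "\<forall>m\<in>set ns. 0 < m" "ns \<noteq> []"
  shows "0 < (\<Sum>m\<leftarrow>ns. real m - \<alpha>)"
  using assms(3,2)
proof (induction ns rule: list_nonempty_induct)
  case (single x)
  then show ?case using assms(1) by auto
next
  case (cons x xs)
  then have "1 \<le> real x" by simp
  then have "0 < real x - \<alpha>" using assms(1) by linarith
  then show ?case using cons by auto
qed

lemma size_biased_weight_pos:
  assumes "\<alpha> < 1" "\<forall>m\<in>set ns. 0 < m"
  shows "0 < size_biased_weight \<alpha> ns"
  using assms(2)
proof (induction ns)
  case (Cons n ns)
  have "0 < real n - \<alpha>" using Cons.prems assms(1) by (auto simp: Suc_le_eq[symmetric])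
  then show ?case
    using Cons sum_list_size_minus_pos[OF assms(1) Cons.prems]
    unfolding size_biased_weight_Cons by (intro mult_pos_pos divide_pos_pos) auto
qed simp

lemma length_le_sum_list: "\<forall>m\<in>set ns. 0 < m \<Longrightarrow> length ns \<le> sum_list (ns::nat list)"
  by (induction ns) (auto simp: Suc_le_eq)

lemma gibbs_eppf_pos:
  assumes "gibbs_weights \<alpha> V" "\<alpha> < 1" "\<forall>m\<in>set ns. 0 < m" "ns \<noteq> []"
  shows "0 < gibbs_eppf \<alpha> V ns"
proof -
  have "0 < V (length ns) (sum_list ns)"
  proof -
    have "1 \<le> length ns" using assms(4) by (cases ns) auto
    with length_le_sum_list[OF assms(3)] show ?thesis
      using assms(1) unfolding gibbs_weights_def by blast
  qed
  moreover have "0 < (\<Prod>i<length ns. pochhammer (1 - \<alpha>) (ns ! i - 1))"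
    using assms(2) by (intro prod_pos) (auto intro!: pochhammer_pos)
  ultimately show ?thesis by (simp add: gibbs_eppf_def)
qed

lemma gibbs_eppf_incr:
  assumes "0 < n"
  shows "gibbs_eppf \<alpha> V (c @ Suc n # d) =
    (real n - \<alpha>) * (V (length (c @ n # d)) (Suc (sum_list (c @ n # d))) *
      (\<Prod>m\<leftarrow>c @ n # d. pochhammer (1 - \<alpha>) (m - 1)))"
proof -
  obtain m where n: "n = Suc m" using assms by (cases n) auto
  have "pochhammer (1 - \<alpha>) n = (real n - \<alpha>) * pochhammer (1 - \<alpha>) (n - 1)"
    by (simp add: n pochhammer_Suc algebra_simps)
  then show ?thesis by (simp add: gibbs_eppf_prod_list)
qed

lemma gibbs_eppf_bump:
  assumes "\<forall>m\<in>set c. 0 < m" "i < length c"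
  shows "gibbs_eppf \<alpha> V (bump i 1 c @ d) =
    (real (c ! i) - \<alpha>) * (V (length (c @ d)) (Suc (sum_list (c @ d))) *
      (\<Prod>m\<leftarrow>c @ d. pochhammer (1 - \<alpha>) (m - 1)))"
proof -
  have c: "c = take i c @ c ! i # drop (Suc i) c"
    by (rule id_take_nth_drop[OF assms(2)])
  have "bump i 1 c @ d = take i c @ Suc (c ! i) # (drop (Suc i) c @ d)"
    using assms(2) by (simp add: bump_def upd_conv_take_nth_drop)
  moreover have "take i c @ c ! i # (drop (Suc i) c @ d) = c @ d"
    using arg_cong[OF c, of "\<lambda>x. x @ d"] by simp
  moreover have "0 < c ! i" using assms by simp
  ultimately show ?thesis
    using gibbs_eppf_incr[of "c ! i" \<alpha> V "take i c" "drop (Suc i) c @ d"] by (simp only:)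
qed

lemma sum_list_minus_const:
  "(\<Sum>m\<leftarrow>ns. real m - \<alpha>) = real (sum_list ns) - real (length ns) * \<alpha>"
  by (induction ns) (auto simp: algebra_simps)

text \<open>
  The recursion of the Gibbs weights, as the rule for one additional element: it joins one of the
  clusters \<open>c\<close>, or is a new singleton, or joins one of the clusters \<open>r\<close>. The last case is written
  with the common factor of the weights \<open>m - \<alpha>\<close>, since this is the form in which it meets the
  denominator of \<open>size_biased_weight\<close>.
\<close>
lemma gibbs_eppf_consistent:
  assumes V: "gibbs_weights \<alpha> V" and pos: "\<forall>m\<in>set (c @ r). 0 < m" and ne: "c @ r \<noteq> []"
  shows "gibbs_eppf \<alpha> V (c @ r) =
      (\<Sum>i<length c. gibbs_eppf \<alpha> V (bump i 1 c @ r)) + gibbs_eppf \<alpha> V (c @ 1 # r)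
      + (\<Sum>m\<leftarrow>r. real m - \<alpha>) * (V (length (c @ r)) (Suc (sum_list (c @ r))) *
        (\<Prod>m\<leftarrow>c @ r. pochhammer (1 - \<alpha>) (m - 1)))"
proof -
  define k where "k = length (c @ r)"
  define n where "n = sum_list (c @ r)"
  define G where "G = (\<Prod>m\<leftarrow>c @ r. pochhammer (1 - \<alpha>) (m - 1))"
  have kn: "1 \<le> k" "k \<le> n"
    using ne length_le_sum_list[OF pos] by (cases "c @ r"; simp add: k_def n_def)+
  have Vk: "V k n = (real n - real k * \<alpha>) * V k (Suc n) + V (Suc k) (Suc n)"
    using V[unfolded gibbs_weights_def, rule_format, of k n] kn by (metis Suc_eq_plus1)
  have "(\<Sum>i<length c. gibbs_eppf \<alpha> V (bump i 1 c @ r)) = (\<Sum>i<length c. (real (c ! i) - \<alpha>) * (V k (Suc n) * G))"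
    using pos gibbs_eppf_bump unfolding k_def n_def G_def
    by (intro sum.cong refl) (metis (no_types, lifting) Un_iff lessThan_iff set_append)
  also have "\<dots> = (\<Sum>m\<leftarrow>c. real m - \<alpha>) * (V k (Suc n) * G)"
    using sum_atLeastLessThan_nth_eq_sum_list[of "\<lambda>m. real m - \<alpha>" c]
    by (simp add: sum_distrib_right[symmetric] atLeast0LessThan)
  finally have old: "(\<Sum>i<length c. gibbs_eppf \<alpha> V (bump i 1 c @ r)) = (\<Sum>m\<leftarrow>c. real m - \<alpha>) * (V k (Suc n) * G)" .
  have new: "gibbs_eppf \<alpha> V (c @ 1 # r) = V (Suc k) (Suc n) * G"
    by (simp add: gibbs_eppf_prod_list k_def n_def G_def)
  have "gibbs_eppf \<alpha> V (c @ r) = V k n * G"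
    by (simp add: gibbs_eppf_prod_list k_def n_def G_def)
  also have "\<dots> = ((\<Sum>m\<leftarrow>c. real m - \<alpha>) + (\<Sum>m\<leftarrow>r. real m - \<alpha>)) * (V k (Suc n) * G) + V (Suc k) (Suc n) * G"
  proof -
    have "(\<Sum>m\<leftarrow>c. real m - \<alpha>) + (\<Sum>m\<leftarrow>r. real m - \<alpha>) = real n - real k * \<alpha>"
      unfolding sum_list_minus_const k_def n_def by (simp add: algebra_simps)
    then show ?thesis unfolding Vk by (simp only: distrib_right mult.assoc)
  qed
  finally show ?thesis
    unfolding old new k_def[symmetric] n_def[symmetric] G_def[symmetric] by (simp add: algebra_simps)
qed

lemma set_bump_pos: "\<forall>m\<in>set c. 0 < m \<Longrightarrow> \<forall>m\<in>set (bump i k c). 0 < m"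
  by (cases "i < length c") (auto simp: bump_def set_conv_nth nth_list_update)

lemma grow_gibbs_eppf:
  assumes "gibbs_weights \<alpha> V" "\<forall>m\<in>set c. 0 < m" "c \<noteq> []"
  shows "grow (gibbs_eppf \<alpha> V) c = gibbs_eppf \<alpha> V c"
  using gibbs_eppf_consistent[of \<alpha> V c "[]"] assms by (simp add: grow_def)

lemma funpow_grow_gibbs_eppf:
  assumes "gibbs_weights \<alpha> V" "\<forall>m\<in>set c. 0 < m" "c \<noteq> []"
  shows "(grow ^^ N) (gibbs_eppf \<alpha> V) c = gibbs_eppf \<alpha> V c"
  using assms(2,3)
proof (induction N arbitrary: c)
  case (Suc N)
  have "(grow ^^ Suc N) (gibbs_eppf \<alpha> V) c = grow (gibbs_eppf \<alpha> V) c"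
  proof -
    have "(grow ^^ N) (gibbs_eppf \<alpha> V) (bump i 1 c) = gibbs_eppf \<alpha> V (bump i 1 c)" for i
      using Suc.prems by (intro Suc.IH set_bump_pos) (simp_all add: bump_def)
    moreover have "(grow ^^ N) (gibbs_eppf \<alpha> V) (c @ [1]) = gibbs_eppf \<alpha> V (c @ [1])"
      using Suc.prems by (intro Suc.IH) auto
    ultimately show ?thesis by (simp add: grow_def)
  qed
  with Suc.prems grow_gibbs_eppf[OF assms(1)] show ?case by simp
qed simp

text \<open>
  Here \<open>c\<close> lists the clusters met by the new elements so far, with the elements of the initial
  clusters merged into them, and \<open>r\<close> the initial clusters that have not been met. In the induction
  step the next element either leaves \<open>r\<close> unchanged or joins a cluster of \<open>r\<close>, and the latter has
  to be the first one in the list. That costs the factor \<open>(n - \<alpha>) / (\<Sum>m\<leftarrow>r. m - \<alpha>)\<close>, which is the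
  first factor of \<open>size_biased_weight \<alpha> r\<close>. After no steps the left-hand side is 0 unless \<open>r\<close> is
  empty, whence the inequality instead of an equality.
\<close>
lemma funpow_grow_placements_le:
  assumes V: "gibbs_weights \<alpha> V" and "0 \<le> \<alpha>" "\<alpha> < 1"
    and "\<forall>m\<in>set (c @ r). 0 < m" "c @ r \<noteq> []"
  shows "(grow ^^ N) (placements (gibbs_eppf \<alpha> V) (length c) r) c
    \<le> size_biased_weight \<alpha> r * gibbs_eppf \<alpha> V (c @ r)"
  using assms(4,5)
proof (induction N arbitrary: c r)
  case 0
  then show ?case
    using size_biased_weight_pos[OF assms(3), of r] gibbs_eppf_pos[OF V assms(3) 0]
    by (cases r) (auto simp: placements_def inc_lists_empty)
next
  case (Suc N)
  let ?p = "gibbs_eppf \<alpha> V"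
  define Z where "Z = V (length (c @ r)) (Suc (sum_list (c @ r))) *
        (\<Prod>m\<leftarrow>c @ r. pochhammer (1 - \<alpha>) (m - 1))"
  have w: "0 < size_biased_weight \<alpha> r" using size_biased_weight_pos[OF assms(3)] Suc.prems by simp
  have old: "(grow ^^ N) (placements ?p (length c) r) (bump i 1 c) \<le> size_biased_weight \<alpha> r * ?p (bump i 1 c @ r)"
    if "i < length c" for i
  proof -
    have "\<forall>m\<in>set (bump i 1 c @ r). 0 < m" using set_bump_pos[of c i 1] Suc.prems by auto
    moreover have "bump i 1 c @ r \<noteq> []" using that by (auto simp: bump_def)
    ultimately show ?thesis using Suc.IH[of "bump i 1 c" r] by simp
  qed
  have new: "(grow ^^ N) (placements ?p (length c) r) (c @ [1])
     \<le> size_biased_weight \<alpha> r * ?p (c @ 1 # r) + size_biased_weight \<alpha> r * ((\<Sum>m\<leftarrow>r. real m - \<alpha>) * Z)"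
  proof (cases r)
    case Nil
    then show ?thesis using Suc.IH[of "c @ [1]" r] Suc.prems by simp
  next
    case (Cons n r')
    \<comment> \<open>The cluster opened by the new element is either new or the first cluster of the list r.\<close>
    have "(grow ^^ N) (placements ?p (length c) r) (c @ [1]) =
      (grow ^^ N) (\<lambda>c'. placements ?p (Suc (length c)) r c' + placements ?p (Suc (length c)) r' (bump (length c) n c')) (c @ [1])"
      unfolding Cons by (intro funpow_grow_cong placements_Cons) simp
    also have "\<dots> = (grow ^^ N) (placements ?p (length (c @ [1])) r) (c @ [1])
       + (grow ^^ N) (placements ?p (length (c @ [Suc n])) r') (c @ [Suc n])"
      by (simp add: funpow_grow_add funpow_grow_bump bump_append2)
    also have "\<dots> \<le> size_biased_weight \<alpha> r * ?p ((c @ [1]) @ r) + size_biased_weight \<alpha> r' * ?p ((c @ [Suc n]) @ r')"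
      using Suc.prems Cons by (intro add_mono Suc.IH) auto
    also have "?p ((c @ [Suc n]) @ r') = (real n - \<alpha>) * Z"
      using gibbs_eppf_incr[of n \<alpha> V c r'] Suc.prems by (simp add: Z_def Cons)
    also have "size_biased_weight \<alpha> r' * ((real n - \<alpha>) * Z) = size_biased_weight \<alpha> r * ((\<Sum>m\<leftarrow>r. real m - \<alpha>) * Z)"
      using sum_list_size_minus_pos[OF assms(3), of r] Suc.prems
      unfolding Cons size_biased_weight_Cons by (simp add: Cons)
    finally show ?thesis by simp
  qed
  have "(grow ^^ Suc N) (placements ?p (length c) r) c
     = (\<Sum>i<length c. (grow ^^ N) (placements ?p (length c) r) (bump i 1 c)) + (grow ^^ N) (placements ?p (length c) r) (c @ [1])"
    by (simp add: grow_def)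
  also have "\<dots> \<le> (\<Sum>i<length c. size_biased_weight \<alpha> r * ?p (bump i 1 c @ r))
      + (size_biased_weight \<alpha> r * ?p (c @ 1 # r) + size_biased_weight \<alpha> r * ((\<Sum>m\<leftarrow>r. real m - \<alpha>) * Z))"
    by (intro add_mono sum_mono old new) auto
  also have "\<dots> = size_biased_weight \<alpha> r * ?p (c @ r)"
    unfolding gibbs_eppf_consistent[OF V Suc.prems] Z_def
    by (simp add: sum_distrib_left algebra_simps)
  finally show ?case .
qed

section \<open>Restricted growth sequences and set partitions\<close>

lemma (in linorder) sorted_key_list_of_set_eqI:
  assumes "sorted_wrt (<) (map f xs)"
  shows "sorted_key_list_of_set f (set xs) = xs"
proof -
  have d: "distinct (map f xs)" "sorted (map f xs)"
    using assms by (simp_all add: strict_sorted_iff)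
  then interpret folding_insort_key "(\<le>)" "(<)" "set xs" f
    by unfold_locales (simp_all add: distinct_map)
  show ?thesis using d by (intro idem_if_sorted_distinct) (auto simp: distinct_map)
qed

lemma (in linorder) sorted_key_list_of_set_props:
  assumes "inj_on f A" "finite A"
  shows "set (sorted_key_list_of_set f A) = A" "distinct (sorted_key_list_of_set f A)"
    "sorted_wrt (<) (map f (sorted_key_list_of_set f A))"
proof -
  interpret folding_insort_key "(\<le>)" "(<)" A f
    by unfold_locales fact
  show "set (sorted_key_list_of_set f A) = A"
    using assms by simp
  show "sorted_wrt (<) (map f (sorted_key_list_of_set f A))"
    by (rule strict_sorted_key_list_of_set) simp
  then show "distinct (sorted_key_list_of_set f A)"
    by (auto simp: strict_sorted_iff distinct_map)
qed

lemma inj_on_Min_partition: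
  assumes "partition_on S A" "finite S"
  shows "inj_on Min A"
proof (rule inj_onI)
  fix C D assume CD: "C \<in> A" "D \<in> A" and eq: "Min C = Min D"
  have "finite C" "C \<noteq> {}" "finite D" "D \<noteq> {}"
    using CD assms by (auto simp: partition_on_def intro: finite_subset)
  then have "Min C \<in> C" "Min C \<in> D"
    using Min_in[of C] Min_in[of D] eq by auto
  with CD partition_onD2[OF assms(1)] show "C = D"
    by (auto simp: disjoint_def)
qed

text \<open>
  A word \<open>a\<close> describes a partition: element \<open>i + 1\<close> belongs to the cluster with label \<open>a ! i\<close>.
  Labels are given in order of appearance, so the next label either occurs already or is the
  least one that does not. The words obtained from \<open>[]\<close> are the restricted growth sequences.
\<close>
primrec extensions :: "nat list \<Rightarrow> nat \<Rightarrow> nat list set" where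
  "extensions a 0 = {a}"
| "extensions a (Suc x) = (\<lambda>(b, l). b @ [l]) ` (SIGMA b:extensions a x. {..card (set b)})"

abbreviation rgs :: "nat \<Rightarrow> nat list set" where
  "rgs n \<equiv> extensions [] n"

definition counts :: "nat list \<Rightarrow> nat list" where
  "counts a = map (count_list a) [0..<card (set a)]"

lemma length_counts [simp]: "length (counts a) = card (set a)"
  by (simp add: counts_def)

lemma counts_Nil [simp]: "counts [] = []"
  by (simp add: counts_def)

lemma extensions_SucI: "b \<in> extensions a x \<Longrightarrow> l \<le> card (set b) \<Longrightarrow> b @ [l] \<in> extensions a (Suc x)"
  by force

lemma extensions_SucE:
  assumes "b \<in> extensions a (Suc x)"
  obtains b' l where "b = b' @ [l]" "b' \<in> extensions a x" "l \<le> card (set b')"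
  using assms by auto

lemma finite_extensions [simp]: "finite (extensions a x)"
  by (induction x) auto

lemma length_extensions: "b \<in> extensions a x \<Longrightarrow> length b = length a + x"
  by (induction x arbitrary: b) (auto elim!: extensions_SucE simp del: extensions.simps(2))

lemma set_snoc_initial:
  assumes "set b = {..<k}" "l \<le> k"
  shows "set (b @ [l]) = {..<(if l = k then Suc k else k)}"
proof (cases "l = k")
  case True
  then show ?thesis using assms(1) by (simp add: lessThan_Suc)
next
  case False
  then show ?thesis using assms by (simp add: insert_absorb)
qed

definition initial_labels :: "nat list \<Rightarrow> bool" where
  "initial_labels a \<longleftrightarrow> (\<exists>k. set a = {..<k})"

lemma set_initial_labels: "initial_labels a \<Longrightarrow> set a = {..<card (set a)}"
  unfolding initial_labels_def by (elim exE) simp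

lemma initial_labels_extensions:
  assumes "initial_labels a"
  shows "b \<in> extensions a x \<Longrightarrow> initial_labels b"
proof (induction x arbitrary: b)
  case (Suc x)
  from Suc.prems obtain b' l where b: "b = b' @ [l]" "b' \<in> extensions a x" "l \<le> card (set b')"
    by (rule extensions_SucE)
  have "set b' = {..<card (set b')}" using Suc.IH b set_initial_labels by blast
  from set_snoc_initial[OF this b(3)] show ?case
    unfolding b(1) initial_labels_def by blast
qed (use assms in simp)

lemma initial_labels_Nil [simp]: "initial_labels []"
  unfolding initial_labels_def by (rule exI[of _ 0]) simp

lemma set_rgs: "a \<in> rgs n \<Longrightarrow> set a = {..<card (set a)}"
  using initial_labels_extensions[OF initial_labels_Nil] set_initial_labels by blast

lemma length_rgs: "a \<in> rgs n \<Longrightarrow> length a = n"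
  using length_extensions by force

lemma counts_snoc:
  assumes a: "initial_labels a"
  shows "l < card (set a) \<Longrightarrow> counts (a @ [l]) = bump l 1 (counts a)"
    and "counts (a @ [card (set a)]) = counts a @ [1]"
proof -
  note sa = set_initial_labels[OF a]
  assume l: "l < card (set a)"
  then have "set (a @ [l]) = {..<card (set a)}"
    using set_snoc_initial[OF sa, of l] l by (simp del: set_append)
  then have "card (set (a @ [l])) = card (set a)" by simp
  then show "counts (a @ [l]) = bump l 1 (counts a)"
    using l unfolding counts_def
    by (intro nth_equalityI) (auto simp: bump_def nth_list_update simp del: set_append)
next
  note sa = set_initial_labels[OF a]
  have "set (a @ [card (set a)]) = {..<Suc (card (set a))}"
    using set_snoc_initial[OF sa, of "card (set a)"] by (simp del: set_append)
  then have "card (set (a @ [card (set a)])) = Suc (card (set a))" by simp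
  moreover have "count_list a (card (set a)) = 0"
    using sa by (metis count_list_0_iff lessThan_iff less_irrefl)
  moreover have "count_list (a @ [card (set a)]) j = count_list a j" if "j < card (set a)" for j
    using that by simp
  ultimately show "counts (a @ [card (set a)]) = counts a @ [1]"
    unfolding counts_def by (simp del: set_append)
qed

lemma sum_extensions_Suc:
  assumes "initial_labels a"
  shows "(\<Sum>b\<in>extensions a (Suc x). h (counts b)) = (\<Sum>b\<in>extensions a x. grow h (counts b))"
proof -
  have inj: "inj_on (\<lambda>(b, l). b @ [l]) (SIGMA b:extensions a x. {..card (set b)})"
    by (auto simp: inj_on_def)
  have "(\<Sum>b\<in>extensions a (Suc x). h (counts b))
      = (\<Sum>b\<in>extensions a x. \<Sum>l\<le>card (set b). h (counts (b @ [l])))"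
    unfolding extensions.simps sum.reindex[OF inj] by (simp add: sum.Sigma case_prod_unfold)
  also have "\<dots> = (\<Sum>b\<in>extensions a x. grow h (counts b))"
  proof (intro sum.cong refl)
    fix b assume "b \<in> extensions a x"
    note b = initial_labels_extensions[OF assms this]
    show "(\<Sum>l\<le>card (set b). h (counts (b @ [l]))) = grow h (counts b)"
      using counts_snoc[OF b] unfolding grow_def
      by (simp add: lessThan_Suc_atMost[symmetric])
  qed
  finally show ?thesis .
qed

text \<open>
  The function \<open>h\<close> is attached to the last of the \<open>x\<close> letters, hence \<open>grow\<close> is applied first to \<open>h\<close>
  and the iterates are finally evaluated at the sizes of the initial word.
\<close>
lemma sum_extensions:
  assumes "initial_labels a"
  shows "(\<Sum>b\<in>extensions a x. h (counts b)) = (grow ^^ x) h (counts a)"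
proof (induction x arbitrary: h)
  case (Suc x)
  show ?case
    unfolding sum_extensions_Suc[OF assms] Suc by (simp add: funpow_swap1)
qed simp

lemma take_rgs: "a \<in> rgs (m + x) \<Longrightarrow> take m a \<in> rgs m \<and> a \<in> extensions (take m a) x"
proof (induction x arbitrary: a)
  case 0
  then show ?case using length_rgs by fastforce
next
  case (Suc x)
  from Suc.prems obtain b l where b: "a = b @ [l]" "b \<in> rgs (m + x)" "l \<le> card (set b)"
    unfolding add_Suc_right by (rule extensions_SucE)
  then have "take m a = take m b" using length_rgs[OF b(2)] by simp
  then show ?case using Suc.IH[OF b(2)] b extensions_SucI by simp
qed

lemma extensions_in_rgs: "a \<in> rgs m \<Longrightarrow> b \<in> extensions a x \<Longrightarrow> b \<in> rgs (m + x) \<and> take m b = a"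
proof (induction x arbitrary: b)
  case 0
  then show ?case using length_rgs by auto
next
  case (Suc x)
  from Suc.prems(2) obtain b' l where b: "b = b' @ [l]" "b' \<in> extensions a x" "l \<le> card (set b')"
    by (rule extensions_SucE)
  with Suc have "b' \<in> rgs (m + x)" "take m b' = a" by auto
  moreover have "take m b = take m b'" using b length_rgs[OF calculation(1)] by simp
  ultimately show ?case unfolding b(1) add_Suc_right using extensions_SucI[OF _ b(3)] by metis
qed

lemma extensions_eq: "a \<in> rgs m \<Longrightarrow> extensions a x = {b \<in> rgs (m + x). take m b = a}"
  using take_rgs extensions_in_rgs by blast

definition label_block :: "nat list \<Rightarrow> nat \<Rightarrow> nat set" where
  "label_block a j = {i \<in> {1..length a}. a ! (i - 1) = j}"

definition label_partition :: "nat list \<Rightarrow> nat set set" where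
  "label_partition a = range (label_block a) - {{}}"

lemma label_block_nonempty: "label_block a j \<noteq> {} \<longleftrightarrow> j \<in> set a"
proof
  assume "j \<in> set a"
  then obtain i where "i < length a" "a ! i = j" by (auto simp: in_set_conv_nth)
  then have "Suc i \<in> label_block a j" by (simp add: label_block_def)
  then show "label_block a j \<noteq> {}" by blast
qed (auto simp: label_block_def)

lemma label_partition_eq: "label_partition a = label_block a ` set a"
  using label_block_nonempty by (auto simp: label_partition_def)

lemma finite_label_block [simp]: "finite (label_block a j)"
  by (simp add: label_block_def)

lemma partition_on_label_partition: "partition_on {1..length a} (label_partition a)"
proof (rule partition_onI)
  have "i \<in> \<Union> (label_partition a)" if "i \<in> {1..length a}" for i
  proof -
    have "i \<in> label_block a (a ! (i - 1))" using that by (simp add: label_block_def)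
    then show ?thesis unfolding label_partition_def by blast
  qed
  moreover have "i \<in> {1..length a}" if "i \<in> \<Union> (label_partition a)" for i
    using that by (auto simp: label_partition_def label_block_def)
  ultimately show "\<Union> (label_partition a) = {1..length a}" by blast
qed (auto simp: label_partition_def label_block_def disjnt_def)

lemma label_block_take: "m \<le> length a \<Longrightarrow> label_block (take m a) j = label_block a j \<inter> {1..m}"
  by (auto simp: label_block_def)

lemma label_partition_take: "m \<le> length a \<Longrightarrow> label_partition (take m a) = (\<lambda>C. C \<inter> {1..m}) ` label_partition a - {{}}"
  unfolding label_partition_def using label_block_take[of m a] by auto

lemma card_label_block: "card (label_block a j) = count_list a j"
proof -
  have "label_block a j = Suc ` {i. i < length a \<and> a ! i = j}"
    by (auto simp: label_block_def image_iff Suc_le_eq gr0_conv_Suc)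
  moreover have "count_list a j = card {i. i < length a \<and> a ! i = j}"
    unfolding count_list_eq_length_filter length_filter_conv_card by (rule arg_cong[of _ _ card]) auto
  ultimately show ?thesis by (simp add: card_image)
qed

text \<open>
  Up to the least element of a block only labels not exceeding the label of that block occur, and
  all of them do. Hence the order of labels is the order of least elements.
\<close>
lemma Min_label_block_less:
  assumes "a \<in> rgs n" "j < j'" "j' < card (set a)"
  shows "Min (label_block a j) < Min (label_block a j')"
proof -
  define i where "i = Min (label_block a j')"
  have "j' \<in> set a" using set_rgs[OF assms(1)] assms(3) by blast
  then have "i \<in> label_block a j'"
    unfolding i_def using label_block_nonempty by (intro Min_in) auto
  then have i: "1 \<le> i" "i \<le> n" "a ! (i - 1) = j'"
    using length_rgs[OF assms(1)] by (auto simp: label_block_def)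
  then have b: "take i a \<in> rgs i"
    using take_rgs[of a i "n - i"] assms(1) by simp
  have "take i a ! (i - 1) \<in> set (take i a)"
    using i length_rgs[OF assms(1)] by (intro nth_mem) simp
  then have "j' \<in> set (take i a)" using i by simp
  then have "j \<in> set (take i a)"
    using set_rgs[OF b] assms(2) by (metis lessThan_iff less_trans)
  then obtain i0 where i0: "i0 \<in> label_block (take i a) j" using label_block_nonempty by blast
  then have "i0 \<in> label_block a j" "i0 \<le> i"
    using label_block_take[of i a j] i length_rgs[OF assms(1)] by auto
  moreover have "i0 \<noteq> i" using \<open>i0 \<in> label_block a j\<close> i assms(2) by (auto simp: label_block_def)
  ultimately have "Min (label_block a j) < i" by (metis Min_le finite_label_block le_neq_implies_less le_trans leD leI)
  then show ?thesis by (simp add: i_def)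
qed

lemma sorted_key_list_of_set_label_partition:
  assumes "a \<in> rgs n"
  shows "sorted_key_list_of_set Min (label_partition a) = map (label_block a) [0..<card (set a)]"
proof -
  have "label_partition a = set (map (label_block a) [0..<card (set a)])"
    using set_rgs[OF assms] unfolding label_partition_eq set_map set_upt atLeast0LessThan by (rule arg_cong)
  moreover have "sorted_wrt (<) (map Min (map (label_block a) [0..<card (set a)]))"
    using Min_label_block_less[OF assms] by (auto simp: sorted_wrt_iff_nth_less)
  ultimately show ?thesis by (simp only: sorted_key_list_of_set_eqI)
qed

lemma appearance_sizes_label_partition: "a \<in> rgs n \<Longrightarrow> appearance_sizes (label_partition a) = counts a"
  by (simp add: appearance_sizes_def sorted_key_list_of_set_label_partition counts_def card_label_block)

lemma inj_on_label_partition: "inj_on label_partition (rgs n)"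
proof (rule inj_onI)
  fix a b assume ab: "a \<in> rgs n" "b \<in> rgs n" "label_partition a = label_partition b"
  then have eq: "map (label_block a) [0..<card (set a)] = map (label_block b) [0..<card (set b)]"
    by (metis sorted_key_list_of_set_label_partition)
  then have c: "card (set a) = card (set b)" by (metis length_map length_upt diff_zero)
  show "a = b"
  proof (rule nth_equalityI)
    show "length a = length b" using ab length_rgs by simp
  next
    fix i assume i: "i < length a"
    then have "a ! i < card (set a)" using set_rgs[OF ab(1)] nth_mem by blast
    moreover have "map (label_block a) [0..<card (set a)] ! (a ! i) = map (label_block b) [0..<card (set b)] ! (a ! i)"
      by (simp only: eq)
    ultimately have "label_block a (a ! i) = label_block b (a ! i)" unfolding c[symmetric] by simp
    moreover have "Suc i \<in> label_block a (a ! i)" using i by (simp add: label_block_def)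
    ultimately show "a ! i = b ! i" by (simp add: label_block_def)
  qed
qed

text \<open>
  Remove the largest element and let \<open>D\<close> be its block. The label of that element is the label of
  the remainder of \<open>D\<close>, or a new label if this remainder is empty.
\<close>
lemma label_partition_surj: "partition_on {1..n} A \<Longrightarrow> A \<in> label_partition ` rgs n"
proof (induction n arbitrary: A)
  case 0
  then have "A = {}" by (simp add: partition_on_empty)
  then show ?case by (auto simp: label_partition_eq)
next
  case (Suc n)
  have "partition_on ({1..n} \<inter> {1..Suc n}) ((\<inter>) {1..n} ` A - {{}})"
    using Suc.prems by (rule partition_on_restrict)
  then have "(\<inter>) {1..n} ` A - {{}} \<in> label_partition ` rgs n"
    by (intro Suc.IH) (simp add: Int_absorb2)
  then obtain a where a: "a \<in> rgs n" "label_partition a = (\<inter>) {1..n} ` A - {{}}" by force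
  have len: "length a = n" using a length_rgs by blast
  have "Suc n \<in> \<Union> A" using partition_onD1[OF Suc.prems] by (metis atLeastAtMost_iff le_refl le_add1 plus_1_eq_Suc)
  then obtain D where D: "D \<in> A" "Suc n \<in> D" by blast
  have sub: "C \<subseteq> {1..Suc n}" if "C \<in> A" for C using that Suc.prems by (auto simp: partition_on_def)
  have dis: "C = C'" if "C \<in> A" "C' \<in> A" "i \<in> C" "i \<in> C'" for C C' i
    using that partition_onD2[OF Suc.prems] by (auto simp: disjoint_def)
  obtain l where l: "l \<le> card (set a)" "label_block a l = {1..n} \<inter> D"
  proof (cases "{1..n} \<inter> D = {}")
    case True
    have "card (set a) \<notin> set a" using set_rgs[OF a(1)] by (metis lessThan_iff less_irrefl)
    then show ?thesis using that[of "card (set a)"] True label_block_nonempty by blast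
  next
    case False
    then have "{1..n} \<inter> D \<in> label_partition a" using D a(2) by blast
    then obtain l where "l \<in> set a" "label_block a l = {1..n} \<inter> D" by (auto simp: label_partition_eq)
    moreover have "l < card (set a)" using set_rgs[OF a(1)] calculation(1) by blast
    ultimately show ?thesis using that[of l] by simp
  qed
  let ?b = "a @ [l]"
  have b: "?b \<in> rgs (Suc n)" using a(1) l(1) by (rule extensions_SucI)
  have blkb: "label_block ?b j = (if j = l then insert (Suc n) (label_block a j) else label_block a j)" for j
    using len by (auto simp: label_block_def nth_append le_Suc_eq)
  have Dl: "label_block ?b l = D"
    unfolding blkb l(2) using D sub[OF D(1)] by (auto simp: le_Suc_eq)
  have other: "C \<in> label_partition a \<longleftrightarrow> C \<in> A" if "C \<noteq> {1..n} \<inter> D" "C \<noteq> D" for C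
  proof
    assume "C \<in> label_partition a"
    then obtain C' where C': "C' \<in> A" "C = {1..n} \<inter> C'" using a(2) by blast
    then have "Suc n \<notin> C'" using dis[OF C'(1) D(1)] D(2) that by blast
    then have "C = C'" using C' sub[OF C'(1)] by (force simp: le_Suc_eq)
    then show "C \<in> A" using C' by simp
  next
    assume C: "C \<in> A"
    then have "Suc n \<notin> C" using dis[OF C D(1)] D(2) that by blast
    then have "C = {1..n} \<inter> C" using sub[OF C] by (force simp: le_Suc_eq)
    moreover have "C \<noteq> {}" using C Suc.prems by (auto simp: partition_on_def)
    ultimately show "C \<in> label_partition a" using C a(2) by blast
  qed
  have "label_partition ?b = A"
  proof (intro set_eqI iffI)
    fix C assume "C \<in> label_partition ?b"
    then obtain j where j: "C = label_block ?b j" "C \<noteq> {}" by (auto simp: label_partition_def)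
    show "C \<in> A"
    proof (cases "j = l")
      case True
      then show ?thesis using j Dl D by simp
    next
      case False
      then have C: "C = label_block a j" using blkb j by simp
      then have "C \<in> label_partition a" using j by (auto simp: label_partition_def)
      moreover have "C \<inter> label_block a l = {}" using False C by (auto simp: label_block_def)
      then have "C \<noteq> {1..n} \<inter> D" using l(2) j(2) by auto
      moreover have "Suc n \<notin> C" using C len by (auto simp: label_block_def)
      then have "C \<noteq> D" using D by auto
      ultimately show ?thesis using other by blast
    qed
  next
    fix C assume C: "C \<in> A"
    show "C \<in> label_partition ?b"
    proof (cases "C = D")
      case True
      then show ?thesis using Dl D by (auto simp: label_partition_def)
    next
      case False
      have "C \<noteq> {}" using C Suc.prems by (auto simp: partition_on_def)
      moreover have "C \<noteq> {1..n} \<inter> D"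
        using dis[OF C D(1)] False \<open>C \<noteq> {}\<close> by blast
      ultimately have "C \<in> label_partition a" using other False C by blast
      then obtain j where j: "C = label_block a j" by (auto simp: label_partition_def)
      have "j \<noteq> l" using j l(2) \<open>C \<noteq> {1..n} \<inter> D\<close> by auto
      then have "C = label_block ?b j" using blkb j by simp
      then show ?thesis using \<open>C \<noteq> {}\<close> by (auto simp: label_partition_def)
    qed
  qed
  then show ?case using b by blast
qed

lemma bij_betw_label_partition: "bij_betw label_partition (rgs n) {A. partition_on {1..n} A}"
  unfolding bij_betw_def
proof (intro conjI set_eqI iffI inj_on_label_partition)
  fix A assume "A \<in> label_partition ` rgs n"
  then show "A \<in> {A. partition_on {1..n} A}"
    using partition_on_label_partition length_rgs by auto
qed (use label_partition_surj in auto)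

lemma set_counts_pos:
  assumes "a \<in> rgs n" shows "\<forall>m\<in>set (counts a). 0 < m"
proof
  fix m assume "m \<in> set (counts a)"
  then obtain j where "j < card (set a)" "m = count_list a j" by (auto simp: counts_def)
  moreover have "j \<in> set a" using set_rgs[OF assms] calculation(1) by blast
  ultimately show "0 < m" by (metis count_list_0_iff gr0I)
qed

lemma sum_list_counts:
  assumes "a \<in> rgs n" shows "sum_list (counts a) = n"
proof -
  have "sum_list (counts a) = (\<Sum>j\<in>set a. count_list a j)"
    by (subst set_rgs[OF assms])
       (simp add: counts_def interv_sum_list_conv_sum_set_nat atLeast0LessThan)
  then show ?thesis using sum_count_set[of a "set a"] length_rgs[OF assms] by simp
qed

text \<open>
  Adding one element preserves the total mass, so it is the mass of the only partition of a
  one-element set.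
\<close>
lemma sum_gibbs_eppf_partitions:
  assumes V: "gibbs_weights \<alpha> V" "V 1 1 = 1" and n: "1 \<le> n"
  shows "(\<Sum>A | partition_on {1..n} A. gibbs_eppf \<alpha> V (appearance_sizes A)) = 1"
proof -
  obtain m where m: "n = Suc m" using n by (cases n) auto
  have "(\<Sum>A | partition_on {1..n} A. gibbs_eppf \<alpha> V (appearance_sizes A))
      = (\<Sum>a\<in>rgs n. gibbs_eppf \<alpha> V (counts a))"
    by (subst sum.reindex_bij_betw[OF bij_betw_label_partition, symmetric]) (simp add: appearance_sizes_label_partition)
  also have "\<dots> = (grow ^^ n) (gibbs_eppf \<alpha> V) []"
    using sum_extensions[of "[]"] by simp
  also have "\<dots> = (grow ^^ m) (gibbs_eppf \<alpha> V) [1]"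
    unfolding m funpow.simps o_apply by (simp add: grow_def)
  also have "\<dots> = gibbs_eppf \<alpha> V [1]"
    by (rule funpow_grow_gibbs_eppf[OF V(1)]) auto
  also have "\<dots> = 1" using V(2) by (simp add: gibbs_eppf_def)
  finally show ?thesis .
qed

section \<open>Ordered set partitions\<close>

text \<open>
  The weights are those of drawing the elements successively, each draw choosing among the
  remaining elements \<open>x\<close> proportionally to \<open>f x - \<alpha>\<close>. The induction conditions on the first
  draw.
\<close>
lemma sum_size_biased_weight_orderings:
  fixes f :: "'a \<Rightarrow> nat"
  assumes "\<alpha> < 1"
  shows "finite A \<Longrightarrow> \<forall>x\<in>A. 0 < f x \<Longrightarrow>
    (\<Sum>xs\<in>permutations_of_set A. size_biased_weight \<alpha> (map f xs)) = 1"
proof (induction A rule: finite_psubset_induct)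
  case (psubset A)
  show ?case
  proof (cases "A = {}")
    case False
    define S where "S = (\<Sum>y\<in>A. real (f y) - \<alpha>)"
    have "0 < S"
      unfolding S_def using False psubset assms
      by (intro sum_pos) (auto intro: less_le_trans simp flip: Suc_le_eq)
    have "(\<Sum>xs\<in>permutations_of_set A. size_biased_weight \<alpha> (map f xs))
        = (\<Sum>x\<in>A. \<Sum>xs\<in>(#) x ` permutations_of_set (A - {x}). size_biased_weight \<alpha> (map f xs))"
      unfolding permutations_of_set_nonempty[OF False]
      using psubset.hyps by (intro sum.UNION_disjoint) auto
    also have "\<dots> = (\<Sum>x\<in>A. (real (f x) - \<alpha>) / S)"
    proof (intro sum.cong refl)
      fix x assume x: "x \<in> A"
      have "(\<Sum>xs\<in>(#) x ` permutations_of_set (A - {x}). size_biased_weight \<alpha> (map f xs))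
          = (\<Sum>xs\<in>permutations_of_set (A - {x}). size_biased_weight \<alpha> (map f (x # xs)))"
        by (subst sum.reindex) auto
      also have "\<dots> = (\<Sum>xs\<in>permutations_of_set (A - {x}). (real (f x) - \<alpha>) / S * size_biased_weight \<alpha> (map f xs))"
      proof (intro sum.cong refl)
        fix xs assume xs: "xs \<in> permutations_of_set (A - {x})"
        have "(\<Sum>m\<leftarrow>map f (x # xs). real m - \<alpha>) = (\<Sum>y\<in>set (x # xs). real (f y) - \<alpha>)"
          using permutations_of_setD[OF xs] sum_list_distinct_conv_sum_set[of "x # xs" "\<lambda>y. real (f y) - \<alpha>"]
          by (simp add: o_def)
        also have "set (x # xs) = A"
          using permutations_of_setD[OF xs] x by auto
        finally show "size_biased_weight \<alpha> (map f (x # xs)) = (real (f x) - \<alpha>) / S * size_biased_weight \<alpha> (map f xs)"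
          by (simp add: size_biased_weight_Cons S_def)
      qed
      also have "\<dots> = (real (f x) - \<alpha>) / S"
      proof -
        have "A - {x} \<subset> A" using x by blast
        then have "(\<Sum>xs\<in>permutations_of_set (A - {x}). size_biased_weight \<alpha> (map f xs)) = 1"
          using psubset.prems by (intro psubset.IH) auto
        then show ?thesis by (simp only: sum_distrib_left[symmetric] mult_1_right)
      qed
      finally show "(\<Sum>xs\<in>(#) x ` permutations_of_set (A - {x}). size_biased_weight \<alpha> (map f xs)) = (real (f x) - \<alpha>) / S" .
    qed
    also have "\<dots> = 1"
      using \<open>0 < S\<close> by (simp add: S_def sum_divide_distrib[symmetric])
    finally show ?thesis .
  qed simp
qed

definition ordered_partitions :: "nat set \<Rightarrow> nat set list set" where
  "ordered_partitions S = {Cs. distinct Cs \<and> partition_on S (set Cs)}"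

lemma ordered_partitions_Cons:
  "C # Cs \<in> ordered_partitions S \<longleftrightarrow> C \<noteq> {} \<and> C \<subseteq> S \<and> Cs \<in> ordered_partitions (S - C)"
proof
  assume L: "C # Cs \<in> ordered_partitions S"
  then have "disjnt C (\<Union> (set Cs))"
    by (auto simp: ordered_partitions_def partition_on_def disjoint_def disjnt_def)
  with L show "C \<noteq> {} \<and> C \<subseteq> S \<and> Cs \<in> ordered_partitions (S - C)"
    by (simp add: ordered_partitions_def partition_on_insert)
next
  assume R: "C \<noteq> {} \<and> C \<subseteq> S \<and> Cs \<in> ordered_partitions (S - C)"
  then have U: "\<Union> (set Cs) = S - C" "disjnt C (\<Union> (set Cs))"
    by (auto simp: ordered_partitions_def partition_on_def disjnt_def)
  then have "C \<notin> set Cs" using R by (auto simp: disjnt_def)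
  with R U show "C # Cs \<in> ordered_partitions S"
    by (simp add: ordered_partitions_def partition_on_insert)
qed

lemma ordered_partitions_Nil: "[] \<in> ordered_partitions S \<longleftrightarrow> S = {}"
  by (auto simp: ordered_partitions_def partition_on_def)

lemma finite_ordered_partitions [simp]:
  assumes "finite S" shows "finite (ordered_partitions S)"
proof -
  have "ordered_partitions S \<subseteq> (\<Union>A\<in>{A. partition_on S A}. permutations_of_set A)"
    by (auto simp: ordered_partitions_def permutations_of_set_def)
  then show ?thesis
    by (rule finite_subset) (intro finite_UN_I finitely_many_partition_on assms finite_permutations_of_set)
qed

lemma card_Cons_family:
  assumes "finite F" "\<And>C. C \<in> F \<Longrightarrow> finite (G C) \<and> real (card (G C)) = c"
  shows "real (card {C # Cs | C Cs. C \<in> F \<and> Cs \<in> G C}) = real (card F) * c"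
proof -
  have "{C # Cs | C Cs. C \<in> F \<and> Cs \<in> G C} = (\<lambda>(C, Cs). C # Cs) ` (SIGMA C:F. G C)"
    by auto
  moreover have "inj_on (\<lambda>(C, Cs). C # Cs) (SIGMA C:F. G C)"
    by (auto simp: inj_on_def)
  ultimately have "card {C # Cs | C Cs. C \<in> F \<and> Cs \<in> G C} = (\<Sum>C\<in>F. card (G C))"
    using assms by (simp add: card_image card_SigmaI)
  then show ?thesis using assms by simp
qed

lemma multinomial_Nil [simp]: "multinomial [] = 1"
  by (simp add: multinomial_def)

lemma multinomial_Cons:
  "multinomial (n # ns) = real (sum_list (n # ns) choose n) * multinomial ns"
proof -
  have "real ((n + sum_list ns) choose n) = fact (n + sum_list ns) / (fact n * fact (sum_list ns))"
    using binomial_fact[of n "n + sum_list ns"] by simp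
  then show ?thesis
    by (simp add: multinomial_def prod.lessThan_Suc_shift del: prod.lessThan_Suc)
qed

lemma multinomial_pos: "0 < multinomial ns"
  by (simp add: multinomial_def prod_pos)

lemma card_ordered_partitions:
  assumes "finite S" "card S = sum_list ns" "\<forall>m\<in>set ns. 0 < m"
  shows "real (card {Cs \<in> ordered_partitions S. map card Cs = ns}) = multinomial ns"
  using assms
proof (induction ns arbitrary: S)
  case Nil
  then have "{Cs \<in> ordered_partitions S. map card Cs = []} = {[]}"
    by (auto simp: ordered_partitions_Nil)
  then show ?case by simp
next
  case (Cons n ns)
  have eq: "{Cs \<in> ordered_partitions S. map card Cs = n # ns} =
    {C # Cs | C Cs. C \<in> {C. C \<subseteq> S \<and> card C = n} \<and> Cs \<in> {Cs \<in> ordered_partitions (S - C). map card Cs = ns}}"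
    using Cons.prems by (fastforce simp: ordered_partitions_Cons map_eq_Cons_conv)
  have "real (card {Cs \<in> ordered_partitions S. map card Cs = n # ns})
      = real (card {C. C \<subseteq> S \<and> card C = n}) * multinomial ns"
    unfolding eq
  proof (rule card_Cons_family)
    fix C assume "C \<in> {C. C \<subseteq> S \<and> card C = n}"
    then show "finite {Cs \<in> ordered_partitions (S - C). map card Cs = ns} \<and>
      real (card {Cs \<in> ordered_partitions (S - C). map card Cs = ns}) = multinomial ns"
      using Cons by (auto simp: card_Diff_subset finite_subset)
  qed (use Cons.prems in auto)
  also have "\<dots> = multinomial (n # ns)"
    using n_subsets[OF Cons.prems(1), of n] Cons.prems(2) by (simp add: multinomial_Cons)
  finally show ?case .
qed

lemma card_subsets_containing:
  assumes "finite S" "x \<in> S" "0 < n"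
  shows "card {C. C \<subseteq> S \<and> card C = n \<and> x \<in> C} = (card S - 1) choose (n - 1)"
proof -
  have "bij_betw (insert x) {C. C \<subseteq> S - {x} \<and> card C = n - 1} {C. C \<subseteq> S \<and> card C = n \<and> x \<in> C}"
  proof (rule bij_betw_byWitness[where f' = "\<lambda>C. C - {x}"])
    show "insert x ` {C. C \<subseteq> S - {x} \<and> card C = n - 1} \<subseteq> {C. C \<subseteq> S \<and> card C = n \<and> x \<in> C}"
    proof
      fix D assume "D \<in> insert x ` {C. C \<subseteq> S - {x} \<and> card C = n - 1}"
      then obtain C where C: "C \<subseteq> S - {x}" "card C = n - 1" "D = insert x C" by blast
      then have "finite C" using assms(1) finite_subset by blast
      moreover have "x \<notin> C" using C by blast
      ultimately have "card D = n" using C assms(3) by simp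
      then show "D \<in> {C. C \<subseteq> S \<and> card C = n \<and> x \<in> C}" using C assms(2) by blast
    qed
    show "(\<lambda>C. C - {x}) ` {C. C \<subseteq> S \<and> card C = n \<and> x \<in> C} \<subseteq> {C. C \<subseteq> S - {x} \<and> card C = n - 1}"
      by (auto simp: card_Diff_singleton)
  qed (blast intro: insert_Diff Diff_insert_absorb)+
  then have "card {C. C \<subseteq> S \<and> card C = n \<and> x \<in> C} = card {C. C \<subseteq> S - {x} \<and> card C = n - 1}"
    by (rule bij_betw_same_card[symmetric])
  also have "\<dots> = (card S - 1) choose (n - 1)"
    using n_subsets[of "S - {x}" "n - 1"] assms by simp
  finally show ?thesis .
qed

lemma sorted_Min_Cons:
  assumes "finite S" "C # Cs \<in> ordered_partitions S"
  shows "sorted_wrt (<) (map Min (C # Cs)) \<longleftrightarrow> Min S \<in> C \<and> sorted_wrt (<) (map Min Cs)"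
proof -
  have C: "C \<noteq> {}" "C \<subseteq> S" and Cs: "Cs \<in> ordered_partitions (S - C)"
    using assms(2) by (auto simp: ordered_partitions_Cons)
  have fin: "finite C" using C assms(1) finite_subset by blast
  have D: "D \<noteq> {}" "D \<subseteq> S - C" "finite D" if "D \<in> set Cs" for D
    using Cs that assms(1) by (auto simp: ordered_partitions_def partition_on_def intro: finite_subset)
  have un: "\<Union> (set Cs) = S - C" using Cs by (auto simp: ordered_partitions_def partition_on_def)
  have "(\<forall>D\<in>set Cs. Min C < Min D) \<longleftrightarrow> Min S \<in> C"
  proof
    assume L: "\<forall>D\<in>set Cs. Min C < Min D"
    show "Min S \<in> C"
    proof (rule ccontr)
      assume "Min S \<notin> C"
      moreover have "Min S \<in> S" using C assms(1) by (intro Min_in) auto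
      ultimately obtain D where "D \<in> set Cs" "Min S \<in> D" using un by blast
      then have "Min C < Min D" "Min D \<le> Min S" using L D by auto
      moreover have "Min S \<le> Min C" using C fin assms(1) by (intro Min_antimono)
      ultimately show False by simp
    qed
  next
    assume R: "Min S \<in> C"
    show "\<forall>D\<in>set Cs. Min C < Min D"
    proof
      fix E assume E: "E \<in> set Cs"
      have m: "Min E \<in> E" using D[OF E] by (intro Min_in)
      have "Min C \<le> Min S" using R fin by simp
      also have "\<dots> \<le> Min E" using m D[OF E] assms(1) by auto
      finally have "Min C \<le> Min E" .
      moreover have "Min C \<in> C" using C fin by (intro Min_in)
      then have "Min C \<noteq> Min E" using m D(2)[OF E] by (metis Diff_iff subsetD)
      ultimately show "Min C < Min E" by simp
    qed
  qed
  then show ?thesis by auto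
qed

text \<open>
  The first block contains the least element, so it is determined by \<open>n - 1\<close> of the other elements.
  Compared with unrestricted ordered partitions, this replaces the binomial coefficient \<open>N choose n\<close>
  by \<open>(N - 1) choose (n - 1) = (n / N) * (N choose n)\<close>, where \<open>N\<close> is the number of elements left.
  The quotients \<open>n / N\<close> are the factors of \<open>size_biased_weight 0\<close>.
\<close>
lemma card_sorted_ordered_partitions:
  assumes "finite S" "card S = sum_list ns" "\<forall>m\<in>set ns. 0 < m"
  shows "real (card {Cs \<in> ordered_partitions S. map card Cs = ns \<and> sorted_wrt (<) (map Min Cs)})
    = multinomial ns * size_biased_weight 0 ns"
  using assms
proof (induction ns arbitrary: S)
  case Nil
  then have "{Cs \<in> ordered_partitions S. map card Cs = [] \<and> sorted_wrt (<) (map Min Cs)} = {[]}"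
    by (auto simp: ordered_partitions_Nil)
  then show ?case by simp
next
  case (Cons n ns)
  have n: "0 < n" using Cons.prems by simp
  then have ne: "S \<noteq> {}" using Cons.prems(2) by auto
  have eq: "{Cs \<in> ordered_partitions S. map card Cs = n # ns \<and> sorted_wrt (<) (map Min Cs)} =
    {C # Cs | C Cs. C \<in> {C. C \<subseteq> S \<and> card C = n \<and> Min S \<in> C} \<and>
       Cs \<in> {Cs \<in> ordered_partitions (S - C). map card Cs = ns \<and> sorted_wrt (<) (map Min Cs)}}"
    (is "?L = ?R")
  proof (intro set_eqI iffI)
    fix Ds assume Ds: "Ds \<in> ?L"
    then obtain C Cs where CC: "Ds = C # Cs" "card C = n" "map card Cs = ns"
      by (auto simp: map_eq_Cons_conv)
    then show "Ds \<in> ?R"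
      using Ds sorted_Min_Cons[OF Cons.prems(1), of C Cs] by (auto simp: ordered_partitions_Cons)
  next
    fix Ds assume "Ds \<in> ?R"
    then obtain C Cs where CC: "Ds = C # Cs" "C \<subseteq> S" "card C = n" "Min S \<in> C"
      "Cs \<in> ordered_partitions (S - C)" "map card Cs = ns" "sorted_wrt (<) (map Min Cs)" by blast
    then have "C # Cs \<in> ordered_partitions S" by (auto simp: ordered_partitions_Cons)
    then show "Ds \<in> ?L"
      using CC sorted_Min_Cons[OF Cons.prems(1), of C Cs] by simp
  qed
  have "real (card ?L) = real (card {C. C \<subseteq> S \<and> card C = n \<and> Min S \<in> C}) * (multinomial ns * size_biased_weight 0 ns)"
    unfolding eq
  proof (rule card_Cons_family)
    fix C assume C: "C \<in> {C. C \<subseteq> S \<and> card C = n \<and> Min S \<in> C}"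
    then have "card (S - C) = sum_list ns"
      using Cons.prems by (auto simp: card_Diff_subset finite_subset)
    then show "finite {Cs \<in> ordered_partitions (S - C). map card Cs = ns \<and> sorted_wrt (<) (map Min Cs)} \<and>
      real (card {Cs \<in> ordered_partitions (S - C). map card Cs = ns \<and> sorted_wrt (<) (map Min Cs)})
        = multinomial ns * size_biased_weight 0 ns"
      using Cons.IH[of "S - C"] Cons.prems by simp
  qed (use Cons.prems in auto)
  also have "card {C. C \<subseteq> S \<and> card C = n \<and> Min S \<in> C} = (card S - 1) choose (n - 1)"
    using Cons.prems(1) n ne by (intro card_subsets_containing Min_in)
  also have "real ((card S - 1) choose (n - 1)) * (multinomial ns * size_biased_weight 0 ns)
      = multinomial (n # ns) * size_biased_weight 0 (n # ns)"
  proof -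
    obtain m where m: "n = Suc m" using n by (cases n) auto
    define s where "s = sum_list ns"
    have "real (Suc m) * real (Suc (m + s) choose Suc m) = real (Suc (m + s)) * real ((m + s) choose m)"
      using Suc_times_binomial_eq[of "m + s" m] by (metis mult.commute of_nat_mult)
    then have "real ((m + s) choose m) = real (Suc (m + s) choose Suc m) * (real (Suc m) / real (Suc (m + s)))"
      by (simp add: field_simps del: binomial_Suc_Suc of_nat_Suc)
    moreover have "(\<Sum>m\<leftarrow>n # ns. real m - 0) = real (Suc (m + s))"
      using sum_list_minus_const[of 0 "n # ns"] by (simp add: m s_def)
    moreover have "card S - 1 = m + s" "sum_list (n # ns) = Suc (m + s)" "n - 1 = m"
      using Cons.prems(2) by (simp_all add: m s_def)
    ultimately show ?thesis
      unfolding multinomial_Cons size_biased_weight_Cons m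
      by (simp del: binomial_Suc_Suc of_nat_Suc)
  qed
  finally show ?case .
qed

lemma partitions_eq_sorted_ordered:
  assumes "finite S"
  shows "bij_betw set {Cs \<in> ordered_partitions S. map card Cs = ns \<and> sorted_wrt (<) (map Min Cs)}
    {A. partition_on S A \<and> appearance_sizes A = ns}"
proof (rule bij_betw_byWitness[where f' = "sorted_key_list_of_set Min"])
  show "\<forall>Cs\<in>{Cs \<in> ordered_partitions S. map card Cs = ns \<and> sorted_wrt (<) (map Min Cs)}.
      sorted_key_list_of_set Min (set Cs) = Cs"
    using sorted_key_list_of_set_eqI[of Min] by blast
  have props: "set (sorted_key_list_of_set Min A) = A" "distinct (sorted_key_list_of_set Min A)"
    "sorted_wrt (<) (map Min (sorted_key_list_of_set Min A))"
    if "partition_on S A" for A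
    using sorted_key_list_of_set_props[OF inj_on_Min_partition[OF that assms]] finite_elements[OF assms that]
    by auto
  then show "\<forall>A\<in>{A. partition_on S A \<and> appearance_sizes A = ns}. set (sorted_key_list_of_set Min A) = A"
    by blast
  show "set ` {Cs \<in> ordered_partitions S. map card Cs = ns \<and> sorted_wrt (<) (map Min Cs)}
      \<subseteq> {A. partition_on S A \<and> appearance_sizes A = ns}"
    by (auto simp: ordered_partitions_def appearance_sizes_def sorted_key_list_of_set_eqI)
  show "sorted_key_list_of_set Min ` {A. partition_on S A \<and> appearance_sizes A = ns} \<subseteq>
      {Cs \<in> ordered_partitions S. map card Cs = ns \<and> sorted_wrt (<) (map Min Cs)}"
    using props by (auto simp: ordered_partitions_def appearance_sizes_def)
qed

lemma card_partitions_appearance_sizes: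
  assumes "finite S" "card S = sum_list ns" "\<forall>m\<in>set ns. 0 < m"
  shows "real (card {A. partition_on S A \<and> appearance_sizes A = ns}) = multinomial ns * size_biased_weight 0 ns"
  using bij_betw_same_card[OF partitions_eq_sorted_ordered[OF assms(1), of ns]]
    card_sorted_ordered_partitions[OF assms] by simp

lemma mset_appearance_sizes:
  assumes "Cs \<in> ordered_partitions S" "finite S"
  shows "mset (map card Cs) = mset (appearance_sizes (set Cs))"
proof -
  have p: "partition_on S (set Cs)" "distinct Cs" using assms(1) by (auto simp: ordered_partitions_def)
  have "mset (sorted_key_list_of_set Min (set Cs)) = mset Cs"
    using sorted_key_list_of_set_props[OF inj_on_Min_partition[OF p(1) assms(2)]] p(2)
    by (metis List.finite_set set_eq_iff_mset_eq_distinct)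
  then show ?thesis by (simp add: appearance_sizes_def)
qed

lemma composition_sizes:
  assumes "Cs \<in> ordered_partitions S" "finite S"
  shows "composition (card S) (map card Cs)"
proof -
  have p: "partition_on S (set Cs)" "distinct Cs" using assms(1) by (auto simp: ordered_partitions_def)
  have fin: "finite C" if "C \<in> set Cs" for C
    using p(1) that assms(2) by (auto simp: partition_on_def intro: finite_subset)
  have "card S = (\<Sum>C\<in>set Cs. card C)"
    using p(1) fin by (subst card_Union_disjoint[symmetric]) (auto simp: partition_on_def disjoint_def pairwise_def disjnt_def)
  also have "\<dots> = sum_list (map card Cs)" using p(2) by (simp add: sum_list_distinct_conv_sum_set)
  finally show ?thesis
    using p(1) fin by (auto simp: composition_def partition_on_def card_gt_0_iff)
qed

lemma sum_ordered_partitions: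
  assumes "finite S"
  shows "(\<Sum>Cs | Cs \<in> ordered_partitions S \<and> \<phi> Cs. g Cs) =
    (\<Sum>A | partition_on S A. \<Sum>Cs | Cs \<in> permutations_of_set A \<and> \<phi> Cs. g Cs)"
proof -
  have "(\<Sum>A\<in>{A. partition_on S A}. \<Sum>Cs\<in>{Cs \<in> {Cs. Cs \<in> ordered_partitions S \<and> \<phi> Cs}. set Cs = A}. g Cs)
      = (\<Sum>Cs\<in>{Cs. Cs \<in> ordered_partitions S \<and> \<phi> Cs}. g Cs)"
  proof (rule sum.group)
    show "finite {Cs. Cs \<in> ordered_partitions S \<and> \<phi> Cs}"
      using finite_ordered_partitions[OF assms] by (rule rev_finite_subset) blast
  qed (use assms in \<open>auto simp: ordered_partitions_def finitely_many_partition_on\<close>)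
  moreover have "{Cs \<in> {Cs. Cs \<in> ordered_partitions S \<and> \<phi> Cs}. set Cs = A} = {Cs. Cs \<in> permutations_of_set A \<and> \<phi> Cs}"
    if "partition_on S A" for A
    using that by (auto simp: ordered_partitions_def permutations_of_set_def)
  ultimately show ?thesis by simp
qed

lemma permutations_of_set_eq_permute_list:
  assumes "distinct xs"
  shows "bij_betw (\<lambda>\<sigma>. permute_list \<sigma> xs) {\<sigma>. \<sigma> permutes {..<length xs}} (permutations_of_set (set xs))"
  unfolding bij_betw_def
proof
  show "inj_on (\<lambda>\<sigma>. permute_list \<sigma> xs) {\<sigma>. \<sigma> permutes {..<length xs}}"
  proof (rule inj_onI)
    fix \<sigma> \<tau> assume p: "\<sigma> \<in> {\<sigma>. \<sigma> permutes {..<length xs}}" "\<tau> \<in> {\<sigma>. \<sigma> permutes {..<length xs}}"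
      and eq: "permute_list \<sigma> xs = permute_list \<tau> xs"
    show "\<sigma> = \<tau>"
    proof
      fix i
      show "\<sigma> i = \<tau> i"
      proof (cases "i < length xs")
        case True
        then have "xs ! \<sigma> i = xs ! \<tau> i"
          using p arg_cong[OF eq, of "\<lambda>l. l ! i"] by (simp add: permute_list_nth)
        moreover have "\<sigma> i < length xs" "\<tau> i < length xs"
          using p True permutes_in_image by fastforce+
        ultimately show ?thesis using assms nth_eq_iff_index_eq by blast
      next
        case False
        then show ?thesis using p by (simp add: permutes_not_in)
      qed
    qed
  qed
  show "(\<lambda>\<sigma>. permute_list \<sigma> xs) ` {\<sigma>. \<sigma> permutes {..<length xs}} = permutations_of_set (set xs)"
  proof (intro set_eqI iffI)
    fix ys assume "ys \<in> permutations_of_set (set xs)"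
    then have "mset ys = mset xs"
      using assms by (metis permutations_of_setD set_eq_iff_mset_eq_distinct)
    then obtain \<sigma> where "\<sigma> permutes {..<length xs}" "permute_list \<sigma> xs = ys"
      by (rule mset_eq_permutation)
    then show "ys \<in> (\<lambda>\<sigma>. permute_list \<sigma> xs) ` {\<sigma>. \<sigma> permutes {..<length xs}}" by blast
  qed (use assms in \<open>auto simp: permutations_of_set_def\<close>)
qed

text \<open>
  Permutations of indices correspond to orderings of the blocks, which are distinct even where
  their sizes coincide. So repeated sizes are counted as often on both sides.
\<close>
lemma sum_orderings_with_sizes:
  assumes "partition_on S A" "finite S" "appearance_sizes A = ns"
  shows "(\<Sum>Cs | Cs \<in> permutations_of_set A \<and> map card Cs = ms. size_biased_weight \<alpha> (map card Cs))
    = size_biased_perm_prob \<alpha> ns ms"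
proof -
  define Ds where "Ds = sorted_key_list_of_set Min A"
  have Ds: "set Ds = A" "distinct Ds" "map card Ds = ns"
    using sorted_key_list_of_set_props[OF inj_on_Min_partition[OF assms(1,2)]] finite_elements[OF assms(2,1)] assms(3)
    by (auto simp: Ds_def appearance_sizes_def)
  have len: "length Ds = length ns" using Ds(3) by auto
  have bij: "bij_betw (\<lambda>\<sigma>. permute_list \<sigma> Ds) {\<sigma>. \<sigma> permutes {..<length ns}} (permutations_of_set A)"
    using permutations_of_set_eq_permute_list[OF Ds(2)] Ds(1) len by simp
  have m: "map card (permute_list \<sigma> Ds) = permute_list \<sigma> ns" if "\<sigma> permutes {..<length ns}" for \<sigma>
    using permute_list_map[of \<sigma> Ds card] that Ds(3) len by simp
  have "(\<Sum>Cs | Cs \<in> permutations_of_set A \<and> map card Cs = ms. size_biased_weight \<alpha> (map card Cs))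
     = (\<Sum>Cs\<in>permutations_of_set A. if map card Cs = ms then size_biased_weight \<alpha> (map card Cs) else 0)"
    by (simp add: sum.inter_filter[symmetric])
  also have "\<dots> = (\<Sum>\<sigma> | \<sigma> permutes {..<length ns}. if permute_list \<sigma> ns = ms then size_biased_weight \<alpha> (permute_list \<sigma> ns) else 0)"
    by (subst sum.reindex_bij_betw[OF bij, symmetric]) (intro sum.cong refl, simp add: m)
  also have "\<dots> = size_biased_perm_prob \<alpha> ns ms"
    unfolding size_biased_perm_prob_def by (subst sum.inter_filter[symmetric]) (auto simp: finite_permutations)
  finally show ?thesis .
qed

section \<open>Clusters of a random sample\<close>

text \<open>
  The outcome of the sample in which the elements of the \<open>k\<close>th block have the \<open>k\<close>th value. At most
  one summand is nonzero, because the blocks are disjoint.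
\<close>
definition block_value :: "nat set list \<Rightarrow> nat list \<Rightarrow> nat \<Rightarrow> nat" where
  "block_value Cs js i = (\<Sum>k<length Cs. if i \<in> Cs ! k then js ! k else 0)"

lemma ordered_partitions_disjoint:
  assumes "Cs \<in> ordered_partitions S" "k < length Cs" "l < length Cs" "i \<in> Cs ! k" "i \<in> Cs ! l"
  shows "k = l"
proof -
  have "distinct Cs" "disjoint (set Cs)"
    using assms(1) by (auto simp: ordered_partitions_def partition_on_def)
  moreover have "Cs ! k \<in> set Cs" "Cs ! l \<in> set Cs" using assms by auto
  ultimately have "Cs ! k = Cs ! l" using assms(4,5) by (auto simp: disjoint_def)
  then show ?thesis using \<open>distinct Cs\<close> assms(2,3) by (simp add: nth_eq_iff_index_eq)
qed

lemma ordered_partitions_cover: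
  assumes "Cs \<in> ordered_partitions S" "i \<in> S"
  obtains k where "k < length Cs" "i \<in> Cs ! k"
proof -
  have "i \<in> \<Union> (set Cs)" using assms by (auto simp: ordered_partitions_def partition_on_def)
  then show ?thesis using that by (metis UnionE in_set_conv_nth)
qed

lemma block_value_eq:
  assumes "Cs \<in> ordered_partitions S" "k < length Cs" "i \<in> Cs ! k"
  shows "block_value Cs js i = js ! k"
proof -
  have "block_value Cs js i = (\<Sum>l<length Cs. if l = k then js ! k else 0)"
    unfolding block_value_def
    by (intro sum.cong refl) (use ordered_partitions_disjoint[OF assms(1)] assms(2,3) in auto)
  then show ?thesis using assms(2) by simp
qed

lemma prod_block_value:
  assumes "Cs \<in> ordered_partitions S" "finite S"
  shows "(\<Prod>i\<in>S. f (block_value Cs js i)) = (\<Prod>k<length Cs. f (js ! k) ^ card (Cs ! k) :: real)"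
proof -
  have S: "S = (\<Union>k\<in>{..<length Cs}. Cs ! k)"
    using assms(1) by (auto simp: ordered_partitions_def partition_on_def in_set_conv_nth)
       (metis UnionI in_set_conv_nth)+
  have "(\<Prod>i\<in>S. f (block_value Cs js i)) = (\<Prod>k<length Cs. \<Prod>i\<in>Cs ! k. f (block_value Cs js i))"
  proof (subst S, rule prod.UNION_disjoint)
    show "\<forall>k\<in>{..<length Cs}. finite (Cs ! k)"
    proof
      fix k assume "k \<in> {..<length Cs}"
      then have "Cs ! k \<subseteq> S" using S by blast
      then show "finite (Cs ! k)" using assms(2) finite_subset by blast
    qed
  qed (use ordered_partitions_disjoint[OF assms(1)] in auto)
  also have "\<dots> = (\<Prod>k<length Cs. \<Prod>i\<in>Cs ! k. f (js ! k))"
    using block_value_eq[OF assms(1)] by (intro prod.cong refl) auto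
  finally show ?thesis by simp
qed

definition value_order :: "nat \<Rightarrow> (nat \<Rightarrow> 'w \<Rightarrow> nat) \<Rightarrow> 'w \<Rightarrow> nat set list" where
  "value_order n X w = sorted_key_list_of_set (\<lambda>C. X (Min C) w) (sample_clusters n X w)"

lemma sample_clusters_eq:
  "sample_clusters n X w = (\<lambda>i. {j \<in> {1..n}. X j w = X i w}) ` {1..n}"
proof -
  have "{(i, j). i \<in> {1..n} \<and> j \<in> {1..n} \<and> X i w = X j w} `` {i} = {j \<in> {1..n}. X j w = X i w}"
    if "i \<in> {1..n}" for i
    using that by auto
  then show ?thesis unfolding sample_clusters_def quotient_def by auto
qed

lemma partition_on_sample_clusters: "partition_on {1..n} (sample_clusters n X w)"
  unfolding sample_clusters_eq by (intro partition_onI) (auto simp: disjnt_def)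

lemma X_Min_cluster:
  assumes "C \<in> sample_clusters n X w" "i \<in> C"
  shows "X (Min C) w = X i w"
proof -
  obtain j where C: "C = {l \<in> {1..n}. X l w = X j w}"
    using assms(1) by (auto simp: sample_clusters_eq)
  have "Min C \<in> C" using assms(2) by (intro Min_in) (auto simp: C)
  then show ?thesis using assms(2) by (auto simp: C)
qed

lemma value_order_props:
  shows set_value_order: "set (value_order n X w) = sample_clusters n X w"
    and value_order_in: "value_order n X w \<in> ordered_partitions {1..n}"
    and sorted_value_order: "sorted_wrt (<) (map (\<lambda>C. X (Min C) w) (value_order n X w))"
proof -
  have "inj_on (\<lambda>C. X (Min C) w) (sample_clusters n X w)"
  proof (rule inj_onI)
    fix C D assume CD: "C \<in> sample_clusters n X w" "D \<in> sample_clusters n X w"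
      and eq: "X (Min C) w = X (Min D) w"
    obtain i j where ij: "i \<in> {1..n}" "C = {l \<in> {1..n}. X l w = X i w}"
        "j \<in> {1..n}" "D = {l \<in> {1..n}. X l w = X j w}"
      using CD by (auto simp: sample_clusters_eq)
    have "i \<in> C" "j \<in> D" unfolding ij(2,4) using ij(1,3) by simp_all
    then have "X i w = X j w"
      using X_Min_cluster[OF CD(1)] X_Min_cluster[OF CD(2)] eq by metis
    then show "C = D" unfolding ij(2,4) by simp
  qed
  moreover have "finite (sample_clusters n X w)" by (simp add: sample_clusters_eq)
  ultimately have p: "set (value_order n X w) = sample_clusters n X w" "distinct (value_order n X w)"
    "sorted_wrt (<) (map (\<lambda>C. X (Min C) w) (value_order n X w))"
    unfolding value_order_def by (rule sorted_key_list_of_set_props)+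
  then show "set (value_order n X w) = sample_clusters n X w"
    "value_order n X w \<in> ordered_partitions {1..n}"
    "sorted_wrt (<) (map (\<lambda>C. X (Min C) w) (value_order n X w))"
    using partition_on_sample_clusters by (auto simp: ordered_partitions_def)
qed

text \<open>
  The event that \<open>Cs\<close> is the list of clusters in increasing order of values is the union over
  increasing lists \<open>js\<close> of the events that block \<open>k\<close> has the common value \<open>js ! k\<close>. The bound \<open>K\<close> on
  the values exhibits it as an increasing limit of finite unions.
\<close>
lemma value_order_eq_iff:
  assumes Cs: "Cs \<in> ordered_partitions {1..n}" and X: "\<forall>i\<in>{1..n}. 1 \<le> X i w"
  shows "value_order n X w = Cs \<longleftrightarrow>
    (\<exists>K. \<exists>js\<in>inc_lists 1 (Suc K) (length Cs). \<forall>i\<in>{1..n}. X i w = block_value Cs js i)"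
proof
  assume v: "value_order n X w = Cs"
  define js where "js = map (\<lambda>C. X (Min C) w) Cs"
  have sorted: "sorted_wrt (<) js" using sorted_value_order[where n=n and X=X and w=w] by (simp add: js_def v)
  have blocks: "Min C \<in> C" "C \<subseteq> {1..n}" if "C \<in> set Cs" for C
  proof -
    have "C \<noteq> {}" "C \<subseteq> {1..n}" using Cs that by (auto simp: ordered_partitions_def partition_on_def)
    then show "Min C \<in> C" "C \<subseteq> {1..n}" by (auto intro: Min_in finite_subset)
  qed
  have "set js \<subseteq> {1..<Suc (Max (set js))}"
  proof
    fix j assume j: "j \<in> set js"
    then obtain C where C: "C \<in> set Cs" "j = X (Min C) w" by (auto simp: js_def)
    then have "1 \<le> j" using blocks[OF C(1)] X by auto
    moreover have "j \<le> Max (set js)" using j by simp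
    ultimately show "j \<in> {1..<Suc (Max (set js))}" by simp
  qed
  then have "js \<in> inc_lists 1 (Suc (Max (set js))) (length Cs)"
    using sorted by (simp add: inc_lists_def js_def)
  moreover have "X i w = block_value Cs js i" if i: "i \<in> {1..n}" for i
  proof -
    obtain k where k: "k < length Cs" "i \<in> Cs ! k" by (rule ordered_partitions_cover[OF Cs i])
    have "Cs ! k \<in> sample_clusters n X w"
      using set_value_order[where n=n and X=X and w=w] k(1) by (simp add: v flip: set_value_order)
    then have "X i w = js ! k"
      using X_Min_cluster[of "Cs ! k" n X w i] k by (simp add: js_def)
    then show ?thesis using block_value_eq[OF Cs k] by simp
  qed
  ultimately show "\<exists>K. \<exists>js\<in>inc_lists 1 (Suc K) (length Cs). \<forall>i\<in>{1..n}. X i w = block_value Cs js i"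
    by blast
next
  assume "\<exists>K. \<exists>js\<in>inc_lists 1 (Suc K) (length Cs). \<forall>i\<in>{1..n}. X i w = block_value Cs js i"
  then obtain js where js: "sorted_wrt (<) js" "length js = length Cs"
    and Xj: "\<And>i. i \<in> {1..n} \<Longrightarrow> X i w = block_value Cs js i"
    by (auto simp: inc_lists_def)
  have sub: "Cs ! k \<subseteq> {1..n}" "Cs ! k \<noteq> {}" if "k < length Cs" for k
    using Cs nth_mem[OF that] by (auto simp: ordered_partitions_def partition_on_def)
  have Xk: "X i w = js ! k" if "k < length Cs" "i \<in> Cs ! k" for i k
    using Xj[of i] block_value_eq[OF Cs that, of js] sub[OF that(1)] that(2) by auto
  have inj: "k = l" if "k < length Cs" "l < length Cs" "js ! k = js ! l" for k l
    using js that strict_sorted_iff[of js] by (simp add: nth_eq_iff_index_eq)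
  have cluster: "{j \<in> {1..n}. X j w = X i w} = Cs ! k" if k: "k < length Cs" "i \<in> Cs ! k" for i k
  proof (intro set_eqI iffI)
    fix j assume j: "j \<in> {j \<in> {1..n}. X j w = X i w}"
    then obtain l where l: "l < length Cs" "j \<in> Cs ! l" using ordered_partitions_cover[OF Cs] by blast
    then have "k = l" using j Xk[OF k] Xk[OF l] inj k by auto
    then show "j \<in> Cs ! k" using l by simp
  next
    fix j assume "j \<in> Cs ! k"
    then show "j \<in> {j \<in> {1..n}. X j w = X i w}"
      using Xk k sub[OF k(1)] by auto
  qed
  have "sample_clusters n X w = set Cs"
  proof (intro set_eqI iffI)
    fix C assume "C \<in> sample_clusters n X w"
    then obtain i where i: "i \<in> {1..n}" "C = {j \<in> {1..n}. X j w = X i w}" by (auto simp: sample_clusters_eq)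
    obtain k where k: "k < length Cs" "i \<in> Cs ! k" by (rule ordered_partitions_cover[OF Cs i(1)])
    then show "C \<in> set Cs" using cluster[OF k] i by simp
  next
    fix C assume "C \<in> set Cs"
    then obtain k where k: "k < length Cs" "C = Cs ! k" by (auto simp: in_set_conv_nth)
    then obtain i where i: "i \<in> Cs ! k" using sub by blast
    then have "i \<in> {1..n}" using sub k by blast
    then show "C \<in> sample_clusters n X w" using cluster[OF k(1) i] k(2) by (auto simp: sample_clusters_eq)
  qed
  moreover have "map (\<lambda>C. X (Min C) w) Cs = js"
  proof (rule nth_equalityI)
    fix k assume "k < length (map (\<lambda>C. X (Min C) w) Cs)"
    then have k: "k < length Cs" by simp
    have "Min (Cs ! k) \<in> Cs ! k" using sub[OF k] by (intro Min_in) (auto intro: finite_subset)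
    then show "map (\<lambda>C. X (Min C) w) Cs ! k = js ! k" using Xk[OF k] k by simp
  qed (simp add: js(2))
  ultimately show "value_order n X w = Cs"
    unfolding value_order_def using js(1) by (metis sorted_key_list_of_set_eqI)
qed

lemma N_inc_eq: "N_inc n X w = map card (value_order n X w)"
  by (simp add: N_inc_def value_order_def)

lemma N_app_eq: "N_app n X w = appearance_sizes (set (value_order n X w))"
  by (simp add: N_app_def set_value_order)

text \<open>
  Averaging the conditional probabilities over the frequencies.
\<close>
lemma prob_sample_eq:
  assumes "prob_space M" and rs: "random_sample M P n X" and x: "x \<in> {1..n} \<rightarrow> {1..}"
  shows "{w \<in> space M. \<forall>i\<in>{1..n}. X i w = x i} \<in> sets M"
    and "measure M {w \<in> space M. \<forall>i\<in>{1..n}. X i w = x i} = (\<integral>w. (\<Prod>i\<in>{1..n}. P (x i) w) \<partial>M)"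
proof -
  interpret prob_space M by fact
  have [measurable]: "P j \<in> borel_measurable M" if "1 \<le> j" for j
    using rs that by (simp add: random_sample_def)
  have Xm: "X i \<in> M \<rightarrow>\<^sub>M count_space {1..}" if "i \<in> {1..n}" for i
    using rs that by (simp add: random_sample_def)
  let ?E = "{w \<in> space M. \<forall>i\<in>{1..n}. X i w = x i}"
  have "{w \<in> space M. X i w = x i} \<in> sets M" if i: "i \<in> {1..n}" for i
  proof -
    have "{w \<in> space M. X i w = x i} = X i -` {x i} \<inter> space M" by auto
    moreover have "x i \<in> {1..}" using x i by (rule funcset_mem)
    ultimately show ?thesis using measurable_sets[OF Xm[OF i], of "{x i}"] by simp
  qed
  then show E: "?E \<in> sets M" by (intro sets.sets_Collect_finite_All) auto
  let ?F = "vimage_algebra (space M) (freq_seq P) seq_space"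
  have "freq_seq P \<in> M \<rightarrow>\<^sub>M seq_space" by (rule measurable_restrict) simp
  then have "subalgebra M ?F"
    by (simp add: subalgebra_def sets_image_in_sets)
  then interpret F: finite_measure_subalgebra M ?F by unfold_locales
  have "(\<integral>w. (\<Prod>i\<in>{1..n}. P (x i) w) \<partial>M) = (\<integral>w. real_cond_exp M ?F (indicator ?E) w \<partial>M)"
  proof (rule integral_cong_AE)
    show "(\<lambda>w. \<Prod>i\<in>{1..n}. P (x i) w) \<in> borel_measurable M"
    proof (rule borel_measurable_prod)
      fix i assume "i \<in> {1..n}"
      then have "1 \<le> x i" using x by auto
      then show "P (x i) \<in> borel_measurable M" by simp
    qed
    have "AE w in M. real_cond_exp M ?F (indicator ?E) w = (\<Prod>i\<in>{1..n}. P (x i) w)"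
      using rs x by (simp add: random_sample_def)
    then show "AE w in M. (\<Prod>i\<in>{1..n}. P (x i) w) = real_cond_exp M ?F (indicator ?E) w"
      by eventually_elim simp
  qed simp
  also have "\<dots> = (\<integral>w. indicator ?E w \<partial>M)"
    using E by (intro F.real_cond_exp_int(2)) (simp add: emeasure_eq_measure)
  also have "\<dots> = measure M ?E" using E by simp
  finally show "measure M ?E = (\<integral>w. (\<Prod>i\<in>{1..n}. P (x i) w) \<partial>M)" by simp
qed

lemma measure_value_order_sum:
  assumes "prob_space M" and "\<And>Cs. Cs \<in> ordered_partitions {1..n} \<Longrightarrow> {w \<in> space M. value_order n X w = Cs} \<in> sets M"
  shows "measure M {w \<in> space M. \<phi> (value_order n X w)} =
    (\<Sum>Cs | Cs \<in> ordered_partitions {1..n} \<and> \<phi> Cs. measure M {w \<in> space M. value_order n X w = Cs})"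
proof -
  interpret prob_space M by fact
  let ?I = "{Cs. Cs \<in> ordered_partitions {1..n} \<and> \<phi> Cs}"
  have "finite ?I"
    using finite_ordered_partitions[of "{1..n}"] by (rule rev_finite_subset) auto
  moreover have "(\<lambda>Cs. {w \<in> space M. value_order n X w = Cs}) ` ?I \<subseteq> sets M"
    using assms(2) by blast
  moreover have "disjoint_family_on (\<lambda>Cs. {w \<in> space M. value_order n X w = Cs}) ?I"
    unfolding disjoint_family_on_def by blast
  ultimately have "measure M (\<Union>Cs\<in>?I. {w \<in> space M. value_order n X w = Cs})
    = (\<Sum>Cs\<in>?I. measure M {w \<in> space M. value_order n X w = Cs})"
    by (rule finite_measure_finite_Union)
  moreover have "{w \<in> space M. \<phi> (value_order n X w)} = (\<Union>Cs\<in>?I. {w \<in> space M. value_order n X w = Cs})"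
    using value_order_in[of n X] by (auto simp del: One_nat_def)
  ultimately show ?thesis by (simp only:)
qed

lemma value_order_prob_le:
  fixes b :: real
  assumes "prob_space M" "random_sample M P n X" and Cs: "Cs \<in> ordered_partitions {1..n}"
    and bound: "\<And>K. (\<Sum>js\<in>inc_lists 1 (Suc K) (length Cs).
        \<integral>w. (\<Prod>k<length Cs. P (js ! k) w ^ card (Cs ! k)) \<partial>M) \<le> b"
  shows "{w \<in> space M. value_order n X w = Cs} \<in> sets M"
    and "measure M {w \<in> space M. value_order n X w = Cs} \<le> b"
proof -
  interpret prob_space M by fact
  let ?A = "\<lambda>js. {w \<in> space M. \<forall>i\<in>{1..n}. X i w = block_value Cs js i}"
  let ?E = "\<lambda>K. \<Union>js\<in>inc_lists 1 (Suc K) (length Cs). ?A js"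
  have fc: "block_value Cs js \<in> {1..n} \<rightarrow> {1..}" if js: "js \<in> inc_lists 1 (Suc K) (length Cs)" for js K
  proof
    fix i assume "i \<in> {1..n}"
    then obtain k where k: "k < length Cs" "i \<in> Cs ! k" by (rule ordered_partitions_cover[OF Cs])
    have "set js \<subseteq> {1..<Suc K}" "k < length js" using js k(1) by (auto simp: inc_lists_def)
    then have "js ! k \<in> {1..<Suc K}" by (meson nth_mem subsetD)
    then show "block_value Cs js i \<in> {1..}" using block_value_eq[OF Cs k] by simp
  qed
  have E: "?E K \<in> sets M" for K
    by (intro sets.finite_UN prob_sample_eq(1)[OF assms(1,2) fc]) auto
  have pos: "\<forall>i\<in>{1..n}. 1 \<le> X i w" if "w \<in> space M" for w
    using assms(2) that by (auto simp: random_sample_def dest!: measurable_space)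
  have eq: "{w \<in> space M. value_order n X w = Cs} = (\<Union>K. ?E K)"
  proof (rule set_eqI)
    fix w show "w \<in> {w \<in> space M. value_order n X w = Cs} \<longleftrightarrow> w \<in> (\<Union>K. ?E K)"
      using value_order_eq_iff[where X = X and w = w, OF Cs] pos[of w] by (cases "w \<in> space M") simp_all
  qed
  show "{w \<in> space M. value_order n X w = Cs} \<in> sets M"
    unfolding eq using E by blast
  have "inc_lists 1 (Suc K) k \<subseteq> inc_lists 1 (Suc (Suc K)) k" for K k
    by (auto simp: inc_lists_def)
  then have "incseq ?E" by (intro incseq_SucI UN_mono) auto
  then have "(\<lambda>K. measure M (?E K)) \<longlonglongrightarrow> measure M (\<Union>K. ?E K)"
    using E by (intro finite_Lim_measure_incseq) auto
  moreover have "measure M (?E K) \<le> b" for K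
  proof -
    have "measure M (?E K) \<le> (\<Sum>js\<in>inc_lists 1 (Suc K) (length Cs). measure M (?A js))"
      using prob_sample_eq(1)[OF assms(1,2) fc] by (intro finite_measure_subadditive_finite) auto
    also have "\<dots> = (\<Sum>js\<in>inc_lists 1 (Suc K) (length Cs). \<integral>w. (\<Prod>k<length Cs. P (js ! k) w ^ card (Cs ! k)) \<partial>M)"
    proof (intro sum.cong refl)
      fix js assume "js \<in> inc_lists 1 (Suc K) (length Cs)"
      then have "measure M (?A js) = (\<integral>w. (\<Prod>i\<in>{1..n}. P (block_value Cs js i) w) \<partial>M)"
        by (rule prob_sample_eq(2)[OF assms(1,2) fc])
      also have "(\<lambda>w. \<Prod>i\<in>{1..n}. P (block_value Cs js i) w) = (\<lambda>w. \<Prod>k<length Cs. P (js ! k) w ^ card (Cs ! k))"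
        using prod_block_value[OF Cs] by (intro ext) simp
      finally show "measure M (?A js) = (\<integral>w. (\<Prod>k<length Cs. P (js ! k) w ^ card (Cs ! k)) \<partial>M)" .
    qed
    finally show ?thesis using bound[of K] by simp
  qed
  ultimately show "measure M {w \<in> space M. value_order n X w = Cs} \<le> b"
    unfolding eq by (intro LIMSEQ_le_const2) auto
qed

text \<open>
  Upper bounds for the probabilities of disjoint events that exhaust the space are attained as soon
  as they add up to 1. The bounds do so: for a fixed set partition \<open>A\<close> the factor \<open>gibbs_eppf\<close> is
  constant and the size-biased weights of the orderings of \<open>A\<close> add up to 1.
\<close>
lemma value_order_prob:
  assumes M: "prob_space M" "random_sample M P n X"
    and \<alpha>: "\<alpha> < 1"
    and total: "(\<Sum>A | partition_on {1..n} A. gibbs_eppf \<alpha> V (appearance_sizes A)) = 1"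
    and bound: "\<And>ns K. composition n ns \<Longrightarrow>
      (\<Sum>js\<in>inc_lists 1 (Suc K) (length ns). \<integral>w. (\<Prod>k<length ns. P (js ! k) w ^ (ns ! k)) \<partial>M)
        \<le> size_biased_weight \<alpha> ns * gibbs_eppf \<alpha> V ns"
    and Cs: "Cs \<in> ordered_partitions {1..n}"
  shows "{w \<in> space M. value_order n X w = Cs} \<in> sets M"
    and "measure M {w \<in> space M. value_order n X w = Cs} =
      size_biased_weight \<alpha> (map card Cs) * gibbs_eppf \<alpha> V (map card Cs)"
proof -
  interpret prob_space M by fact
  let ?g = "\<lambda>Cs. size_biased_weight \<alpha> (map card Cs) * gibbs_eppf \<alpha> V (map card Cs)"
  let ?m = "\<lambda>Cs. measure M {w \<in> space M. value_order n X w = Cs}"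
  let ?OP = "ordered_partitions {1..n}"
  have comp: "composition n (map card Ds)" if "Ds \<in> ?OP" for Ds
    using composition_sizes[OF that] by simp
  have meas: "{w \<in> space M. value_order n X w = Ds} \<in> sets M" if "Ds \<in> ?OP" for Ds
    by (rule value_order_prob_le(1)[OF M that, of "?g Ds"]) (use bound[OF comp[OF that]] in simp)
  have le: "?m Ds \<le> ?g Ds" if "Ds \<in> ?OP" for Ds
    by (rule value_order_prob_le(2)[OF M that, of "?g Ds"]) (use bound[OF comp[OF that]] in simp)
  have "(\<Sum>Ds\<in>?OP. ?m Ds) = 1"
    using measure_value_order_sum[OF M(1) meas, of "\<lambda>_. True"] prob_space by simp
  moreover have "(\<Sum>Ds\<in>?OP. ?g Ds) = 1"
  proof -
    have "(\<Sum>Ds\<in>?OP. ?g Ds) = (\<Sum>A | partition_on {1..n} A. \<Sum>Ds\<in>permutations_of_set A. ?g Ds)"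
      using sum_ordered_partitions[of "{1..n}" _ "\<lambda>_. True"] by simp
    also have "\<dots> = (\<Sum>A | partition_on {1..n} A. gibbs_eppf \<alpha> V (appearance_sizes A))"
    proof (intro sum.cong refl)
      fix A assume A: "A \<in> {A. partition_on {1..n} A}"
      have "(\<Sum>Ds\<in>permutations_of_set A. ?g Ds) =
        (\<Sum>Ds\<in>permutations_of_set A. size_biased_weight \<alpha> (map card Ds) * gibbs_eppf \<alpha> V (appearance_sizes A))"
      proof (intro sum.cong refl)
        fix Ds assume "Ds \<in> permutations_of_set A"
        then have "Ds \<in> ?OP" "set Ds = A" using A by (auto simp: ordered_partitions_def permutations_of_set_def)
        then show "?g Ds = size_biased_weight \<alpha> (map card Ds) * gibbs_eppf \<alpha> V (appearance_sizes A)"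
          using gibbs_eppf_perm[OF mset_appearance_sizes] by force
      qed
      also have "\<dots> = gibbs_eppf \<alpha> V (appearance_sizes A)"
      proof -
        have "finite A" "\<forall>C\<in>A. 0 < card C"
          using A finite_elements[of "{1..n}" A]
          by (auto simp: partition_on_def card_gt_0_iff intro: finite_subset)
        then show ?thesis
          using sum_size_biased_weight_orderings[OF \<alpha>, of A card] by (simp add: sum_distrib_right[symmetric])
      qed
      finally show "(\<Sum>Ds\<in>permutations_of_set A. ?g Ds) = gibbs_eppf \<alpha> V (appearance_sizes A)" .
    qed
    finally show ?thesis using total by simp
  qed
  ultimately have "(\<Sum>Ds\<in>?OP. ?g Ds - ?m Ds) = 0" by (simp add: sum_subtractf)
  then have "\<forall>Ds\<in>?OP. ?g Ds - ?m Ds = 0"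
    using le by (subst (asm) sum_nonneg_eq_0_iff) auto
  then show "?m Cs = ?g Cs" using Cs by simp
  show "{w \<in> space M. value_order n X w = Cs} \<in> sets M" by (rule meas[OF Cs])
qed

lemma compositionD:
  "composition n ns \<Longrightarrow> \<forall>m\<in>set ns. 0 < m" "composition n ns \<Longrightarrow> sum_list ns = n"
  by (simp_all add: composition_def)

text \<open>
  Each law is a sum of \<open>value_order_prob\<close> over ordered partitions. For the first, all summands are
  equal; for the others the sum is grouped by the underlying set partition, on which the factor
  \<open>gibbs_eppf\<close> depends only through its appearance-ordered sizes.
\<close>
lemma cluster_size_laws_of_bound:
  assumes M: "prob_space M" "random_sample M P n X"
    and \<alpha>: "\<alpha> < 1" and n: "1 \<le> n" and V: "gibbs_weights \<alpha> V"
    and total: "(\<Sum>A | partition_on {1..n} A. gibbs_eppf \<alpha> V (appearance_sizes A)) = 1"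
    and bound: "\<And>ns K. composition n ns \<Longrightarrow>
      (\<Sum>js\<in>inc_lists 1 (Suc K) (length ns). \<integral>w. (\<Prod>k<length ns. P (js ! k) w ^ (ns ! k)) \<partial>M)
        \<le> size_biased_weight \<alpha> ns * gibbs_eppf \<alpha> V ns"
  shows "cluster_size_laws M \<alpha> (gibbs_eppf \<alpha> V) n X"
proof -
  interpret prob_space M by fact
  let ?p = "gibbs_eppf \<alpha> V"
  let ?OP = "ordered_partitions {1..n}"
  note vo = value_order_prob[OF M \<alpha> total bound]
  note sum = measure_value_order_sum[OF M(1) vo(1)]
  have app: "gibbs_eppf \<alpha> V (map card Cs) = gibbs_eppf \<alpha> V (appearance_sizes (set Cs))" if "Cs \<in> ?OP" for Cs
    using gibbs_eppf_perm[OF mset_appearance_sizes[OF that]] by simp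
  have inc: "measure M {w \<in> space M. N_inc n X w = ns} = multinomial ns * size_biased_weight \<alpha> ns * ?p ns"
    if ns: "composition n ns" for ns
  proof -
    have "measure M {w \<in> space M. N_inc n X w = ns} =
      (\<Sum>Cs | Cs \<in> ?OP \<and> map card Cs = ns. measure M {w \<in> space M. value_order n X w = Cs})"
      unfolding N_inc_eq by (rule sum[of "\<lambda>Cs. map card Cs = ns"])
    also have "\<dots> = (\<Sum>Cs | Cs \<in> ?OP \<and> map card Cs = ns. size_biased_weight \<alpha> ns * ?p ns)"
      using vo(2) by (intro sum.cong refl) auto
    also have "\<dots> = multinomial ns * size_biased_weight \<alpha> ns * ?p ns"
      using card_ordered_partitions[of "{1..n}" ns] compositionD[OF ns] by simp
    finally show ?thesis .
  qed
  have joint: "measure M {w \<in> space M. N_inc n X w = ms \<and> N_app n X w = ns} =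
      multinomial ns * size_biased_weight 0 ns * ?p ns * size_biased_perm_prob \<alpha> ns ms"
    if ns: "composition n ns" for ns ms
  proof -
    let ?\<phi> = "\<lambda>Cs. map card Cs = ms \<and> appearance_sizes (set Cs) = ns"
    have "measure M {w \<in> space M. N_inc n X w = ms \<and> N_app n X w = ns} =
      (\<Sum>Cs | Cs \<in> ?OP \<and> ?\<phi> Cs. measure M {w \<in> space M. value_order n X w = Cs})"
      unfolding N_inc_eq N_app_eq by (rule sum[of ?\<phi>])
    also have "\<dots> = (\<Sum>Cs | Cs \<in> ?OP \<and> ?\<phi> Cs. size_biased_weight \<alpha> (map card Cs) * ?p ns)"
      using vo(2) app by (intro sum.cong refl) auto
    also have "\<dots> = (\<Sum>A | partition_on {1..n} A. \<Sum>Cs | Cs \<in> permutations_of_set A \<and> ?\<phi> Cs.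
        size_biased_weight \<alpha> (map card Cs) * ?p ns)"
      by (rule sum_ordered_partitions) simp
    also have "\<dots> = (\<Sum>A | partition_on {1..n} A. if appearance_sizes A = ns then size_biased_perm_prob \<alpha> ns ms * ?p ns else 0)"
    proof (intro sum.cong refl)
      fix A assume A: "A \<in> {A. partition_on {1..n} A}"
      have "{Cs. Cs \<in> permutations_of_set A \<and> ?\<phi> Cs} =
        (if appearance_sizes A = ns then {Cs. Cs \<in> permutations_of_set A \<and> map card Cs = ms} else {})"
        by (auto simp: permutations_of_set_def)
      then show "(\<Sum>Cs | Cs \<in> permutations_of_set A \<and> ?\<phi> Cs. size_biased_weight \<alpha> (map card Cs) * ?p ns)
        = (if appearance_sizes A = ns then size_biased_perm_prob \<alpha> ns ms * ?p ns else 0)"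
        using A sum_orderings_with_sizes[of "{1..n}" A ns \<alpha> ms] by (simp add: sum_distrib_right[symmetric])
    qed
    also have "\<dots> = (\<Sum>A | partition_on {1..n} A \<and> appearance_sizes A = ns. size_biased_perm_prob \<alpha> ns ms * ?p ns)"
      using finitely_many_partition_on[of "{1..n}"] by (simp add: sum.inter_filter[symmetric])
    also have "\<dots> = multinomial ns * size_biased_weight 0 ns * ?p ns * size_biased_perm_prob \<alpha> ns ms"
      using card_partitions_appearance_sizes[of "{1..n}" ns] compositionD[OF ns] by simp
    finally show ?thesis .
  qed
  have app_law: "measure M {w \<in> space M. N_app n X w = ns} = multinomial ns * size_biased_weight 0 ns * ?p ns"
    if ns: "composition n ns" for ns
  proof -
    have "measure M {w \<in> space M. N_app n X w = ns} =
      (\<Sum>Cs | Cs \<in> ?OP \<and> appearance_sizes (set Cs) = ns. measure M {w \<in> space M. value_order n X w = Cs})"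
      unfolding N_app_eq by (rule sum[of "\<lambda>Cs. appearance_sizes (set Cs) = ns"])
    also have "\<dots> = (\<Sum>Cs | Cs \<in> ?OP \<and> appearance_sizes (set Cs) = ns. size_biased_weight \<alpha> (map card Cs) * ?p ns)"
      using vo(2) app by (intro sum.cong refl) auto
    also have "\<dots> = (\<Sum>A | partition_on {1..n} A. \<Sum>Cs | Cs \<in> permutations_of_set A \<and> appearance_sizes (set Cs) = ns.
        size_biased_weight \<alpha> (map card Cs) * ?p ns)"
      by (rule sum_ordered_partitions) simp
    also have "\<dots> = (\<Sum>A | partition_on {1..n} A. if appearance_sizes A = ns then ?p ns else 0)"
    proof (intro sum.cong refl)
      fix A assume A: "A \<in> {A. partition_on {1..n} A}"
      have "{Cs. Cs \<in> permutations_of_set A \<and> appearance_sizes (set Cs) = ns} =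
        (if appearance_sizes A = ns then permutations_of_set A else {})"
        by (auto simp: permutations_of_set_def)
      moreover have "finite A" "\<forall>C\<in>A. 0 < card C"
        using A finite_elements[of "{1..n}" A]
        by (auto simp: partition_on_def card_gt_0_iff intro: finite_subset)
      ultimately show "(\<Sum>Cs | Cs \<in> permutations_of_set A \<and> appearance_sizes (set Cs) = ns. size_biased_weight \<alpha> (map card Cs) * ?p ns)
        = (if appearance_sizes A = ns then ?p ns else 0)"
        using sum_size_biased_weight_orderings[OF \<alpha>, of A card] by (simp add: sum_distrib_right[symmetric])
    qed
    also have "\<dots> = (\<Sum>A | partition_on {1..n} A \<and> appearance_sizes A = ns. ?p ns)"
      using finitely_many_partition_on[of "{1..n}"] by (simp add: sum.inter_filter[symmetric])
    also have "\<dots> = multinomial ns * size_biased_weight 0 ns * ?p ns"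
      using card_partitions_appearance_sizes[of "{1..n}" ns] compositionD[OF ns] by simp
    finally show ?thesis .
  qed
  have cond: "\<P>(w in M. N_inc n X w = ms \<bar> N_app n X w = ns) = size_biased_perm_prob \<alpha> ns ms"
    if ns: "composition n ns" for ns ms
  proof -
    have "ns \<noteq> []" using ns n by (auto simp: composition_def)
    then have "0 < ?p ns" using gibbs_eppf_pos[OF V \<alpha>] compositionD[OF ns] by simp
    moreover have "0 < size_biased_weight 0 ns" using size_biased_weight_pos[of 0 ns] compositionD[OF ns] by simp
    ultimately show ?thesis
      unfolding cond_prob_def joint[OF ns] app_law[OF ns] using multinomial_pos[of ns] by simp
  qed
  show ?thesis
    unfolding cluster_size_laws_def using inc cond app_law by blast
qed

section \<open>Limit frequencies of a Gibbs partition\<close>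

text \<open>
  Lists each position as often as its multiplicity says, so that a product of powers of frequencies
  becomes a product over a list and can be treated one factor at a time.
\<close>
definition expand :: "nat list \<Rightarrow> nat list \<Rightarrow> nat list" where
  "expand js ns = concat (map2 (\<lambda>j n. replicate n j) js ns)"

lemma funpow_bump: "(bump j 1 ^^ n) c = bump j n c"
proof (induction n)
  case 0
  then show ?case by (simp add: bump_def)
next
  case (Suc n)
  have "bump j 1 (bump j n c) = bump j (Suc n) c"
    by (cases "j < length c") (simp_all add: bump_def list_update_beyond)
  then show ?case using Suc by simp
qed

lemma fold_bump_expand: "fold (\<lambda>l. bump l 1) (expand js ns) c = bumps js ns c"
  by (induction js ns c rule: bumps.induct)
     (simp_all add: expand_def funpow_bump del: One_nat_def)

lemma prod_list_expand:
  "length js = length ns \<Longrightarrow> (\<Prod>l\<leftarrow>expand js ns. f l) = (\<Prod>i<length ns. f (js ! i) ^ (ns ! i) :: real)"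
  by (induction js ns rule: list_induct2)
     (simp_all add: expand_def prod.lessThan_Suc_shift map_replicate_const prod_list_replicate del: prod.lessThan_Suc)

lemma set_expand: "set (expand js ns) \<subseteq> set js"
  by (auto simp: expand_def dest!: set_zip_leftD)

lemma length_fold_bump [simp]: "length (fold (\<lambda>l. bump l 1) ls c) = length c"
  by (induction ls arbitrary: c) auto

lemma fold_bump_pos: "\<forall>m\<in>set c. 0 < m \<Longrightarrow> \<forall>m\<in>set (fold (\<lambda>l. bump l k) ls c). 0 < m"
proof (induction ls arbitrary: c)
  case (Cons l ls)
  then show ?case unfolding fold_Cons o_apply by (intro Cons.IH set_bump_pos)
qed simp

lemma funpow_grow_fold_bump:
  "set ls \<subseteq> {..<length c} \<Longrightarrow>
    (grow ^^ N) (\<lambda>c. h (fold (\<lambda>l. bump l 1) ls c)) c = (grow ^^ N) h (fold (\<lambda>l. bump l 1) ls c)"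
proof (induction ls arbitrary: c)
  case (Cons l ls)
  have "(grow ^^ N) (\<lambda>c. h (fold (\<lambda>l. bump l 1) (l # ls) c)) c
      = (grow ^^ N) (\<lambda>c. (\<lambda>c. h (fold (\<lambda>l. bump l 1) ls c)) (bump l 1 c)) c" by simp
  also have "\<dots> = (grow ^^ N) (\<lambda>c. h (fold (\<lambda>l. bump l 1) ls c)) (bump l 1 c)"
    using Cons.prems by (intro funpow_grow_bump) simp
  also have "\<dots> = (grow ^^ N) h (fold (\<lambda>l. bump l 1) ls (bump l 1 c))"
    using Cons.prems by (intro Cons.IH) simp
  finally show ?case by simp
qed simp

text \<open>
  The EPPF enters only through the weights \<open>V\<close>: after the restricted growth sequences have been
  identified with the partitions, \<open>Q_law\<close> states the law of \<open>Q n\<close> without reference to a choice of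
  an enumeration of the blocks.
\<close>
locale gibbs_frequencies = prob_space M for M :: "'w measure" +
  fixes \<alpha> :: real and V :: "nat \<Rightarrow> nat \<Rightarrow> real"
    and Q :: "nat \<Rightarrow> 'w \<Rightarrow> nat set set" and P :: "nat \<Rightarrow> 'w \<Rightarrow> real"
  assumes \<alpha>: "0 \<le> \<alpha>" "\<alpha> < 1" and V: "gibbs_weights \<alpha> V"
    and Q_partition: "\<And>n w. 1 \<le> n \<Longrightarrow> w \<in> space M \<Longrightarrow> partition_on {1..n} (Q n w)"
    and Q_restrict: "\<And>m n w. 1 \<le> m \<Longrightarrow> m < n \<Longrightarrow> w \<in> space M \<Longrightarrow>
      Q m w = (\<lambda>C. C \<inter> {1..m}) ` Q n w - {{}}"
    and Q_law: "\<And>n a. 1 \<le> n \<Longrightarrow> a \<in> rgs n \<Longrightarrow>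
      {w \<in> space M. Q n w = label_partition a} \<in> sets M \<and> prob {w \<in> space M. Q n w = label_partition a} = gibbs_eppf \<alpha> V (counts a)"
    and P_measurable: "\<And>j. 1 \<le> j \<Longrightarrow> P j \<in> borel_measurable M"
    and P_limit: "size_biased_limit_freqs M Q P"
    and P_bounds: "AE w in M. \<forall>j\<ge>1. 0 < P j w \<and> P j w \<le> 1"
begin

text \<open>
  The restricted growth sequence of the partition \<open>Q n w\<close>. As \<open>n\<close> grows, these words extend one
  another, and letter \<open>x\<close> is the rank of the cluster of element \<open>x + 1\<close>.
\<close>
definition label_word :: "nat \<Rightarrow> 'w \<Rightarrow> nat list" where
  "label_word n w = the_inv_into (rgs n) label_partition (Q n w)"

lemma label_word:
  assumes "1 \<le> n" "w \<in> space M"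
  shows label_word_in: "label_word n w \<in> rgs n" and partition_label_word: "label_partition (label_word n w) = Q n w"
proof -
  have "Q n w \<in> label_partition ` rgs n" using label_partition_surj Q_partition[OF assms] by blast
  then show "label_word n w \<in> rgs n" "label_partition (label_word n w) = Q n w"
    unfolding label_word_def
    by (rule the_inv_into_into[OF inj_on_label_partition _ subset_refl], rule f_the_inv_into_f[OF inj_on_label_partition])
qed

lemma label_word_eq_iff:
  assumes "1 \<le> n" "w \<in> space M" "a \<in> rgs n"
  shows "label_word n w = a \<longleftrightarrow> Q n w = label_partition a"
  using label_word[OF assms(1,2)] assms(3) inj_on_eq_iff[OF inj_on_label_partition[of n]] by metis

lemma take_label_word:
  assumes "1 \<le> m" "m \<le> n" "w \<in> space M"
  shows "take m (label_word n w) = label_word m w"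
proof (cases "m = n")
  case True
  then show ?thesis using length_rgs[OF label_word_in[of n w]] assms by simp
next
  case False
  have n: "label_word n w \<in> rgs n" "label_partition (label_word n w) = Q n w" using label_word[of n w] assms by auto
  have t: "take m (label_word n w) \<in> rgs m" using take_rgs[of "label_word n w" m "n - m"] n(1) assms by simp
  have "label_partition (take m (label_word n w)) = Q m w"
    using Q_restrict[of m n w] label_partition_take[of m "label_word n w"] n False assms length_rgs[OF n(1)] by simp
  then show ?thesis using label_word_eq_iff[OF assms(1,3) t] by simp
qed

lemma label_word_Suc:
  assumes "1 \<le> n" "w \<in> space M"
  shows "label_word (Suc n) w = label_word n w @ [label_word (Suc n) w ! n]"
  using take_label_word[of n "Suc n" w] length_rgs[OF label_word_in[of "Suc n" w]] assms
    take_Suc_conv_app_nth[of n "label_word (Suc n) w"] by simp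

lemma label_word_event:
  assumes "1 \<le> n" "a \<in> rgs n"
  shows "{w \<in> space M. label_word n w = a} \<in> sets M"
    and "prob {w \<in> space M. label_word n w = a} = gibbs_eppf \<alpha> V (counts a)"
proof -
  have "{w \<in> space M. label_word n w = a} = {w \<in> space M. Q n w = label_partition a}"
    using label_word_eq_iff assms by auto
  then show "{w \<in> space M. label_word n w = a} \<in> sets M"
    "prob {w \<in> space M. label_word n w = a} = gibbs_eppf \<alpha> V (counts a)"
    using Q_law[OF assms] by simp_all
qed

lemma count_label_limit:
  "AE w in M. (\<lambda>n. real (count_list (label_word n w) j) / real n) \<longlonglongrightarrow> P (Suc j) w"
proof -
  have eq: "(if Suc j \<le> length (appearance_sizes (Q n w)) then real (appearance_sizes (Q n w) ! (Suc j - 1)) else 0) / real n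
      = real (count_list (label_word n w) j) / real n" if w: "w \<in> space M" for w n
  proof (cases "n = 0")
    case False
    then have n: "1 \<le> n" by simp
    note c = label_word[OF n w]
    have "appearance_sizes (Q n w) = counts (label_word n w)"
      using appearance_sizes_label_partition[OF c(1)] c(2) by simp
    moreover have "count_list (label_word n w) j = 0" if "\<not> j < card (set (label_word n w))"
      using set_rgs[OF c(1)] that by (metis count_list_0_iff lessThan_iff)
    ultimately show ?thesis by (auto simp: Suc_le_eq counts_def)
  qed simp
  have "AE w in M. (\<lambda>n. (if Suc j \<le> length (appearance_sizes (Q n w))
              then real (appearance_sizes (Q n w) ! (Suc j - 1)) else 0) / real n) \<longlonglongrightarrow> P (Suc j) w"
    using P_limit[unfolded size_biased_limit_freqs_def, rule_format, of "Suc j"] by simp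
  with AE_space show ?thesis
  proof eventually_elim
    case (elim w)
    then show ?case by (simp only: eq)
  qed
qed

text \<open>
  Labels start at 0, frequencies at index 1.
\<close>
abbreviation moment_of :: "nat list \<Rightarrow> 'w \<Rightarrow> real" where
  "moment_of ls w \<equiv> (\<Prod>l\<leftarrow>ls. P (Suc l) w)"

lemma moment_of_measurable [measurable]: "moment_of ls \<in> borel_measurable M"
proof (induction ls)
  case (Cons l ls)
  have "P (Suc l) \<in> borel_measurable M" by (rule P_measurable) simp
  then show ?case using Cons by simp
qed simp

lemma moment_of_bounds: "AE w in M. 0 \<le> moment_of ls w \<and> moment_of ls w \<le> 1"
  using P_bounds
proof eventually_elim
  case (elim w)
  show ?case
  proof (induction ls)
    case (Cons l ls)
    have "0 \<le> P (Suc l) w" "P (Suc l) w \<le> 1" using elim by (auto intro: less_imp_le)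
    then show ?case using Cons by (auto intro: mult_le_one)
  qed simp
qed

lemma indicator_moment_integrable:
  assumes "A \<in> sets M"
  shows "integrable M (\<lambda>w. indicator A w * moment_of ls w)"
proof (rule integrable_const_bound[where B = 1])
  show "AE w in M. norm (indicator A w * moment_of ls w) \<le> 1"
    using moment_of_bounds[of ls] by eventually_elim (auto simp: indicator_def)
qed (use assms in measurable)

text \<open>
  Summing over the labels between \<open>n\<close> and \<open>x\<close> expresses the event that a later element has the label
  \<open>j\<close> in terms of complete words.
\<close>
lemma label_event:
  assumes a: "1 \<le> n" "a \<in> rgs n" and j: "j < card (set a)" and x: "n \<le> x"
  defines "D \<equiv> {w \<in> space M. label_word n w = a \<and> label_word (Suc x) w ! x = j}"
  shows "D \<in> sets M"
    and "indicator D w = (\<Sum>b\<in>extensions a (x - n). indicator {w \<in> space M. label_word (Suc x) w = b @ [j]} w :: real)"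
    and "\<And>b. b \<in> extensions a (x - n) \<Longrightarrow> b @ [j] \<in> rgs (Suc x) \<and> j < card (set b)"
proof -
  have b: "b \<in> rgs x \<and> take n b = a" if "b \<in> extensions a (x - n)" for b
    using extensions_in_rgs[OF a(2) that] x by simp
  show bj: "b @ [j] \<in> rgs (Suc x) \<and> j < card (set b)" if "b \<in> extensions a (x - n)" for b
  proof -
    have "set a \<subseteq> set b" using b[OF that] set_take_subset[of n b] by simp
    then have "card (set a) \<le> card (set b)" by (intro card_mono) auto
    then have "j < card (set b)" using j by simp
    then show ?thesis using extensions_SucI[of b "[]" x j] b[OF that] by simp
  qed
  have D: "D = (\<Union>b\<in>extensions a (x - n). {w \<in> space M. label_word (Suc x) w = b @ [j]})"
  proof (intro set_eqI iffI)
    fix w assume w: "w \<in> D"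
    then have "label_word x w \<in> extensions a (x - n)"
      using extensions_eq[OF a(2), of "x - n"] label_word_in[of x w] take_label_word[of n x w] a x by (simp add: D_def)
    moreover have "label_word (Suc x) w = label_word x w @ [j]"
      using label_word_Suc[of x w] w a x by (simp add: D_def)
    ultimately show "w \<in> (\<Union>b\<in>extensions a (x - n). {w \<in> space M. label_word (Suc x) w = b @ [j]})"
      using w by (auto simp: D_def)
  next
    fix w assume "w \<in> (\<Union>b\<in>extensions a (x - n). {w \<in> space M. label_word (Suc x) w = b @ [j]})"
    then obtain c where c: "c \<in> extensions a (x - n)" "w \<in> space M" "label_word (Suc x) w = c @ [j]" by blast
    have "length c = x" "take n c = a" using b[OF c(1)] length_rgs by auto
    then have "label_word n w = a" using take_label_word[of n "Suc x" w] c a x by simp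
    then show "w \<in> D" using c \<open>length c = x\<close> by (simp add: D_def nth_append)
  qed
  show "D \<in> sets M"
    unfolding D using bj by (intro sets.finite_UN finite_extensions label_word_event(1)) auto
  show "indicator D w = (\<Sum>b\<in>extensions a (x - n). indicator {w \<in> space M. label_word (Suc x) w = b @ [j]} w :: real)"
    unfolding D by (rule indicator_UN_disjoint) (auto simp: disjoint_family_on_def)
qed

lemma count_label_word:
  assumes "1 \<le> n" "n \<le> N" "w \<in> space M" "label_word n w = a"
  shows "real (count_list (label_word N w) j) =
    real (count_list a j) + (\<Sum>x\<in>{n..<N}. indicator {w \<in> space M. label_word n w = a \<and> label_word (Suc x) w ! x = j} w)"
  using assms(2)
proof (induction N rule: dec_induct)
  case base
  then show ?case using assms by simp
next
  case (step N)
  have "real (count_list (label_word (Suc N) w) j) = real (count_list (label_word N w) j) + (if label_word (Suc N) w ! N = j then 1 else 0)"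
    using arg_cong[OF label_word_Suc[of N w], of "\<lambda>l. real (count_list l j)"] step assms by simp
  then show ?case using step assms by simp
qed

text \<open>
  The product of frequencies acts like as many additional elements with the labels \<open>ls\<close>. The
  induction removes one factor \<open>P (Suc j)\<close>. If the factor is replaced by the indicator that element
  \<open>x + 1\<close> has label \<open>j\<close>, the expectation does not depend on \<open>x \<ge> n\<close>: by the induction hypothesis, applied
  to words of length \<open>x + 1\<close>, it is the right-hand side summed over the labels between \<open>n\<close> and \<open>x\<close>,
  and that sum collapses by consistency. Averaging the indicators over \<open>x < N\<close> and letting
  \<open>N \<rightarrow> \<infinity>\<close> turns them back into the limit frequency.
\<close>
lemma moment_given_label_word:
  assumes "1 \<le> n" "a \<in> rgs n" "set ls \<subseteq> {..<card (set a)}"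
  shows "(\<integral>w. indicator {w \<in> space M. label_word n w = a} w * moment_of ls w \<partial>M)
    = gibbs_eppf \<alpha> V (fold (\<lambda>l. bump l 1) ls (counts a))"
  using assms
proof (induction ls arbitrary: n a)
  case Nil
  then show ?case using label_word_event by simp
next
  case (Cons j ls n a)
  let ?A = "{w \<in> space M. label_word n w = a}"
  let ?D = "\<lambda>x. {w \<in> space M. label_word n w = a \<and> label_word (Suc x) w ! x = j}"
  define c where "c = gibbs_eppf \<alpha> V (fold (\<lambda>l. bump l 1) (j # ls) (counts a))"
  define d where "d = (\<integral>w. indicator ?A w * moment_of ls w \<partial>M)"
  have A: "?A \<in> sets M" by (rule label_word_event(1)[OF Cons.prems(1,2)])
  have j: "j < card (set a)" using Cons.prems by simp
  \<comment> \<open>The value c is the same for every later position x.\<close>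
  have D: "(\<integral>w. indicator (?D x) w * moment_of ls w \<partial>M) = c" if x: "n \<le> x" for x
  proof -
    note L = label_event[OF Cons.prems(1,2) j x]
    have setb: "set ls \<subseteq> {..<card (set b)}" if "b \<in> extensions a (x - n)" for b
    proof -
      have "set a \<subseteq> set b" using extensions_in_rgs[OF Cons.prems(2) that] set_take_subset[of n b] by simp
      then have "card (set a) \<le> card (set b)" by (intro card_mono) auto
      then show ?thesis using Cons.prems(3) by auto
    qed
    have "(\<integral>w. indicator (?D x) w * moment_of ls w \<partial>M)
      = (\<integral>w. (\<Sum>b\<in>extensions a (x - n). indicator {w \<in> space M. label_word (Suc x) w = b @ [j]} w * moment_of ls w) \<partial>M)"
      by (simp only: L(2) sum_distrib_right)
    also have "\<dots> = (\<Sum>b\<in>extensions a (x - n). \<integral>w. indicator {w \<in> space M. label_word (Suc x) w = b @ [j]} w * moment_of ls w \<partial>M)"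
      using L(3) by (intro Bochner_Integration.integral_sum indicator_moment_integrable label_word_event(1)) auto
    also have "\<dots> = (\<Sum>b\<in>extensions a (x - n). gibbs_eppf \<alpha> V (fold (\<lambda>l. bump l 1) (j # ls) (counts b)))"
    proof (intro sum.cong refl)
      fix b assume b: "b \<in> extensions a (x - n)"
      have ib: "initial_labels b"
        using extensions_in_rgs[OF Cons.prems(2) b] initial_labels_extensions[OF initial_labels_Nil] by blast
      have "card (set b) \<le> card (set (b @ [j]))" by (intro card_mono) auto
      then have "set ls \<subseteq> {..<card (set (b @ [j]))}" using setb[OF b] by (auto dest: order_trans)
      then show "(\<integral>w. indicator {w \<in> space M. label_word (Suc x) w = b @ [j]} w * moment_of ls w \<partial>M)
        = gibbs_eppf \<alpha> V (fold (\<lambda>l. bump l 1) (j # ls) (counts b))"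
        using Cons.IH[of "Suc x" "b @ [j]"] L(3)[OF b] counts_snoc(1)[OF ib, of j] by simp
    qed
    also have "\<dots> = (grow ^^ (x - n)) (\<lambda>c. gibbs_eppf \<alpha> V (fold (\<lambda>l. bump l 1) (j # ls) c)) (counts a)"
      using initial_labels_extensions[OF initial_labels_Nil Cons.prems(2)]
      by (rule sum_extensions[where h = "\<lambda>c. gibbs_eppf \<alpha> V (fold (\<lambda>l. bump l 1) (j # ls) c)"])
    also have "\<dots> = (grow ^^ (x - n)) (gibbs_eppf \<alpha> V) (fold (\<lambda>l. bump l 1) (j # ls) (counts a))"
      using Cons.prems(3) by (intro funpow_grow_fold_bump) simp
    also have "\<dots> = c"
    proof -
      have "fold (\<lambda>l. bump l 1) (j # ls) (counts a) \<noteq> []"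
        using j length_fold_bump[of "j # ls" "counts a"] by (metis length_counts length_0_conv less_nat_zero_code)
      then show ?thesis
        unfolding c_def using set_counts_pos[OF Cons.prems(2)]
        by (intro funpow_grow_gibbs_eppf[OF V] fold_bump_pos)
    qed
    finally show ?thesis .
  qed
  \<comment> \<open>The letters before position n contribute a bounded amount to the average, which vanishes in the limit.\<close>
  let ?f = "\<lambda>N w. indicator ?A w * moment_of ls w * (real (count_list (label_word N w) j) / real N)"
  have eq: "indicator ?A w * moment_of ls w * (real (count_list (label_word N w) j) / real N)
      = (real (count_list a j) * (indicator ?A w * moment_of ls w)
        + (\<Sum>x\<in>{n..<N}. indicator (?D x) w * moment_of ls w)) / real N"
    if "n \<le> N" "w \<in> space M" for N w
  proof (cases "label_word n w = a")
    case True
    have "indicator ?A w = (1 :: real)" using True that(2) by simp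
    moreover have "1 * m * ((r + t) / x) = (r * (1 * m) + t * m) / x" for m r t x :: real
      by (simp add: add_divide_distrib algebra_simps)
    ultimately show ?thesis
      unfolding count_label_word[OF Cons.prems(1) that True, of j] sum_distrib_right[symmetric] by metis
  next
    case False
    then show ?thesis by simp
  qed
  have int: "(\<integral>w. ?f N w \<partial>M) = (real (count_list a j) * d + (real N - real n) * c) / real N" if "n \<le> N" for N
  proof -
    have "(\<integral>w. ?f N w \<partial>M) = (\<integral>w. (real (count_list a j) * (indicator ?A w * moment_of ls w)
        + (\<Sum>x\<in>{n..<N}. indicator (?D x) w * moment_of ls w)) / real N \<partial>M)"
      by (intro Bochner_Integration.integral_cong refl eq that)
    also have "\<dots> = (real (count_list a j) * d + (\<Sum>x\<in>{n..<N}. \<integral>w. indicator (?D x) w * moment_of ls w \<partial>M)) / real N"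
    proof -
      have iA: "integrable M (\<lambda>w. indicator ?A w * moment_of ls w)"
        by (rule indicator_moment_integrable[OF A])
      have iD: "integrable M (\<lambda>w. indicator (?D x) w * moment_of ls w)" if "x \<in> {n..<N}" for x
        using that by (intro indicator_moment_integrable label_event(1)[OF Cons.prems(1,2) j]) simp
      have "(\<integral>w. real (count_list a j) * (indicator ?A w * moment_of ls w)
          + (\<Sum>x\<in>{n..<N}. indicator (?D x) w * moment_of ls w) \<partial>M)
        = real (count_list a j) * d + (\<Sum>x\<in>{n..<N}. \<integral>w. indicator (?D x) w * moment_of ls w \<partial>M)"
        by (simp only: d_def integral_mult_right_zero Bochner_Integration.integral_sum[OF iD]
          Bochner_Integration.integral_add[OF integrable_mult_right[OF iA] Bochner_Integration.integrable_sum[OF iD]])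
      then show ?thesis by (simp only: integral_divide_zero)
    qed
    also have "(\<Sum>x\<in>{n..<N}. \<integral>w. indicator (?D x) w * moment_of ls w \<partial>M) = (\<Sum>x\<in>{n..<N}. c)"
      by (intro sum.cong refl D) simp
    finally show ?thesis using that by (simp add: of_nat_diff)
  qed
  have meas: "?f N \<in> borel_measurable M" if "n \<le> N" for N
  proof -
    have "(\<lambda>w. (real (count_list a j) * (indicator ?A w * moment_of ls w)
        + (\<Sum>x\<in>{n..<N}. indicator (?D x) w * moment_of ls w)) / real N) \<in> borel_measurable M"
      using A label_event(1)[OF Cons.prems(1,2) j]
      by (intro borel_measurable_divide borel_measurable_add borel_measurable_times borel_measurable_sum
          borel_measurable_indicator moment_of_measurable borel_measurable_const) auto
    then show ?thesis
      by (subst measurable_cong[OF eq[OF that]])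
  qed
  have "(\<lambda>N. \<integral>w. ?f (N + n) w \<partial>M) \<longlonglongrightarrow> (\<integral>w. indicator ?A w * moment_of ls w * P (Suc j) w \<partial>M)"
  proof (rule integral_dominated_convergence[where w = "\<lambda>_. 1"])
    show "(\<lambda>w. indicator ?A w * moment_of ls w * P (Suc j) w) \<in> borel_measurable M"
      using A P_measurable[of "Suc j"] by measurable
    show "?f (N + n) \<in> borel_measurable M" for N by (rule meas) simp
    show "AE w in M. (\<lambda>N. ?f (N + n) w) \<longlonglongrightarrow> indicator ?A w * moment_of ls w * P (Suc j) w"
      using count_label_limit[of j]
    proof eventually_elim
      case (elim w)
      then show ?case by (intro tendsto_mult tendsto_const LIMSEQ_ignore_initial_segment)
    qed
    show "AE w in M. norm (?f (N + n) w) \<le> 1" for N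
      using moment_of_bounds[of ls] AE_space
    proof eventually_elim
      case (elim w)
      have "length (label_word (N + n) w) = N + n"
        using length_rgs[OF label_word_in[of "N + n" w]] elim Cons.prems(1) by simp
      then have "count_list (label_word (N + n) w) j \<le> N + n" by (metis count_le_length)
      then have "real (count_list (label_word (N + n) w) j) / real (N + n) \<le> 1"
        by (simp add: divide_le_eq del: of_nat_add)
      then show ?case
        using elim unfolding norm_mult by (intro mult_le_one mult_nonneg_nonneg) (auto simp: indicator_def)
    qed
  qed simp
  moreover have "(\<lambda>N. \<integral>w. ?f (N + n) w \<partial>M) \<longlonglongrightarrow> c"
  proof -
    have "(\<lambda>N. (real (count_list a j) * d + (real N - real n) * c) / real N) \<longlonglongrightarrow> c"
    proof -
      have "(\<lambda>N. (real (count_list a j) * d - real n * c) * (1 / real N) + c) \<longlonglongrightarrow> (real (count_list a j) * d - real n * c) * 0 + c"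
        by (intro tendsto_intros lim_1_over_n)
      moreover have "\<forall>\<^sub>F N in sequentially. (real (count_list a j) * d - real n * c) * (1 / real N) + c
          = (real (count_list a j) * d + (real N - real n) * c) / real N"
        using eventually_gt_at_top[of 0] by eventually_elim (simp add: field_simps)
      ultimately show ?thesis by (auto dest: Lim_transform_eventually)
    qed
    then have "(\<lambda>N. (real (count_list a j) * d + (real (N + n) - real n) * c) / real (N + n)) \<longlonglongrightarrow> c"
      by (rule LIMSEQ_ignore_initial_segment)
    then show ?thesis by (simp only: int[OF le_add2])
  qed
  ultimately have "(\<integral>w. indicator ?A w * moment_of ls w * P (Suc j) w \<partial>M) = c"
    by (rule LIMSEQ_unique)
  then show ?case by (simp add: c_def mult_ac)
qed

lemma eventually_many_clusters:
  "AE w in M. \<forall>\<^sub>F n in sequentially. K \<le> card (set (label_word n w))"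
proof (cases K)
  case (Suc j)
  show ?thesis
    using count_label_limit[of j] P_bounds AE_space
  proof eventually_elim
    case (elim w)
    then have "0 < P (Suc j) w" by simp
    with elim(1) have "\<forall>\<^sub>F n in sequentially. 0 < real (count_list (label_word n w) j) / real n"
      by (rule order_tendstoD)
    with eventually_ge_at_top[of 1] show ?case
    proof eventually_elim
      case (elim n)
      then have "j \<in> set (label_word n w)" by (metis count_list_0_iff div_0 less_irrefl of_nat_0)
      then have "j < card (set (label_word n w))"
        using set_rgs[OF label_word_in[of n w]] elim \<open>w \<in> space M\<close> by blast
      then show ?case by (simp add: Suc)
    qed
  qed
qed simp

text \<open>
  On the event that the first \<open>N\<close> elements form at least \<open>K\<close> clusters, the moments are sums of Gibbs
  probabilities, and the resulting sum is part of one that the size-biased discovery argument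
  bounds, started from the empty list of clusters. The probability of the event tends to 1 as \<open>N\<close>
  grows, since the \<open>K\<close>th limit frequency is positive.
\<close>
lemma moment_sum_le:
  assumes ns: "ns \<noteq> []" "\<forall>m\<in>set ns. 0 < m"
  shows "(\<Sum>js\<in>inc_lists 0 K (length ns). \<integral>w. moment_of (expand js ns) w \<partial>M)
    \<le> size_biased_weight \<alpha> ns * gibbs_eppf \<alpha> V ns"
proof -
  let ?J = "inc_lists 0 K (length ns)"
  let ?S = "\<lambda>w. \<Sum>js\<in>?J. moment_of (expand js ns) w"
  let ?R = "\<lambda>N. {a \<in> rgs N. K \<le> card (set a)}"
  let ?C = "\<lambda>N. \<Union>a\<in>?R N. {w \<in> space M. label_word N w = a}"
  have finR: "finite (?R N)" for N by (rule finite_subset[OF _ finite_extensions[of "[]" N]]) auto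
  have C: "?C N \<in> sets M" if "1 \<le> N" for N
    using that finR by (intro sets.finite_UN label_word_event(1)) auto
  have nonneg: "0 \<le> gibbs_eppf \<alpha> V (bumps js ns (counts a))" if "1 \<le> N" "a \<in> rgs N" for N a js
  proof -
    have "counts a \<noteq> []" using that length_rgs[of a N] by (auto simp: counts_def)
    then have "bumps js ns (counts a) \<noteq> []"
      by (metis fold_bump_expand length_fold_bump length_0_conv)
    moreover have "\<forall>m\<in>set (bumps js ns (counts a)). 0 < m"
      using fold_bump_pos[OF set_counts_pos[OF that(2)]] by (simp add: fold_bump_expand[symmetric])
    ultimately show ?thesis using gibbs_eppf_pos[OF V \<alpha>(2)] by (intro less_imp_le)
  qed
  have le: "(\<integral>w. indicator (?C N) w * ?S w \<partial>M) \<le> size_biased_weight \<alpha> ns * gibbs_eppf \<alpha> V ns" if N: "1 \<le> N" for N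
  proof -
    have "indicator (?C N) w = (\<Sum>a\<in>?R N. indicator {w \<in> space M. label_word N w = a} w :: real)" for w
      using finR by (intro indicator_UN_disjoint) (auto simp: disjoint_family_on_def)
    then have "(\<integral>w. indicator (?C N) w * ?S w \<partial>M) =
      (\<integral>w. (\<Sum>a\<in>?R N. \<Sum>js\<in>?J. indicator {w \<in> space M. label_word N w = a} w * moment_of (expand js ns) w) \<partial>M)"
      by (simp only: sum_product)
    also have "\<dots> = (\<Sum>a\<in>?R N. \<Sum>js\<in>?J. \<integral>w. indicator {w \<in> space M. label_word N w = a} w * moment_of (expand js ns) w \<partial>M)"
    proof -
      have "integrable M (\<lambda>w. indicator {w \<in> space M. label_word N w = a} w * moment_of (expand js ns) w)"
        if "a \<in> ?R N" for a js
        using that N by (intro indicator_moment_integrable label_word_event(1)) auto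
      then show ?thesis
        by (simp only: Bochner_Integration.integral_sum Bochner_Integration.integrable_sum cong: sum.cong)
    qed
    also have "\<dots> = (\<Sum>a\<in>?R N. \<Sum>js\<in>?J. gibbs_eppf \<alpha> V (bumps js ns (counts a)))"
    proof (intro sum.cong refl)
      fix a js assume "a \<in> ?R N" "js \<in> ?J"
      then have "a \<in> rgs N" "set (expand js ns) \<subseteq> {..<card (set a)}"
        using set_expand[of js ns] by (auto simp: inc_lists_def)
      then show "(\<integral>w. indicator {w \<in> space M. label_word N w = a} w * moment_of (expand js ns) w \<partial>M)
          = gibbs_eppf \<alpha> V (bumps js ns (counts a))"
        using moment_given_label_word[OF N] by (simp only: fold_bump_expand)
    qed
    also have "\<dots> \<le> (\<Sum>a\<in>?R N. placements (gibbs_eppf \<alpha> V) 0 ns (counts a))"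
    proof (intro sum_mono)
      fix a assume a: "a \<in> ?R N"
      have "0 \<le> gibbs_eppf \<alpha> V (bumps js ns (counts a))" for js
        using nonneg[OF N] a by simp
      moreover have "?J \<subseteq> inc_lists 0 (length (counts a)) (length ns)" using a by (auto simp: inc_lists_def)
      ultimately show "(\<Sum>js\<in>?J. gibbs_eppf \<alpha> V (bumps js ns (counts a))) \<le> placements (gibbs_eppf \<alpha> V) 0 ns (counts a)"
        unfolding placements_def by (intro sum_mono2) auto
    qed
    also have "\<dots> \<le> (\<Sum>a\<in>rgs N. placements (gibbs_eppf \<alpha> V) 0 ns (counts a))"
    proof (intro sum_mono2)
      fix a assume "a \<in> rgs N - ?R N"
      then have a: "a \<in> rgs N" by simp
      show "0 \<le> placements (gibbs_eppf \<alpha> V) 0 ns (counts a)"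
        unfolding placements_def by (intro sum_nonneg nonneg[OF N a])
    qed auto
    also have "\<dots> = (grow ^^ N) (placements (gibbs_eppf \<alpha> V) 0 ns) []"
      using sum_extensions[of "[]" "placements (gibbs_eppf \<alpha> V) 0 ns" N] by simp
    also have "\<dots> \<le> size_biased_weight \<alpha> ns * gibbs_eppf \<alpha> V ns"
      using funpow_grow_placements_le[OF V \<alpha>, of "[]" ns N] ns by simp
    finally show ?thesis .
  qed
  have "(\<lambda>N. \<integral>w. indicator (?C (Suc N)) w * ?S w \<partial>M) \<longlonglongrightarrow> (\<integral>w. ?S w \<partial>M)"
  proof (rule integral_dominated_convergence[where w = "\<lambda>_. real (card ?J)"])
    show "?S \<in> borel_measurable M" by measurable
    show "(\<lambda>w. indicator (?C (Suc N)) w * ?S w) \<in> borel_measurable M" for N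
      using C[of "Suc N"] by measurable
    have "AE w in M. \<forall>N. norm (indicator (?C (Suc N)) w * ?S w) \<le> real (card ?J)"
    proof -
      have "AE w in M. \<forall>js\<in>?J. 0 \<le> moment_of (expand js ns) w \<and> moment_of (expand js ns) w \<le> 1"
        by (intro AE_finite_allI finite_inc_lists moment_of_bounds)
      then show ?thesis
      proof eventually_elim
        case (elim w)
        have "0 \<le> ?S w" using elim by (intro sum_nonneg) auto
        moreover have "?S w \<le> (\<Sum>js\<in>?J. 1)" using elim by (intro sum_mono) auto
        ultimately show ?case by (auto simp: indicator_def)
      qed
    qed
    then show "AE w in M. norm (indicator (?C (Suc N)) w * ?S w) \<le> real (card ?J)" for N
      by eventually_elim blast
    show "AE w in M. (\<lambda>N. indicator (?C (Suc N)) w * ?S w) \<longlonglongrightarrow> ?S w"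
      using eventually_many_clusters[of K] AE_space
    proof eventually_elim
      case (elim w)
      have "\<forall>\<^sub>F N in sequentially. K \<le> card (set (label_word (Suc N) w))"
        using elim(1) eventually_sequentially_Suc[of "\<lambda>n. K \<le> card (set (label_word n w))"] by blast
      then have "\<forall>\<^sub>F N in sequentially. ?S w = indicator (?C (Suc N)) w * ?S w"
      proof eventually_elim
        case (elim N)
        then have "w \<in> ?C (Suc N)" using label_word_in[of "Suc N" w] \<open>w \<in> space M\<close> by simp
        then show ?case by simp
      qed
      then show ?case by (rule Lim_transform_eventually[OF tendsto_const])
    qed
  qed simp
  then have "(\<integral>w. ?S w \<partial>M) \<le> size_biased_weight \<alpha> ns * gibbs_eppf \<alpha> V ns"
    by (rule LIMSEQ_le_const2) (intro exI[of _ 0] allI impI le, simp)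
  moreover have "(\<integral>w. ?S w \<partial>M) = (\<Sum>js\<in>?J. \<integral>w. moment_of (expand js ns) w \<partial>M)"
    using indicator_moment_integrable[OF sets.top] 
    by (intro Bochner_Integration.integral_sum) (auto cong: Bochner_Integration.integrable_cong)
  ultimately show ?thesis by simp
qed

lemma Gibbs_bound:
  assumes ns: "ns \<noteq> []" "\<forall>m\<in>set ns. 0 < m"
  shows "(\<Sum>js\<in>inc_lists 1 (Suc K) (length ns). \<integral>w. (\<Prod>k<length ns. P (js ! k) w ^ (ns ! k)) \<partial>M)
    \<le> size_biased_weight \<alpha> ns * gibbs_eppf \<alpha> V ns"
proof -
  have "bij_betw (map Suc) (inc_lists 0 K (length ns)) (inc_lists 1 (Suc K) (length ns))"
  proof (rule bij_betw_byWitness[where f' = "map (\<lambda>j. j - 1)"])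
    show "map Suc ` inc_lists 0 K (length ns) \<subseteq> inc_lists 1 (Suc K) (length ns)"
      by (fastforce simp: inc_lists_def sorted_wrt_map)
    show "map (\<lambda>j. j - 1) ` inc_lists 1 (Suc K) (length ns) \<subseteq> inc_lists 0 K (length ns)"
    proof
      fix ks assume "ks \<in> map (\<lambda>j. j - 1) ` inc_lists 1 (Suc K) (length ns)"
      then obtain js where js: "ks = map (\<lambda>j. j - 1) js" "sorted_wrt (<) js" "set js \<subseteq> {1..<Suc K}" "length js = length ns"
        by (auto simp: inc_lists_def)
      have "sorted_wrt (<) ks"
        unfolding js(1) sorted_wrt_map using js(2)
        by (rule sorted_wrt_mono_rel[rotated]) (use js(3) in \<open>auto simp: subset_iff intro!: diff_less_mono\<close>)
      then show "ks \<in> inc_lists 0 K (length ns)" using js by (fastforce simp: inc_lists_def)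
    qed
    show "\<forall>js\<in>inc_lists 1 (Suc K) (length ns). map Suc (map (\<lambda>j. j - 1) js) = js"
      by (auto simp: inc_lists_def subset_iff intro!: map_idI)
  qed (simp add: o_def)
  then have "(\<Sum>js\<in>inc_lists 1 (Suc K) (length ns). \<integral>w. (\<Prod>k<length ns. P (js ! k) w ^ (ns ! k)) \<partial>M)
    = (\<Sum>js\<in>inc_lists 0 K (length ns). \<integral>w. (\<Prod>k<length ns. P (map Suc js ! k) w ^ (ns ! k)) \<partial>M)"
    by (rule sum.reindex_bij_betw[symmetric])
  also have "\<dots> = (\<Sum>js\<in>inc_lists 0 K (length ns). \<integral>w. moment_of (expand js ns) w \<partial>M)"
  proof (intro sum.cong refl Bochner_Integration.integral_cong)
    fix js w assume js: "js \<in> inc_lists 0 K (length ns)"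
    then show "(\<Prod>k<length ns. P (map Suc js ! k) w ^ (ns ! k)) = moment_of (expand js ns) w"
      using prod_list_expand[of js ns "\<lambda>l. P (Suc l) w"] by (simp add: inc_lists_def)
  qed
  also have "\<dots> \<le> size_biased_weight \<alpha> ns * gibbs_eppf \<alpha> V ns"
    by (rule moment_sum_le[OF ns])
  finally show ?thesis .
qed

end

section \<open>GEM frequencies\<close>

text \<open>
  The expectation of \<open>H ^ m * (1 - H) ^ s\<close> for a beta\<open>(a, b)\<close> variable \<open>H\<close>.
\<close>
definition beta_moment :: "real \<Rightarrow> real \<Rightarrow> nat \<Rightarrow> nat \<Rightarrow> real" where
  "beta_moment a b m s = pochhammer a m * pochhammer b s / pochhammer (a + b) (m + s)"

lemma Beta_shift:
  assumes "0 < a" "0 < (b::real)"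
  shows "Beta (a + real m) (b + real s) = beta_moment a b m s * Beta a b"
proof -
  have nz: "a \<notin> \<int>\<^sub>\<le>\<^sub>0" "b \<notin> \<int>\<^sub>\<le>\<^sub>0" "a + b \<notin> \<int>\<^sub>\<le>\<^sub>0"
    using assms by (auto elim!: nonpos_Ints_cases)
  have G: "Gamma (a + real m) = pochhammer a m * Gamma a"
     "Gamma (b + real s) = pochhammer b s * Gamma b"
     "Gamma (a + b + real (m + s)) = pochhammer (a + b) (m + s) * Gamma (a + b)"
    using assms Gamma_real_pos[of a] Gamma_real_pos[of b] Gamma_real_pos[of "a + b"]
    by (simp_all add: pochhammer_Gamma[OF nz(1)] pochhammer_Gamma[OF nz(2)] pochhammer_Gamma[OF nz(3)]
          less_imp_neq[symmetric])
  have "a + real m + (b + real s) = a + b + real (m + s)" by simp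
  then show ?thesis
    unfolding Beta_def beta_moment_def by (simp only: G) (simp add: field_simps)
qed

lemma has_bochner_integral_beta_weight:
  assumes "0 < a" "0 < (b::real)"
  shows "has_bochner_integral lborel
    (\<lambda>x. indicator {0<..<1} x * (x powr (a - 1) * (1 - x) powr (b - 1))) (Beta a b)"
proof (rule has_bochner_integral_nn_integral)
  have "((\<lambda>t. t powr (a - 1) * (1 - t) powr (b - 1)) has_integral Beta a b) {0<..<1}"
    using has_integral_Beta_real[OF assms] by (simp add: has_integral_Icc_iff_Ioo)
  then have "(\<integral>\<^sup>+x. ennreal (x powr (a - 1) * (1 - x) powr (b - 1)) * indicator {0<..<1} x \<partial>lborel) = ennreal (Beta a b)"
    by (rule nn_integral_has_integral_lebesgue'[rotated]) auto
  moreover have "ennreal (x powr (a - 1) * (1 - x) powr (b - 1)) * indicator {0<..<1} x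
      = ennreal (indicator {0<..<1} x * (x powr (a - 1) * (1 - x) powr (b - 1)))" for x
    by (simp add: indicator_def)
  ultimately show "(\<integral>\<^sup>+x. ennreal (indicator {0<..<1} x * (x powr (a - 1) * (1 - x) powr (b - 1))) \<partial>lborel) = ennreal (Beta a b)"
    by simp
qed (use assms in \<open>auto simp: Beta_def Gamma_real_pos\<close>)

lemma beta_distribution_moment:
  assumes "0 < a" "0 < (b::real)"
  shows "has_bochner_integral (beta_distribution a b) (\<lambda>x. x ^ m * (1 - x) ^ s) (beta_moment a b m s)"
proof -
  have B: "0 < Beta a b" using assms by (simp add: Beta_def Gamma_real_pos)
  have "has_bochner_integral lborel
    (\<lambda>x. (indicator {0<..<1} x * (x powr (a + real m - 1) * (1 - x) powr (b + real s - 1))) / Beta a b)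
     (Beta (a + real m) (b + real s) / Beta a b)"
    using assms by (intro has_bochner_integral_divide has_bochner_integral_beta_weight) auto
  moreover have "(indicator {0<..<1} x * (x powr (a + real m - 1) * (1 - x) powr (b + real s - 1))) / Beta a b
      = (indicator {0<..<1} x * (x powr (a - 1) * (1 - x) powr (b - 1)) / Beta a b) *\<^sub>R (x ^ m * (1 - x) ^ s)" for x
  proof (cases "0 < x \<and> x < 1")
    case True
    then have "x powr (a + real m - 1) = x powr (a - 1) * x ^ m"
      using powr_add[of x "a - 1" "real m"] by (simp add: powr_realpow algebra_simps)
    moreover have "(1 - x) powr (b + real s - 1) = (1 - x) powr (b - 1) * (1 - x) ^ s"
      using True powr_add[of "1 - x" "b - 1" "real s"] by (simp add: powr_realpow algebra_simps)
    ultimately show ?thesis by simp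
  qed simp
  moreover have "Beta (a + real m) (b + real s) / Beta a b = beta_moment a b m s"
    using B by (simp add: Beta_shift[OF assms])
  ultimately have "has_bochner_integral lborel
     (\<lambda>x. (indicator {0<..<1} x * (x powr (a - 1) * (1 - x) powr (b - 1)) / Beta a b) *\<^sub>R (x ^ m * (1 - x) ^ s))
     (beta_moment a b m s)" by simp
  then show ?thesis
    unfolding beta_distribution_def using B
    by (intro has_bochner_integral_density) auto
qed

lemma prob_space_beta_distribution:
  assumes "0 < a" "0 < (b::real)"
  shows "prob_space (beta_distribution a b)"
proof
  have B: "0 < Beta a b" using assms by (simp add: Beta_def Gamma_real_pos)
  have "has_bochner_integral (beta_distribution a b) (\<lambda>x. 1 :: real) 1"
    using beta_distribution_moment[OF assms, of 0 0] by (simp add: beta_moment_def)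
  then have "(\<integral>\<^sup>+x. ennreal 1 \<partial>beta_distribution a b) = ennreal 1"
    by (subst nn_integral_eq_integral) (auto simp: has_bochner_integral_iff)
  then show "emeasure (beta_distribution a b) (space (beta_distribution a b)) = 1"
    by simp
qed

lemma sets_beta_distribution [simp, measurable_cong]: "sets (beta_distribution a b) = sets borel"
  by (simp add: beta_distribution_def)

text \<open>
  In the product of \<open>P (js ! k) ^ (ns ! k)\<close>, the exponent with which the stick variable \<open>H i\<close> occurs;
  \<open>exponent_after\<close> below is the exponent of \<open>1 - H i\<close>.
\<close>
definition exponent_at :: "nat list \<Rightarrow> nat list \<Rightarrow> nat \<Rightarrow> nat" where
  "exponent_at js ns i = (\<Sum>k<length ns. if js ! k = i then ns ! k else 0)"

definition exponent_after :: "nat list \<Rightarrow> nat list \<Rightarrow> nat \<Rightarrow> nat" where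
  "exponent_after js ns i = (\<Sum>k<length ns. if i < js ! k then ns ! k else 0)"

lemma exponent_at_Cons: "exponent_at (j # js) (n # ns) i = (if j = i then n else 0) + exponent_at js ns i"
  by (simp add: exponent_at_def sum.lessThan_Suc_shift del: sum.lessThan_Suc cong: if_cong)

lemma exponent_after_Cons: "exponent_after (j # js) (n # ns) i = (if i < j then n else 0) + exponent_after js ns i"
  by (simp add: exponent_after_def sum.lessThan_Suc_shift del: sum.lessThan_Suc cong: if_cong)

lemma exponents_outside:
  assumes "js \<in> inc_lists (Suc m) K (length ns)"
  shows "exponent_at js ns m = 0" "exponent_after js ns m = sum_list ns"
proof -
  have "m < js ! k" if "k < length ns" for k
  proof -
    have "js ! k \<in> {Suc m..<K}" using assms that nth_mem[of k js] by (auto simp: inc_lists_def simp del: nth_mem)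
    then show ?thesis by simp
  qed
  then show "exponent_at js ns m = 0" "exponent_after js ns m = sum_list ns"
    unfolding exponent_at_def exponent_after_def sum_list_sum_nth atLeast0LessThan
    by (auto intro!: sum.cong sum.neutral)
qed

lemma stick_breaking_power_prod:
  assumes "js \<in> inc_lists 1 (Suc K) (length ns)"
  shows "(\<Prod>k<length ns. stick_breaking h (js ! k) ^ (ns ! k)) =
    (\<Prod>i\<in>{1..K}. h i ^ exponent_at js ns i * (1 - h i) ^ exponent_after js ns i)"
proof -
  have js: "js ! k \<in> {1..K}" if "k < length ns" for k
    using assms that nth_mem[of k js] by (auto simp: inc_lists_def simp del: nth_mem)
  have "stick_breaking h j ^ n = (\<Prod>i\<in>{1..K}. h i ^ (if j = i then n else 0) * (1 - h i) ^ (if i < j then n else 0))"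
    if "j \<in> {1..K}" for j n
  proof -
    have "(\<Prod>i\<in>{1..K}. h i ^ (if j = i then n else 0)) = h j ^ n"
      using that prod.delta[of "{1..K}" j "\<lambda>i. h i ^ n"] by (simp add: if_distrib cong: if_cong)
    moreover have "(\<Prod>i\<in>{1..K}. (1 - h i) ^ (if i < j then n else 0)) = (\<Prod>i\<in>{1..<j}. (1 - h i) ^ n)"
      using that by (intro prod.mono_neutral_cong_right) auto
    ultimately show ?thesis
      using that by (simp add: stick_breaking_def prod.distrib power_mult_distrib prod_power_distrib)
  qed
  then have "(\<Prod>k<length ns. stick_breaking h (js ! k) ^ (ns ! k)) =
    (\<Prod>k<length ns. \<Prod>i\<in>{1..K}. h i ^ (if js ! k = i then ns ! k else 0) * (1 - h i) ^ (if i < js ! k then ns ! k else 0))"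
    using js by (intro prod.cong refl) auto
  also have "\<dots> = (\<Prod>i\<in>{1..K}. \<Prod>k<length ns. h i ^ (if js ! k = i then ns ! k else 0) * (1 - h i) ^ (if i < js ! k then ns ! k else 0))"
    by (rule prod.swap)
  also have "\<dots> = (\<Prod>i\<in>{1..K}. h i ^ exponent_at js ns i * (1 - h i) ^ exponent_after js ns i)"
    unfolding exponent_at_def exponent_after_def by (simp add: prod.distrib power_sum)
  finally show ?thesis .
qed

text \<open>
  The product depends on the first \<open>K\<close> stick variables only and factorises over these independent
  variables.
\<close>
lemma GEM_moment:
  assumes "0 \<le> \<alpha>" "\<alpha> < 1" "- \<alpha> < \<theta>" and js: "js \<in> inc_lists 1 (Suc K) (length ns)"
  shows "(\<integral>x. (\<Prod>k<length ns. x (js ! k) ^ (ns ! k)) \<partial>GEM \<alpha> \<theta>) =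
    (\<Prod>i\<in>{1..K}. beta_moment (1 - \<alpha>) (\<theta> + real i * \<alpha>) (exponent_at js ns i) (exponent_after js ns i))"
proof -
  have pos: "0 < 1 - \<alpha>" "0 < \<theta> + real i * \<alpha>" if "1 \<le> i" for i
    using assms that mult_right_mono[of 1 "real i" \<alpha>] by auto
  \<comment> \<open>The maximum makes every B i a probability measure, including B 0, which lies outside the index set.\<close>
  define B where "B i = beta_distribution (1 - \<alpha>) (\<theta> + real (max 1 i) * \<alpha>)" for i
  interpret product_prob_space B "{1..}"
  proof (rule product_prob_spaceI)
    fix i show "prob_space (B i)"
      unfolding B_def using pos[of "max 1 i"] by (intro prob_space_beta_distribution) auto
  qed
  have setsB [measurable_cong]: "sets (B i) = sets borel" for i by (simp add: B_def)
  have PiB: "(\<Pi>\<^sub>M i\<in>{1..}. beta_distribution (1 - \<alpha>) (\<theta> + real i * \<alpha>)) = PiM {1..} B"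
    by (intro PiM_cong refl) (simp add: B_def max_def)
  have comp [measurable]: "(\<lambda>h. h i) \<in> PiM {1..} B \<rightarrow>\<^sub>M borel" if "1 \<le> i" for i
    using measurable_component_singleton[of i "{1..}" B] that measurable_cong_sets[OF refl setsB] by auto
  have sb: "stick_breaking \<in> PiM {1..} B \<rightarrow>\<^sub>M seq_space"
    unfolding stick_breaking_def
  proof (rule measurable_restrict)
    fix j :: nat assume "j \<in> {1..}"
    then show "(\<lambda>h. h j * (\<Prod>i\<in>{1..<j}. 1 - h i)) \<in> borel_measurable (PiM {1..} B)"
      by (intro borel_measurable_times borel_measurable_prod borel_measurable_diff) (auto intro: comp simp del: One_nat_def)
  qed
  have jsk: "1 \<le> js ! k" if "k < length ns" for k
    using js that nth_mem[of k js] by (auto simp: inc_lists_def simp del: nth_mem)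
  have "(\<integral>x. (\<Prod>k<length ns. x (js ! k) ^ (ns ! k)) \<partial>GEM \<alpha> \<theta>) =
     (\<integral>h. (\<Prod>k<length ns. stick_breaking h (js ! k) ^ (ns ! k)) \<partial>PiM {1..} B)"
    unfolding GEM_def PiB
    by (rule integral_distr[OF sb])
       (intro borel_measurable_prod borel_measurable_power measurable_component_singleton, use jsk in auto)
  also have "\<dots> = (\<integral>h. (\<Prod>i\<in>{1..K}. h i ^ exponent_at js ns i * (1 - h i) ^ exponent_after js ns i) \<partial>PiM {1..} B)"
    by (simp only: stick_breaking_power_prod[OF js])
  also have "\<dots> = (\<integral>h. (\<Prod>i\<in>{1..K}. h i ^ exponent_at js ns i * (1 - h i) ^ exponent_after js ns i)
      \<partial>distr (PiM {1..} B) (PiM {1..K} B) (\<lambda>h. restrict h {1..K}))"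
  proof (subst integral_distr)
    show "(\<lambda>h. restrict h {1..K}) \<in> PiM {1..} B \<rightarrow>\<^sub>M PiM {1..K} B"
      by (rule measurable_restrict_subset) auto
    have "(\<lambda>h. h i) \<in> PiM {1..K} B \<rightarrow>\<^sub>M borel" if "i \<in> {1..K}" for i
      using measurable_component_singleton[OF that, of B] measurable_cong_sets[OF refl setsB] by blast
    then show "(\<lambda>h. \<Prod>i\<in>{1..K}. h i ^ exponent_at js ns i * (1 - h i) ^ exponent_after js ns i) \<in> borel_measurable (PiM {1..K} B)"
      by (intro borel_measurable_prod borel_measurable_times borel_measurable_power borel_measurable_diff) auto
  qed simp
  also have "distr (PiM {1..} B) (PiM {1..K} B) (\<lambda>h. restrict h {1..K}) = PiM {1..K} B"
    by (rule distr_PiM_restrict_finite) auto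
  also have "(\<integral>h. (\<Prod>i\<in>{1..K}. h i ^ exponent_at js ns i * (1 - h i) ^ exponent_after js ns i) \<partial>PiM {1..K} B)
     = (\<Prod>i\<in>{1..K}. \<integral>x. x ^ exponent_at js ns i * (1 - x) ^ exponent_after js ns i \<partial>B i)"
    by (rule product_integral_prod)
       (use beta_distribution_moment pos in \<open>auto simp: B_def has_bochner_integral_iff\<close>)
  also have "\<dots> = (\<Prod>i\<in>{1..K}. beta_moment (1 - \<alpha>) (\<theta> + real i * \<alpha>) (exponent_at js ns i) (exponent_after js ns i))"
    by (intro prod.cong refl) (use beta_distribution_moment pos in \<open>auto simp: B_def has_bochner_integral_iff max_def\<close>)
  finally show ?thesis .
qed

lemma prod_shift_Suc: "(\<Prod>i\<in>{1..<Suc k}. f (Suc i)) = (\<Prod>i\<in>{2..<Suc (Suc k)}. (f i :: real))"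
  using prod.shift_bounds_Suc_ivl[of f 1 "Suc k"] by (simp add: numeral_2_eq_2)

text \<open>
  Passing from \<open>\<theta> + \<alpha>\<close> to \<open>\<theta>\<close> shifts the index of the factors \<open>\<theta> + i * \<alpha>\<close>; the Pochhammer symbol
  supplies the factor for \<open>i = 1\<close> and cancels the denominator. For \<open>k = s = 0\<close> both sides are empty
  products.
\<close>
lemma GEM_weights_shift:
  assumes "k = 0 \<longleftrightarrow> s = 0" "0 \<le> \<alpha>" "\<alpha> < 1" "- \<alpha> < \<theta>"
  shows "pochhammer (\<theta> + \<alpha>) s * GEM_weights \<alpha> (\<theta> + \<alpha>) k s = (\<Prod>i\<in>{1..<Suc k}. \<theta> + real i * \<alpha>)"
proof (cases k)
  case 0
  then show ?thesis using assms by (simp add: GEM_weights_def)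
next
  case (Suc l)
  then obtain t where s: "s = Suc t" using assms(1) by (cases s) auto
  have p: "0 < pochhammer (1 + (\<theta> + \<alpha>)) t" using assms by (intro pochhammer_pos) simp
  have "(\<Prod>i\<in>{1..<Suc k}. \<theta> + real i * \<alpha>) = (\<theta> + \<alpha>) * (\<Prod>i\<in>{2..<Suc k}. \<theta> + real i * \<alpha>)"
    by (simp add: Suc prod.atLeast_Suc_lessThan numeral_2_eq_2 del: prod.op_ivl_Suc)
  also have "(\<Prod>i\<in>{2..<Suc k}. \<theta> + real i * \<alpha>) = (\<Prod>i\<in>{1..<k}. \<theta> + \<alpha> + real i * \<alpha>)"
    unfolding Suc using prod_shift_Suc[of "\<lambda>i. \<theta> + real i * \<alpha>" l] by (simp add: algebra_simps del: prod.op_ivl_Suc)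
  finally show ?thesis
    using p unfolding GEM_weights_def s by (simp add: pochhammer_rec add.commute[of 1])
qed

text \<open>
  The first summand belongs to the case that the first stick carries no cluster, the second one to
  the case that it carries the first cluster. With \<open>k\<close> the length and \<open>N\<close> the sum of \<open>n # ns\<close>, the two
  are the fractions \<open>(\<theta> + k * \<alpha>) / (\<theta> + N)\<close> and \<open>(N - k * \<alpha>) / (\<theta> + N)\<close> of the right-hand side.
  If \<open>ns\<close> is empty, \<open>G (\<theta> + \<alpha>) ns\<close> is 1.
\<close>
lemma gibbs_eppf_GEM_rec:
  assumes \<alpha>: "0 \<le> \<alpha>" "\<alpha> < 1" "- \<alpha> < \<theta>" and pos: "\<forall>m\<in>set (n # ns). 0 < m"
  defines "G \<equiv> \<lambda>\<theta> ns. size_biased_weight \<alpha> ns * gibbs_eppf \<alpha> (GEM_weights \<alpha> \<theta>) ns"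
  shows "beta_moment (1 - \<alpha>) (\<theta> + \<alpha>) 0 (n + sum_list ns) * G (\<theta> + \<alpha>) (n # ns)
      + beta_moment (1 - \<alpha>) (\<theta> + \<alpha>) n (sum_list ns) * G (\<theta> + \<alpha>) ns = G \<theta> (n # ns)"
proof -
  define k where "k = length ns"
  define s where "s = sum_list ns"
  define g where "g = (\<Prod>m\<leftarrow>ns. pochhammer (1 - \<alpha>) (m - 1))"
  define w where "w = size_biased_weight \<alpha> ns"
  define S where "S = real n + real s - (1 + real k) * \<alpha>"
  \<comment> \<open>The numerator of the weight of n # ns, whose length is Suc k and whose sum is Suc N.\<close>
  define Pr where "Pr = (\<Prod>i\<in>{1..<Suc k}. \<theta> + real i * \<alpha>)"
  obtain m where n: "n = Suc m" using pos by (cases n) auto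
  define N where "N = m + s"
  define p where "p = pochhammer (1 + \<theta>) N"
  have p: "0 < p" unfolding p_def using \<alpha> by (intro pochhammer_pos) simp
  have nz: "0 < \<theta> + real (Suc N)" using \<alpha> by simp
  have ks: "k = 0 \<longleftrightarrow> s = 0"
    using pos by (cases ns) (auto simp: k_def s_def)
  have S: "0 < S" "(\<Sum>m\<leftarrow>n # ns. real m - \<alpha>) = S"
    using sum_list_size_minus_pos[OF \<alpha>(2) pos]
    by (simp_all only: sum_list_minus_const) (simp_all add: S_def k_def s_def algebra_simps)
  have pS: "pochhammer (1 + \<theta>) (Suc N) = (\<theta> + real (Suc N)) * p"
    by (simp add: p_def pochhammer_Suc algebra_simps)
  have bm: "beta_moment (1 - \<alpha>) (\<theta> + \<alpha>) x y =
      pochhammer (1 - \<alpha>) x * pochhammer (\<theta> + \<alpha>) y / ((\<theta> + real (Suc N)) * p)"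
    if "x + y = Suc N" for x y
    using that pS by (simp add: beta_moment_def)
  have b1: "beta_moment (1 - \<alpha>) (\<theta> + \<alpha>) 0 (Suc N) * GEM_weights \<alpha> (\<theta> + \<alpha>) (Suc k) (Suc N)
      = Pr * (\<theta> + real (Suc k) * \<alpha>) / ((\<theta> + real (Suc N)) * p)"
  proof -
    have "pochhammer (\<theta> + \<alpha>) (Suc N) * GEM_weights \<alpha> (\<theta> + \<alpha>) (Suc k) (Suc N) = Pr * (\<theta> + real (Suc k) * \<alpha>)"
      using GEM_weights_shift[of "Suc k" "Suc N" \<alpha> \<theta>] \<alpha>
      by (simp only: Pr_def prod.atLeastLessThan_Suc[of 1 "Suc k"]) simp
    then show ?thesis by (simp add: bm)
  qed
  have b2: "beta_moment (1 - \<alpha>) (\<theta> + \<alpha>) n s * GEM_weights \<alpha> (\<theta> + \<alpha>) k s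
      = pochhammer (1 - \<alpha>) n * Pr / ((\<theta> + real (Suc N)) * p)"
  proof -
    have "pochhammer (\<theta> + \<alpha>) s * GEM_weights \<alpha> (\<theta> + \<alpha>) k s = Pr"
      using GEM_weights_shift[OF ks \<alpha>] by (simp only: Pr_def)
    then show ?thesis by (simp add: bm n N_def mult.assoc)
  qed
  have pn: "pochhammer (1 - \<alpha>) n = (real n - \<alpha>) * pochhammer (1 - \<alpha>) m"
    by (simp add: n pochhammer_Suc algebra_simps)
  have wn: "size_biased_weight \<alpha> (n # ns) = (real n - \<alpha>) / S * w"
    unfolding size_biased_weight_Cons S(2) w_def ..
  have e1: "gibbs_eppf \<alpha> V (n # ns) = V (Suc k) (Suc N) * (pochhammer (1 - \<alpha>) m * g)"
    and e2: "gibbs_eppf \<alpha> V ns = V k s * g" for V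
    by (simp_all add: gibbs_eppf_prod_list k_def s_def g_def n N_def)
  have "beta_moment (1 - \<alpha>) (\<theta> + \<alpha>) 0 (n + s) * G (\<theta> + \<alpha>) (n # ns)
      + beta_moment (1 - \<alpha>) (\<theta> + \<alpha>) n s * G (\<theta> + \<alpha>) ns
    = (beta_moment (1 - \<alpha>) (\<theta> + \<alpha>) 0 (Suc N) * GEM_weights \<alpha> (\<theta> + \<alpha>) (Suc k) (Suc N))
        * ((real n - \<alpha>) / S * w * (pochhammer (1 - \<alpha>) m * g))
     + (beta_moment (1 - \<alpha>) (\<theta> + \<alpha>) n s * GEM_weights \<alpha> (\<theta> + \<alpha>) k s) * (w * g)"
    unfolding G_def e1 e2 wn w_def[symmetric] by (simp add: n N_def)
  also have "\<dots> = Pr * (real n - \<alpha>) * w * pochhammer (1 - \<alpha>) m * g / p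
      * (((\<theta> + real (Suc k) * \<alpha>) + S) / (S * (\<theta> + real (Suc N))))"
  proof -
    have alg: "Pr * A / (T * p) * (x / S * w * (h * g)) + x * h * Pr / (T * p) * (w * g)
        = Pr * x * w * h * g / p * ((A + S) / (S * T))" if "T \<noteq> 0" for A T x h
      using that S(1) p by (simp add: field_simps)
    show ?thesis unfolding b1 b2 pn by (rule alg) (use nz in simp)
  qed
  also have "(\<theta> + real (Suc k) * \<alpha>) + S = \<theta> + real (Suc N)"
    by (simp add: S_def n N_def algebra_simps)
  also have "Pr * (real n - \<alpha>) * w * pochhammer (1 - \<alpha>) m * g / p
      * ((\<theta> + real (Suc N)) / (S * (\<theta> + real (Suc N)))) = G \<theta> (n # ns)"
    unfolding G_def e1 wn GEM_weights_def Pr_def[symmetric] using nz by (simp add: p_def mult_ac)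
  finally show ?thesis by (simp add: s_def)
qed

text \<open>
  Discarding the first \<open>m - 1\<close> sticks of a GEM\<open>(\<alpha>, \<theta>)\<close> sequence and renormalising leaves a
  GEM\<open>(\<alpha>, \<theta> + (m - 1) * \<alpha>)\<close> sequence; the left-hand side is the sum of its moments over the sticks
  \<open>m\<close> to \<open>K - 1\<close>.
\<close>
lemma GEM_inc_sum_le:
  assumes \<alpha>: "0 \<le> \<alpha>" "\<alpha> < 1" "- \<alpha> < \<theta>" and "\<forall>n\<in>set ns. 0 < n" "1 \<le> m"
  shows "(\<Sum>js\<in>inc_lists m K (length ns). \<Prod>i\<in>{m..<K}.
      beta_moment (1 - \<alpha>) (\<theta> + real i * \<alpha>) (exponent_at js ns i) (exponent_after js ns i))
    \<le> size_biased_weight \<alpha> ns * gibbs_eppf \<alpha> (GEM_weights \<alpha> (\<theta> + real (m - 1) * \<alpha>)) ns"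
  using assms(4,5)
proof (induction "K - m" arbitrary: m ns)
  case (0 m ns)
  show ?case
  proof (cases ns)
    case Nil
    then show ?thesis using 0 by (simp add: gibbs_eppf_def GEM_weights_def)
  next
    case (Cons n r)
    have "- \<alpha> < \<theta> + real (m - 1) * \<alpha>" using \<alpha> by (intro less_le_trans[OF \<alpha>(3)]) simp
    then have "0 < gibbs_eppf \<alpha> (GEM_weights \<alpha> (\<theta> + real (m - 1) * \<alpha>)) ns"
      using 0 Cons by (intro gibbs_eppf_pos gibbs_weights_GEM_weights \<alpha>) auto
    then show ?thesis
      using 0 Cons size_biased_weight_pos[OF \<alpha>(2), of ns] by (simp add: inc_lists_empty)
  qed
next
  case (Suc d m ns)
  define b where "b = (\<lambda>js ns i. beta_moment (1 - \<alpha>) (\<theta> + real i * \<alpha>) (exponent_at js ns i) (exponent_after js ns i))"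
  define \<theta>' where "\<theta>' = \<theta> + real (m - 1) * \<alpha>"
  have \<theta>': "- \<alpha> < \<theta>'" unfolding \<theta>'_def using \<alpha> by (intro less_le_trans[OF \<alpha>(3)]) simp
  have m: "\<theta> + real m * \<alpha> = \<theta>' + \<alpha>" "\<theta> + real (Suc m - 1) * \<alpha> = \<theta>' + \<alpha>"
    using Suc.prems(2) by (simp_all add: \<theta>'_def of_nat_diff algebra_simps)
  have mK: "m < K" using Suc.hyps(2) by simp
  have IH: "(\<Sum>js\<in>inc_lists (Suc m) K (length r). \<Prod>i\<in>{Suc m..<K}. b js r i)
     \<le> size_biased_weight \<alpha> r * gibbs_eppf \<alpha> (GEM_weights \<alpha> (\<theta>' + \<alpha>)) r"
    if "\<forall>n\<in>set r. 0 < n" for r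
    using Suc.hyps(1)[of "Suc m" r] Suc.hyps(2) that unfolding b_def m by simp
  show ?case
  proof (cases ns)
    case Nil
    then show ?thesis
      by (simp add: gibbs_eppf_def GEM_weights_def exponent_at_def exponent_after_def beta_moment_def)
  next
    case (Cons n r)
    have split: "(\<Prod>i\<in>{m..<K}. b js ms i) = b js ms m * (\<Prod>i\<in>{Suc m..<K}. b js ms i)" for js ms
      using mK by (simp add: prod.atLeast_Suc_lessThan)
    have "(\<Sum>js\<in>inc_lists m K (length ns). \<Prod>i\<in>{m..<K}. b js ns i)
       = (\<Sum>js\<in>inc_lists (Suc m) K (length ns). \<Prod>i\<in>{m..<K}. b js ns i)
       + (\<Sum>js\<in>inc_lists (Suc m) K (length r). \<Prod>i\<in>{m..<K}. b (m # js) ns i)"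
      using sum_inc_lists_Suc[OF mK, where k = "length r"] by (simp add: Cons)
    also have "(\<Sum>js\<in>inc_lists (Suc m) K (length ns). \<Prod>i\<in>{m..<K}. b js ns i)
      = beta_moment (1 - \<alpha>) (\<theta>' + \<alpha>) 0 (sum_list ns) * (\<Sum>js\<in>inc_lists (Suc m) K (length ns). \<Prod>i\<in>{Suc m..<K}. b js ns i)"
      unfolding sum_distrib_left split by (intro sum.cong refl) (simp add: b_def exponents_outside m)
    also have "(\<Sum>js\<in>inc_lists (Suc m) K (length r). \<Prod>i\<in>{m..<K}. b (m # js) ns i)
      = beta_moment (1 - \<alpha>) (\<theta>' + \<alpha>) n (sum_list r) * (\<Sum>js\<in>inc_lists (Suc m) K (length r). \<Prod>i\<in>{Suc m..<K}. b js r i)"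
    proof -
      have "b (m # js) ns m = beta_moment (1 - \<alpha>) (\<theta>' + \<alpha>) n (sum_list r)" if "js \<in> inc_lists (Suc m) K (length r)" for js
        using exponents_outside[OF that] by (simp add: b_def m Cons exponent_at_Cons exponent_after_Cons)
      moreover have "b (m # js) ns i = b js r i" if "i \<in> {Suc m..<K}" for js i
        using that by (simp add: b_def Cons exponent_at_Cons exponent_after_Cons)
      ultimately show ?thesis
        unfolding sum_distrib_left split by (intro sum.cong refl) simp
    qed
    also have "beta_moment (1 - \<alpha>) (\<theta>' + \<alpha>) 0 (sum_list ns) * (\<Sum>js\<in>inc_lists (Suc m) K (length ns). \<Prod>i\<in>{Suc m..<K}. b js ns i)
      + beta_moment (1 - \<alpha>) (\<theta>' + \<alpha>) n (sum_list r) * (\<Sum>js\<in>inc_lists (Suc m) K (length r). \<Prod>i\<in>{Suc m..<K}. b js r i)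
      \<le> beta_moment (1 - \<alpha>) (\<theta>' + \<alpha>) 0 (sum_list ns) * (size_biased_weight \<alpha> ns * gibbs_eppf \<alpha> (GEM_weights \<alpha> (\<theta>' + \<alpha>)) ns)
      + beta_moment (1 - \<alpha>) (\<theta>' + \<alpha>) n (sum_list r) * (size_biased_weight \<alpha> r * gibbs_eppf \<alpha> (GEM_weights \<alpha> (\<theta>' + \<alpha>)) r)"
    proof -
      have "0 \<le> beta_moment (1 - \<alpha>) (\<theta>' + \<alpha>) x y" for x y
        unfolding beta_moment_def using \<alpha> \<theta>'
        by (intro divide_nonneg_nonneg mult_nonneg_nonneg less_imp_le[OF pochhammer_pos]) auto
      then show ?thesis
        using Suc.prems Cons by (intro add_mono mult_left_mono IH) auto
    qed
    also have "\<dots> = size_biased_weight \<alpha> ns * gibbs_eppf \<alpha> (GEM_weights \<alpha> \<theta>') ns"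
      using gibbs_eppf_GEM_rec[OF \<alpha>(1,2) \<theta>', of n r] Suc.prems Cons by simp
    finally show ?thesis by (simp add: b_def \<theta>'_def)
  qed
qed

lemma GEM_bound:
  assumes "0 \<le> \<alpha>" "\<alpha> < 1" "- \<alpha> < \<theta>"
    and P: "\<And>j. 1 \<le> j \<Longrightarrow> P j \<in> borel_measurable M"
    and distr: "distr M seq_space (freq_seq P) = GEM \<alpha> \<theta>"
    and ns: "\<forall>n\<in>set ns. 0 < n"
  shows "(\<Sum>js\<in>inc_lists 1 (Suc K) (length ns). \<integral>w. (\<Prod>k<length ns. P (js ! k) w ^ (ns ! k)) \<partial>M)
    \<le> size_biased_weight \<alpha> ns * gibbs_eppf \<alpha> (GEM_weights \<alpha> \<theta>) ns"
proof -
  have "(\<integral>w. (\<Prod>k<length ns. P (js ! k) w ^ (ns ! k)) \<partial>M) = (\<Prod>i\<in>{1..<Suc K}.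
      beta_moment (1 - \<alpha>) (\<theta> + real i * \<alpha>) (exponent_at js ns i) (exponent_after js ns i))"
    if js: "js \<in> inc_lists 1 (Suc K) (length ns)" for js
  proof -
    have jsk: "1 \<le> js ! k" if "k < length ns" for k
      using js that nth_mem[of k js] by (auto simp: inc_lists_def simp del: nth_mem)
    have "freq_seq P \<in> M \<rightarrow>\<^sub>M seq_space" by (rule measurable_restrict) (simp add: P)
    then have "(\<integral>x. (\<Prod>k<length ns. x (js ! k) ^ (ns ! k)) \<partial>GEM \<alpha> \<theta>)
       = (\<integral>w. (\<Prod>k<length ns. freq_seq P w (js ! k) ^ (ns ! k)) \<partial>M)"
      unfolding distr[symmetric]
      by (rule integral_distr)
         (intro borel_measurable_prod borel_measurable_power measurable_component_singleton, use jsk in auto)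
    also have "\<dots> = (\<integral>w. (\<Prod>k<length ns. P (js ! k) w ^ (ns ! k)) \<partial>M)"
      by (intro Bochner_Integration.integral_cong refl prod.cong) (use jsk in auto)
    finally show ?thesis
      using GEM_moment[OF assms(1-3) js] by (simp add: atLeastLessThanSuc_atLeastAtMost)
  qed
  then show ?thesis
    using GEM_inc_sum_le[OF assms(1-3) ns, of 1 "Suc K"] by simp
qed

section \<open>Sampling from Gibbs frequencies\<close>

lemma (in gibbs_frequencies) first_weight_eq_1: "V 1 1 = 1"
proof -
  have "label_word 1 w = [0]" if "w \<in> space M" for w
    using label_word_in[of 1 w] that by (auto simp: numeral_eq_Suc)
  then have "{w \<in> space M. label_word 1 w = [0]} = space M" by blast
  moreover have "[0] \<in> rgs 1" using extensions_SucI[of "[]" "[]" 0 0] by simp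
  ultimately have "gibbs_eppf \<alpha> V (counts [0]) = 1"
    using label_word_event(2)[of 1 "[0]"] prob_space by simp
  then show ?thesis by (simp add: counts_def gibbs_eppf_def)
qed

text \<open>
  The event \<open>Q n w = label_partition a\<close> has the probability prescribed by the EPPF for the enumeration of
  the blocks by least elements, in which the block sizes are \<open>counts a\<close>.
\<close>
lemma gibbs_frequenciesI:
  assumes M: "prob_space M" and \<alpha>: "0 \<le> \<alpha>" "\<alpha> < 1"
    and P: "\<And>j. 1 \<le> j \<Longrightarrow> P j \<in> borel_measurable M"
    and ex: "exchangeable_partition M Q p"
    and V: "gibbs_weights \<alpha> V" "\<And>n ns. 1 \<le> n \<Longrightarrow> composition n ns \<Longrightarrow> p ns = gibbs_eppf \<alpha> V ns"
    and lim: "size_biased_limit_freqs M Q P" and proper: "proper_freqs M P"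
  shows "gibbs_frequencies M \<alpha> V Q P"
proof -
  interpret prob_space M by fact
  have Qm: "Q n \<in> M \<rightarrow>\<^sub>M count_space {A. partition_on {1..n} A}" if "1 \<le> n" for n
    using ex that by (simp add: exchangeable_partition_def)
  show ?thesis
  proof unfold_locales
    fix n :: nat and w assume "1 \<le> n" "w \<in> space M"
    then show "partition_on {1..n} (Q n w)" using measurable_space[OF Qm] by simp
  next
    fix m n :: nat and w assume "1 \<le> m" "m < n" "w \<in> space M"
    then show "Q m w = (\<lambda>C. C \<inter> {1..m}) ` Q n w - {{}}"
      using ex unfolding exchangeable_partition_def by blast
  next
    fix n :: nat and a assume n: "1 \<le> n" and a: "a \<in> rgs n"
    have pt: "partition_on {1..n} (label_partition a)" using partition_on_label_partition[of a] length_rgs[OF a] by simp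
    have "{w \<in> space M. Q n w = label_partition a} = Q n -` {label_partition a} \<inter> space M" by auto
    then have "{w \<in> space M. Q n w = label_partition a} \<in> sets M"
      using measurable_sets[OF Qm[OF n], of "{label_partition a}"] pt by simp
    moreover have "prob {w \<in> space M. Q n w = label_partition a} = gibbs_eppf \<alpha> V (counts a)"
    proof -
      define Cs where "Cs = sorted_key_list_of_set Min (label_partition a)"
      have Cs: "set Cs = label_partition a" "distinct Cs"
        unfolding Cs_def using sorted_key_list_of_set_props[OF inj_on_Min_partition[OF pt]]
          finite_elements[OF _ pt] by auto
      have sizes: "map card Cs = counts a"
        by (simp add: Cs_def sorted_key_list_of_set_label_partition[OF a] counts_def card_label_block)
      have "prob {w \<in> space M. Q n w = set Cs} = p (map card Cs)"
        using ex n Cs pt unfolding exchangeable_partition_def by metis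
      moreover have "composition n (counts a)"
        using set_counts_pos[OF a] sum_list_counts[OF a] by (simp add: composition_def)
      ultimately show ?thesis using V(2)[OF n] Cs(1) sizes by simp
    qed
    ultimately show "{w \<in> space M. Q n w = label_partition a} \<in> sets M \<and>
        prob {w \<in> space M. Q n w = label_partition a} = gibbs_eppf \<alpha> V (counts a)" ..
  next
    show "AE w in M. \<forall>j\<ge>1. 0 < P j w \<and> P j w \<le> 1"
      using proper unfolding proper_freqs_def
    proof eventually_elim
      case (elim w)
      have "P j w \<le> 1" if "1 \<le> j" for j
        using finite_sum_le_has_sum[of "\<lambda>j. P j w" "{1..}" 1 "{j}"] elim that
        by (auto intro: less_imp_le)
      then show ?case using elim by blast
    qed
  qed (use \<alpha> V P lim in auto)
qed

theorem theorem3p1: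
  fixes M :: "'w measure" and \<alpha> :: real and n :: nat
    and P :: "nat \<Rightarrow> 'w \<Rightarrow> real" and X :: "nat \<Rightarrow> 'w \<Rightarrow> nat"
  assumes "prob_space M" and "0 \<le> \<alpha>" and "\<alpha> < 1" and "1 \<le> n"
    and "random_sample M P n X"
  shows "(\<forall>Q p. gibbs_partition M \<alpha> Q p \<and> size_biased_limit_freqs M Q P \<and> proper_freqs M P \<longrightarrow>
            cluster_size_laws M \<alpha> p n X) \<and>
         (\<forall>\<theta>. - \<alpha> < \<theta> \<and> distr M seq_space (freq_seq P) = GEM \<alpha> \<theta> \<longrightarrow>
            cluster_size_laws M \<alpha> (gibbs_eppf \<alpha> (GEM_weights \<alpha> \<theta>)) n X)"
proof -
  have P: "P j \<in> borel_measurable M" if "1 \<le> j" for j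
    using assms(5) that by (simp add: random_sample_def)
  have ne: "ns \<noteq> []" "\<forall>m\<in>set ns. 0 < m" if "composition n ns" for ns
    using that assms(4) by (auto simp: composition_def)
  have laws: "cluster_size_laws M \<alpha> (gibbs_eppf \<alpha> V) n X"
    if "gibbs_weights \<alpha> V" "V 1 1 = 1"
      and "\<And>ns K. ns \<noteq> [] \<Longrightarrow> \<forall>m\<in>set ns. 0 < m \<Longrightarrow>
        (\<Sum>js\<in>inc_lists 1 (Suc K) (length ns). \<integral>w. (\<Prod>k<length ns. P (js ! k) w ^ (ns ! k)) \<partial>M)
        \<le> size_biased_weight \<alpha> ns * gibbs_eppf \<alpha> V ns" for V
    using that ne
    by (intro cluster_size_laws_of_bound[OF assms(1,5,3,4)] sum_gibbs_eppf_partitions assms(4)) blast+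
  show ?thesis
  proof (intro conjI allI impI)
    fix Q p assume Qp: "gibbs_partition M \<alpha> Q p \<and> size_biased_limit_freqs M Q P \<and> proper_freqs M P"
    then obtain V where eppf: "gibbs_weights \<alpha> V" "\<And>n ns. 1 \<le> n \<Longrightarrow> composition n ns \<Longrightarrow> p ns = gibbs_eppf \<alpha> V ns"
      unfolding gibbs_partition_def by blast
    have "exchangeable_partition M Q p" using Qp by (simp add: gibbs_partition_def)
    then interpret gibbs_frequencies M \<alpha> V Q P
      using Qp by (intro gibbs_frequenciesI[OF assms(1-3) P _ eppf]) auto
    have "cluster_size_laws M \<alpha> (gibbs_eppf \<alpha> V) n X"
      by (rule laws[OF eppf(1) first_weight_eq_1 Gibbs_bound])
    then show "cluster_size_laws M \<alpha> p n X"
      unfolding cluster_size_laws_def using eppf(2)[OF assms(4)] by simp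
  next
    fix \<theta> assume \<theta>: "- \<alpha> < \<theta> \<and> distr M seq_space (freq_seq P) = GEM \<alpha> \<theta>"
    show "cluster_size_laws M \<alpha> (gibbs_eppf \<alpha> (GEM_weights \<alpha> \<theta>)) n X"
    proof (rule laws)
      show "gibbs_weights \<alpha> (GEM_weights \<alpha> \<theta>)"
        using assms(2,3) \<theta> by (intro gibbs_weights_GEM_weights) auto
      show "GEM_weights \<alpha> \<theta> 1 1 = 1" by (simp add: GEM_weights_def)
      fix ns :: "nat list" and K
      assume "\<forall>m\<in>set ns. 0 < m"
      with \<theta> show "(\<Sum>js\<in>inc_lists 1 (Suc K) (length ns). \<integral>w. (\<Prod>k<length ns. P (js ! k) w ^ (ns ! k)) \<partial>M)
          \<le> size_biased_weight \<alpha> ns * gibbs_eppf \<alpha> (GEM_weights \<alpha> \<theta>) ns"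
        by (intro GEM_bound[OF assms(2,3) _ P]) simp_all
    qed
  qed
qed

end
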